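(* Let $p$ be a prime and $k$ a field of characteristic $p$. Let $P$ be a non-trivial finite abelian $p$-group and $E$ an abelian $p'$-subgroup of $\mathrm{Aut}(P)$. Let $\alpha\in Z^2(E;k^\times)$, inflated to $P\rtimes E$ via the canonical surjection $P\rtimes E\to E$. Suppose that $[P,E]=P$. Then: (i) Every class in $\mathrm{HH}^1(k_\alpha(P\rtimes E))$ is represented by a derivation on $k_\alpha(P\rtimes E)$ with image contained in the Jacobson radical $J(k_\alpha(P\rtimes E))$. (ii) If the $\mathbb{F}_pE$-module $P/\Phi(P)$ is multiplicity free, then the Lie algebra $\mathrm{HH}^1(k_\alpha(P\rtimes E))$ is solvable. Conversely, if $p$ is odd and $\mathrm{HH}^1(k_\alpha(P\rtimes E))$ is solvable, then the $\mathbb{F}_pE$-module $P/\Phi(P)$ is multiplicity free.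
   Context: A $p'$-subgroup is a finite subgroup of order prime to $p$. $[P,E]$ is the subgroup of $P$ generated by all elements $({}^eu)u^{-1}$ with $u\in P$, $e\in E$. For a finite group $G$ and $\alpha\in Z^2(G;k^\times)$ (with $G$ acting trivially on $k^\times$), the twisted group algebra $k_\alpha G$ has $k$-basis $\{\hat g\mid g\in G\}$ and multiplication $\hat g\hat h=\alpha(g,h)\widehat{gh}$ extended bilinearly. The inflation of $\alpha\in Z^2(E;k^\times)$ to $P\rtimes E$ (again denoted $\alpha$) is $\alpha(ux,vy)=\alpha(x,y)$ for $u,v\in P$, $x,y\in E$. $\Phi(P)$ is the Frattini subgroup, the smallest normal subgroup of $P$ with elementary abelian quotient; the action of $E$ makes $P/\Phi(P)$ a semisimple $\mathbb{F}_pE$-module. A semisimple module is multiplicity free if it is a direct sum of pairwise non-isomorphic simple modules. For a $k$-algebra $A$, $\mathrm{HH}^1(A)=\mathrm{Der}(A)/\mathrm{IDer}(A)$ ($k$-linear derivations modulo inner derivations), with Lie bracket induced by $[f,g]=f\circ g-g\circ f$. *)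

theory Defs
  imports
    "HOL-Computational_Algebra.Computational_Algebra"
    "HOL-Number_Theory.Residues"
    "HOL-Algebra.Algebra"
begin

section \<open>Groups\<close>

definition aut_group :: "('a, 'm) monoid_scheme \<Rightarrow> ('a \<Rightarrow> 'a) set \<Rightarrow> ('a \<Rightarrow> 'a) monoid" where
  "aut_group P E = (AutoGroup P)\<lparr>carrier := E\<rparr>"

definition semidirect ::
  "('a, 'm) monoid_scheme \<Rightarrow> ('a \<Rightarrow> 'a) set \<Rightarrow> ('a \<times> ('a \<Rightarrow> 'a)) monoid" where
  "semidirect P E =
    \<lparr>carrier = carrier P \<times> E,
     monoid.mult = (\<lambda>(u, x) (v, y). (u \<otimes>\<^bsub>P\<^esub> x v, x \<otimes>\<^bsub>aut_group P E\<^esub> y)),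
     one = (\<one>\<^bsub>P\<^esub>, \<one>\<^bsub>aut_group P E\<^esub>)\<rparr>"

definition comm_aut :: "('a, 'm) monoid_scheme \<Rightarrow> ('a \<Rightarrow> 'a) set \<Rightarrow> 'a set" where
  "comm_aut P E = generate P {e u \<otimes>\<^bsub>P\<^esub> inv\<^bsub>P\<^esub> u | e u. e \<in> E \<and> u \<in> carrier P}"

definition elementary_abelian :: "nat \<Rightarrow> ('a, 'm) monoid_scheme \<Rightarrow> bool" where
  "elementary_abelian p G \<longleftrightarrow> comm_group G \<and> (\<forall>x\<in>carrier G. x [^]\<^bsub>G\<^esub> p = \<one>\<^bsub>G\<^esub>)"

text \<open>For a finite \<open>p\<close>-group, the intersection is the smallest normal subgroup with
  elementary abelian quotient: a finite intersection of such subgroups is again one.\<close>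
definition frattini :: "nat \<Rightarrow> ('a, 'm) monoid_scheme \<Rightarrow> 'a set" where
  "frattini p G = \<Inter>{N. N \<lhd> G \<and> elementary_abelian p (G Mod N)}"

section \<open>Twisted group algebras\<close>

text \<open>The values of cochains outside \<open>carrier G\<close> are irrelevant.\<close>
definition two_cocycle :: "('g, 'm) monoid_scheme \<Rightarrow> ('g \<Rightarrow> 'g \<Rightarrow> 'k::field) \<Rightarrow> bool" where
  "two_cocycle G \<alpha> \<longleftrightarrow>
    (\<forall>x\<in>carrier G. \<forall>y\<in>carrier G. \<alpha> x y \<noteq> 0) \<and>
    (\<forall>x\<in>carrier G. \<forall>y\<in>carrier G. \<forall>z\<in>carrier G.
      \<alpha> x y * \<alpha> (x \<otimes>\<^bsub>G\<^esub> y) z = \<alpha> x (y \<otimes>\<^bsub>G\<^esub> z) * \<alpha> y z)"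

text \<open>An element of the algebra is its coefficient function with respect to the basis
  indexed by \<open>carrier G\<close>, extended by \<open>0\<close> outside \<open>carrier G\<close>; \<open>G\<close> is meant to be finite.
  As \<open>\<alpha>\<close> need not be normalised, the unit is \<open>\<alpha>(1,1)\<^sup>-\<^sup>1\<close> times the basis element of
  \<open>1\<close>.\<close>
definition twisted_group_algebra ::
  "('g, 'm) monoid_scheme \<Rightarrow> ('g \<Rightarrow> 'g \<Rightarrow> 'k::field) \<Rightarrow> ('k, 'g \<Rightarrow> 'k) module" where
  "twisted_group_algebra G \<alpha> =
    \<lparr>carrier = {a. \<forall>g. g \<notin> carrier G \<longrightarrow> a g = 0},
     monoid.mult = (\<lambda>a b g. \<Sum>(x, y)\<in>{(x, y). x \<in> carrier G \<and> y \<in> carrier G \<and> x \<otimes>\<^bsub>G\<^esub> y = g}.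
       a x * b y * \<alpha> x y),
     one = (\<lambda>g. if g = \<one>\<^bsub>G\<^esub> then inverse (\<alpha> \<one>\<^bsub>G\<^esub> \<one>\<^bsub>G\<^esub>) else 0),
     ring.zero = (\<lambda>_. 0),
     add = (\<lambda>a b g. a g + b g),
     module.smult = (\<lambda>c a g. c * a g)\<rparr>"

definition inflate :: "('e \<Rightarrow> 'e \<Rightarrow> 'k) \<Rightarrow> 'u \<times> 'e \<Rightarrow> 'u \<times> 'e \<Rightarrow> 'k" where
  "inflate \<alpha> g h = \<alpha> (snd g) (snd h)"

definition twisted_semidirect ::
  "('a, 'm) monoid_scheme \<Rightarrow> ('a \<Rightarrow> 'a) set \<Rightarrow> (('a \<Rightarrow> 'a) \<Rightarrow> ('a \<Rightarrow> 'a) \<Rightarrow> 'k::field) \<Rightarrow>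
    ('k, 'a \<times> ('a \<Rightarrow> 'a) \<Rightarrow> 'k) module" where
  "twisted_semidirect P E \<alpha> = twisted_group_algebra (semidirect P E) (inflate \<alpha>)"

section \<open>Jacobson radical\<close>

definition left_ideal :: "'a set \<Rightarrow> ('a, 'm) ring_scheme \<Rightarrow> bool" where
  "left_ideal I R \<longleftrightarrow>
    additive_subgroup I R \<and> (\<forall>r\<in>carrier R. \<forall>x\<in>I. r \<otimes>\<^bsub>R\<^esub> x \<in> I)"

definition maximal_left_ideal :: "'a set \<Rightarrow> ('a, 'm) ring_scheme \<Rightarrow> bool" where
  "maximal_left_ideal I R \<longleftrightarrow>
    left_ideal I R \<and> I \<noteq> carrier R \<and>
    (\<forall>J. left_ideal J R \<and> I \<subseteq> J \<longrightarrow> J = I \<or> J = carrier R)"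

definition jacobson_radical :: "('a, 'm) ring_scheme \<Rightarrow> 'a set" where
  "jacobson_radical R = carrier R \<inter> \<Inter>{I. maximal_left_ideal I R}"

section \<open>Lie algebras over a field\<close>

record ('k, 'l) lie_algebra = "'l partial_object" +
  lie_zero :: 'l
  lie_add :: "'l \<Rightarrow> 'l \<Rightarrow> 'l"
  lie_scale :: "'k \<Rightarrow> 'l \<Rightarrow> 'l"
  lie_bracket :: "'l \<Rightarrow> 'l \<Rightarrow> 'l"

definition lie_subspace :: "('k, 'l, 'm) lie_algebra_scheme \<Rightarrow> 'l set \<Rightarrow> bool" where
  "lie_subspace L W \<longleftrightarrow>
    W \<subseteq> carrier L \<and> lie_zero L \<in> W \<and>
    (\<forall>x\<in>W. \<forall>y\<in>W. lie_add L x y \<in> W) \<and> (\<forall>c. \<forall>x\<in>W. lie_scale L c x \<in> W)"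

definition lie_span :: "('k, 'l, 'm) lie_algebra_scheme \<Rightarrow> 'l set \<Rightarrow> 'l set" where
  "lie_span L S = \<Inter>{W. lie_subspace L W \<and> S \<subseteq> W}"

definition lie_derived :: "('k, 'l, 'm) lie_algebra_scheme \<Rightarrow> 'l set \<Rightarrow> 'l set" where
  "lie_derived L W = lie_span L {lie_bracket L x y | x y. x \<in> W \<and> y \<in> W}"

definition lie_solvable :: "('k, 'l, 'm) lie_algebra_scheme \<Rightarrow> bool" where
  "lie_solvable L \<longleftrightarrow> (\<exists>n. (lie_derived L ^^ n) (carrier L) = {lie_zero L})"

definition lie_coset :: "('k, 'l, 'm) lie_algebra_scheme \<Rightarrow> 'l set \<Rightarrow> 'l \<Rightarrow> 'l set" where
  "lie_coset L I x = {lie_add L x i | i. i \<in> I}"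

definition lie_quotient ::
  "('k, 'l, 'm) lie_algebra_scheme \<Rightarrow> 'l set \<Rightarrow> ('k, 'l set) lie_algebra" where
  "lie_quotient L I =
    \<lparr>carrier = lie_coset L I ` carrier L,
     lie_zero = lie_coset L I (lie_zero L),
     lie_add = (\<lambda>S T. \<Union>x\<in>S. \<Union>y\<in>T. lie_coset L I (lie_add L x y)),
     lie_scale = (\<lambda>c S. \<Union>x\<in>S. lie_coset L I (lie_scale L c x)),
     lie_bracket = (\<lambda>S T. \<Union>x\<in>S. \<Union>y\<in>T. lie_coset L I (lie_bracket L x y))\<rparr>"

section \<open>First Hochschild cohomology\<close>

text \<open>Here \<open>A\<close> is a \<open>k\<close>-algebra, all of type \<open>'k\<close> acting as scalars. Linear maps on \<open>A\<close>
  are extensional functions, so that maps agreeing on \<open>carrier A\<close> are equal.\<close>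

definition derivations :: "('k, 'b, 'm) module_scheme \<Rightarrow> ('b \<Rightarrow> 'b) set" where
  "derivations A =
    {D \<in> carrier A \<rightarrow>\<^sub>E carrier A.
      (\<forall>a\<in>carrier A. \<forall>b\<in>carrier A. D (a \<oplus>\<^bsub>A\<^esub> b) = D a \<oplus>\<^bsub>A\<^esub> D b) \<and>
      (\<forall>c. \<forall>a\<in>carrier A. D (c \<odot>\<^bsub>A\<^esub> a) = c \<odot>\<^bsub>A\<^esub> D a) \<and>
      (\<forall>a\<in>carrier A. \<forall>b\<in>carrier A.
        D (a \<otimes>\<^bsub>A\<^esub> b) = (D a \<otimes>\<^bsub>A\<^esub> b) \<oplus>\<^bsub>A\<^esub> (a \<otimes>\<^bsub>A\<^esub> D b))}"

definition inner_derivations :: "('k, 'b, 'm) module_scheme \<Rightarrow> ('b \<Rightarrow> 'b) set" where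
  "inner_derivations A =
    {(\<lambda>a\<in>carrier A. (c \<otimes>\<^bsub>A\<^esub> a) \<ominus>\<^bsub>A\<^esub> (a \<otimes>\<^bsub>A\<^esub> c)) | c. c \<in> carrier A}"

definition derivation_lie_algebra ::
  "('k, 'b, 'm) module_scheme \<Rightarrow> ('k, 'b \<Rightarrow> 'b) lie_algebra" where
  "derivation_lie_algebra A =
    \<lparr>carrier = derivations A,
     lie_zero = (\<lambda>a\<in>carrier A. \<zero>\<^bsub>A\<^esub>),
     lie_add = (\<lambda>f g. \<lambda>a\<in>carrier A. f a \<oplus>\<^bsub>A\<^esub> g a),
     lie_scale = (\<lambda>c f. \<lambda>a\<in>carrier A. c \<odot>\<^bsub>A\<^esub> f a),
     lie_bracket = (\<lambda>f g. \<lambda>a\<in>carrier A. f (g a) \<ominus>\<^bsub>A\<^esub> g (f a))\<rparr>"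

definition HH1 :: "('k, 'b, 'm) module_scheme \<Rightarrow> ('k, ('b \<Rightarrow> 'b) set) lie_algebra" where
  "HH1 A = lie_quotient (derivation_lie_algebra A) (inner_derivations A)"

section \<open>Modules\<close>

text \<open>The untwisted group ring \<open>R G\<close> of a finite group \<open>G\<close> over a commutative ring given by
  a record; it provides \<open>\<bbbF>\<^sub>pE\<close>, as there is no type \<open>\<bbbF>\<^sub>p\<close> for a variable prime \<open>p\<close>.\<close>
definition group_ring ::
  "('r, 'n) ring_scheme \<Rightarrow> ('g, 'm) monoid_scheme \<Rightarrow> ('g \<Rightarrow> 'r) ring" where
  "group_ring R G =
    \<lparr>carrier = carrier G \<rightarrow>\<^sub>E carrier R,
     monoid.mult = (\<lambda>a b. \<lambda>g\<in>carrier G.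
       finsum R (\<lambda>(x, y). a x \<otimes>\<^bsub>R\<^esub> b y)
         {(x, y). x \<in> carrier G \<and> y \<in> carrier G \<and> x \<otimes>\<^bsub>G\<^esub> y = g}),
     one = (\<lambda>g\<in>carrier G. if g = \<one>\<^bsub>G\<^esub> then \<one>\<^bsub>R\<^esub> else \<zero>\<^bsub>R\<^esub>),
     ring.zero = (\<lambda>g\<in>carrier G. \<zero>\<^bsub>R\<^esub>),
     add = (\<lambda>a b. \<lambda>g\<in>carrier G. a g \<oplus>\<^bsub>R\<^esub> b g)\<rparr>"

definition simple_module :: "('r, 'n) ring_scheme \<Rightarrow> ('r, 'b, 'm) module_scheme \<Rightarrow> bool" where
  "simple_module R M \<longleftrightarrow>
    module R M \<and> carrier M \<noteq> {\<zero>\<^bsub>M\<^esub>} \<and>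
    (\<forall>H. submodule H R M \<longrightarrow> H = {\<zero>\<^bsub>M\<^esub>} \<or> H = carrier M)"

definition module_isomorphic ::
  "('r, 'n) ring_scheme \<Rightarrow> ('r, 'b, 'm) module_scheme \<Rightarrow> ('r, 'c, 'l) module_scheme \<Rightarrow> bool" where
  "module_isomorphic R M N \<longleftrightarrow>
    (\<exists>h. bij_betw h (carrier M) (carrier N) \<and>
      (\<forall>x\<in>carrier M. \<forall>y\<in>carrier M. h (x \<oplus>\<^bsub>M\<^esub> y) = h x \<oplus>\<^bsub>N\<^esub> h y) \<and>
      (\<forall>r\<in>carrier R. \<forall>x\<in>carrier M. h (r \<odot>\<^bsub>M\<^esub> x) = r \<odot>\<^bsub>N\<^esub> h x))"

definition direct_sum ::
  "('r, 'n) ring_scheme \<Rightarrow> ('r, 'b, 'm) module_scheme \<Rightarrow> 'b set set \<Rightarrow> bool" where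
  "direct_sum R M \<S> \<longleftrightarrow>
    finite \<S> \<and> (\<forall>N\<in>\<S>. submodule N R M) \<and>
    (\<forall>m\<in>carrier M. \<exists>!f. f \<in> (\<Pi>\<^sub>E N\<in>\<S>. N) \<and> m = finsum M f \<S>)"

text \<open>Only finite direct sums are considered, which loses nothing for a finite module.\<close>
definition multiplicity_free :: "('r, 'n) ring_scheme \<Rightarrow> ('r, 'b, 'm) module_scheme \<Rightarrow> bool" where
  "multiplicity_free R M \<longleftrightarrow>
    (\<exists>\<S>. direct_sum R M \<S> \<and>
      (\<forall>N\<in>\<S>. simple_module R (M\<lparr>carrier := N\<rparr>)) \<and>
      (\<forall>N\<in>\<S>. \<forall>N'\<in>\<S>. N \<noteq> N' \<longrightarrow>
        \<not> module_isomorphic R (M\<lparr>carrier := N\<rparr>) (M\<lparr>carrier := N'\<rparr>)))"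

definition FpE :: "nat \<Rightarrow> ('a, 'm) monoid_scheme \<Rightarrow> ('a \<Rightarrow> 'a) set \<Rightarrow> (('a \<Rightarrow> 'a) \<Rightarrow> int) ring" where
  "FpE p P E = group_ring (residue_ring (int p)) (aut_group P E)"

text \<open>\<open>P/\<Phi>(P)\<close> written additively: \<open>\<Sum>\<^sub>e r\<^sub>e e\<close> sends a coset \<open>C\<close> to the product of the
  powers of \<open>e ` C\<close> with exponents \<open>r\<^sub>e \<in> {0..p-1}\<close>. The multiplicative fields \<open>mult\<close> and \<open>one\<close> of
  the record play no role for modules.\<close>
definition frattini_quotient ::
  "nat \<Rightarrow> ('a, 'm) monoid_scheme \<Rightarrow> ('a \<Rightarrow> 'a) set \<Rightarrow> (('a \<Rightarrow> 'a) \<Rightarrow> int, 'a set) module" where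
  "frattini_quotient p P E =
    (let Q = P Mod frattini p P in
     \<lparr>carrier = carrier Q,
      monoid.mult = undefined,
      one = undefined,
      ring.zero = \<one>\<^bsub>Q\<^esub>,
      add = (\<otimes>\<^bsub>Q\<^esub>),
      module.smult = (\<lambda>r C. finprod Q (\<lambda>e. (e ` C) [^]\<^bsub>Q\<^esub> r e) E)\<rparr>)"

end

theory Submission
  imports Defs "HOL-Library.Function_Algebras"
begin

text \<open>
  Let \<open>A\<close> be the twisted group algebra, let \<open>J\<close> be its ideal generated by the augmentation ideal
  of \<open>kP\<close>, and grade \<open>A\<close> by \<open>E\<close>. As \<open>|E|\<close> is invertible in \<open>k\<close>, every derivation is, up to
  an inner one, zero on \<open>k\<^sub>\<alpha>E\<close>, so it is given by an \<open>E\<close>-equivariant derivation from \<open>kP\<close> to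
  \<open>A\<close>. Its component at \<open>y \<in> E\<close> amounts to a map \<open>d\<close> from \<open>P\<close> to \<open>kP\<close> with
  \<open>d(uv) = \<theta>(v) d(u) + d(v)\<close>, where \<open>\<theta>(v) = v\<^sup>-\<^sup>1 y(v)\<close>.

  If \<open>y \<noteq> 1\<close>, then \<open>P = C\<^sub>P(y) \<times> [P,y]\<close> and \<open>\<theta>\<close> is bijective on \<open>[P,y]\<close>, so that \<open>d\<close> is a
  coboundary there; on \<open>C\<^sub>P(y)\<close> its values are annihilated by the augmentation ideal of \<open>[P,y]\<close>
  and hence lie in \<open>J\<^sup>2\<close>. If \<open>y = 1\<close>, the augmentation of \<open>d\<close> is an \<open>E\<close>-invariant
  homomorphism from \<open>P\<close> to \<open>k\<close>, which is trivial as \<open>[P,E] = P\<close>. Hence every class is represented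
  by a derivation into \<open>J\<close> that modulo \<open>J\<^sup>2\<close> is an \<open>E\<close>-endomorphism of
  \<open>V = k \<otimes> P/\<Phi>(P)\<close>.

  The derivations into \<open>J\<^sup>m\<close> and \<open>J\<^sup>n\<close> have commutators into \<open>J\<^sup>m\<^sup>+\<^sup>n\<^sup>-\<^sup>1\<close>, so only the Lie
  algebra of \<open>E\<close>-endomorphisms of \<open>V\<close> matters for solvability. If \<open>P/\<Phi>(P)\<close> is multiplicity free,
  it is a cyclic module over the commutative ring \<open>\<bbbF>\<^sub>pE\<close>, and these endomorphisms commute.
  Otherwise two isomorphic summands yield \<open>\<ss>\<ll>\<^sub>2\<close>, which is perfect for odd \<open>p\<close>; its elements lift
  to \<open>E\<close>-equivariant derivations of \<open>kP\<close>, and none of these but \<open>0\<close> is inner on \<open>A\<close>.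
\<close>

section \<open>Twisted group algebras\<close>

text \<open>A bracket of derivations into J need not gain a power of J, while one of derivations
  into J^2 always does. So the whole question is decided modulo J^2, and no component of degree y
  other than 1 may be visible there. This is delicate for p = 2: the sum over the elements of a
  group of order 2 may lie outside J^2. The coprime action settles it, because y permutes [P,y] and
  so fixes the product of its elements, but has no nontrivial fixed point in [P,y].

  The Jacobson radical is never computed. With q = |P| one has (u - 1)^q = u^q - 1 = 0, so J is
  nilpotent and lies in every maximal left ideal; this inclusion is all that part (i) uses.

  For the converse the lifts are built with values in kP. Elements of degree 1 commute with kP, so
  an inner derivation has no degree 1 part there, and a lift that is inner must vanish on P.\<close>

definition fscale :: "'k::field \<Rightarrow> ('b \<Rightarrow> 'k) \<Rightarrow> 'b \<Rightarrow> 'k" where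
  "fscale c a = (\<lambda>g. c * a g)"

lemma fscale_apply [simp]: "fscale c a g = c * a g"
  by (simp add: fscale_def)

text \<open>The algebra sits inside the space of all coefficient functions. Its carrier, the powers
  of J and the solution sets of linear conditions become subspaces there, and linear identities can
  be checked by span induction.\<close>

interpretation fsp: vector_space "fscale :: 'k::field \<Rightarrow> ('b \<Rightarrow> 'k) \<Rightarrow> 'b \<Rightarrow> 'k"
  by standard (auto simp: fun_eq_iff algebra_simps)

lemma sum_apply: "sum f A g = (\<Sum>i\<in>A. f i g)" for f :: "'i \<Rightarrow> 'b \<Rightarrow> 'k::comm_monoid_add"
  by (induction A rule: infinite_finite_induct) auto

definition delta :: "'b \<Rightarrow> 'b \<Rightarrow> 'k::field" where
  "delta g = (\<lambda>h. if h = g then 1 else 0)"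

locale twisted_algebra = group G for G :: "('g, 'm) monoid_scheme" (structure) +
  fixes \<alpha> :: "'g \<Rightarrow> 'g \<Rightarrow> 'k::field"
  assumes fin_G: "finite (carrier G)" and cocycle: "two_cocycle G \<alpha>"
begin

abbreviation "A \<equiv> twisted_group_algebra G \<alpha>"

text \<open>Convolution with the second factor solved for: a single sum over
  \<open>carrier G\<close>, so that later computations are reindexings by translations.\<close>

definition star :: "('g \<Rightarrow> 'k) \<Rightarrow> ('g \<Rightarrow> 'k) \<Rightarrow> 'g \<Rightarrow> 'k" (infixl "\<star>" 70) where
  "a \<star> b = (\<lambda>g. if g \<in> carrier G
     then \<Sum>x\<in>carrier G. a x * b (inv x \<otimes> g) * \<alpha> x (inv x \<otimes> g) else 0)"

lemma cocycle_eq: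
  assumes "x \<in> carrier G" "y \<in> carrier G" "z \<in> carrier G"
  shows "\<alpha> x y * \<alpha> (x \<otimes> y) z = \<alpha> x (y \<otimes> z) * \<alpha> y z"
  using cocycle assms unfolding two_cocycle_def by blast

lemma inv_mult_cancel:
  assumes "x \<in> carrier G" "y \<in> carrier G"
  shows "x \<otimes> (inv x \<otimes> y) = y" "inv x \<otimes> (x \<otimes> y) = y"
  using assms by (simp_all add: m_assoc[symmetric])

lemma cocycle_nonzero: "x \<in> carrier G \<Longrightarrow> y \<in> carrier G \<Longrightarrow> \<alpha> x y \<noteq> 0"
  using cocycle unfolding two_cocycle_def by blast

text \<open>The cocycle need not be normalised. Dividing the identities at (1,1,x) and (x,1,1) by a
  nonzero value is what replaces normalisation.\<close>

lemma cocycle_one: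
  assumes "x \<in> carrier G"
  shows "\<alpha> \<one> x = \<alpha> \<one> \<one>" "\<alpha> x \<one> = \<alpha> \<one> \<one>"
  using cocycle_eq[of \<one> \<one> x] cocycle_eq[of x \<one> \<one>] cocycle_nonzero[of \<one> x] cocycle_nonzero[of x \<one>] assms by auto

lemma A_carrier: "a \<in> carrier A \<longleftrightarrow> (\<forall>g. g \<notin> carrier G \<longrightarrow> a g = 0)"
  by (simp add: twisted_group_algebra_def)

lemma A_mult: "a \<otimes>\<^bsub>A\<^esub> b = a \<star> b"
proof (rule ext)
  fix g
  let ?S = "{(x, y). x \<in> carrier G \<and> y \<in> carrier G \<and> x \<otimes> y = g}"
  have "(\<Sum>(x, y)\<in>?S. a x * b y * \<alpha> x y)
      = (\<Sum>x\<in>carrier G. a x * b (inv x \<otimes> g) * \<alpha> x (inv x \<otimes> g))" if g: "g \<in> carrier G"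
    using g by (intro sum.reindex_bij_witness[of _ "\<lambda>x. (x, inv x \<otimes> g)" fst])
      (auto simp: inv_mult_cancel)
  moreover have "(\<Sum>(x, y)\<in>?S. a x * b y * \<alpha> x y) = 0" if "g \<notin> carrier G"
    using that by (intro sum.neutral) auto
  ultimately show "(a \<otimes>\<^bsub>A\<^esub> b) g = (a \<star> b) g"
    by (cases "g \<in> carrier G") (simp_all add: twisted_group_algebra_def star_def)
qed

lemma A_add: "a \<oplus>\<^bsub>A\<^esub> b = a + b"
  by (auto simp: twisted_group_algebra_def)

lemma A_zero: "\<zero>\<^bsub>A\<^esub> = 0"
  by (auto simp: twisted_group_algebra_def)

lemma A_smult: "c \<odot>\<^bsub>A\<^esub> a = fscale c a"
  by (auto simp: twisted_group_algebra_def fscale_def)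

lemma A_one: "\<one>\<^bsub>A\<^esub> = fscale (inverse (\<alpha> \<one> \<one>)) (delta \<one>)"
  by (auto simp: twisted_group_algebra_def fscale_def delta_def)

lemma star_add_left: "(a + b) \<star> c = a \<star> c + b \<star> c"
  by (auto simp: star_def fun_eq_iff distrib_right sum.distrib)

lemma star_add_right: "a \<star> (b + c) = a \<star> b + a \<star> c"
  by (auto simp: star_def fun_eq_iff distrib_left distrib_right sum.distrib)

lemma star_diff_left: "(a - b) \<star> c = a \<star> c - b \<star> c"
  by (auto simp: star_def fun_eq_iff algebra_simps sum_subtractf)

lemma star_diff_right: "a \<star> (b - c) = a \<star> b - a \<star> c"
  by (auto simp: star_def fun_eq_iff algebra_simps sum_subtractf)

lemma star_zero [simp]: "a \<star> 0 = 0" "0 \<star> a = 0"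
  by (auto simp: star_def fun_eq_iff)

lemma star_minus: "a \<star> (- b) = - (a \<star> b)" "(- a) \<star> b = - (a \<star> b)"
  by (auto simp: star_def fun_eq_iff sum_negf)

lemma star_fscale_left [simp]: "fscale c a \<star> b = fscale c (a \<star> b)"
  by (auto simp: star_def fun_eq_iff sum_distrib_left mult_ac)

lemma star_fscale_right [simp]: "a \<star> fscale c b = fscale c (a \<star> b)"
  by (auto simp: star_def fun_eq_iff sum_distrib_left mult_ac)

lemma star_sum_left: "sum f I \<star> b = (\<Sum>i\<in>I. f i \<star> b)"
  by (induction I rule: infinite_finite_induct) (simp_all only: sum.infinite sum.empty sum.insert star_add_left star_zero not_False_eq_True)

lemma star_sum_right: "b \<star> sum f I = (\<Sum>i\<in>I. b \<star> f i)"
  by (induction I rule: infinite_finite_induct) (simp_all only: sum.infinite sum.empty sum.insert star_add_right star_zero not_False_eq_True)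

lemma star_assoc: "(a \<star> b) \<star> c = a \<star> (b \<star> c)"
proof (rule ext)
  fix g
  show "((a \<star> b) \<star> c) g = (a \<star> (b \<star> c)) g"
  proof (cases "g \<in> carrier G")
    case g: True
    have "((a \<star> b) \<star> c) g = (\<Sum>x\<in>carrier G. \<Sum>y\<in>carrier G.
        a y * b (inv y \<otimes> x) * \<alpha> y (inv y \<otimes> x) * c (inv x \<otimes> g) * \<alpha> x (inv x \<otimes> g))"
      using g by (simp add: star_def sum_distrib_right)
    also have "\<dots> = (\<Sum>y\<in>carrier G. \<Sum>x\<in>carrier G.
        a y * b (inv y \<otimes> x) * \<alpha> y (inv y \<otimes> x) * c (inv x \<otimes> g) * \<alpha> x (inv x \<otimes> g))"
      by (rule sum.swap)
    \<comment> \<open>Substitute x = y z in the inner sum; the cocycle identity at y, z and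
      \<open>inv z \<otimes> (inv y \<otimes> g)\<close> then moves the brackets.\<close>
    also have "\<dots> = (\<Sum>y\<in>carrier G. \<Sum>z\<in>carrier G.
        a y * b z * \<alpha> y z * c (inv z \<otimes> (inv y \<otimes> g)) * \<alpha> (y \<otimes> z) (inv z \<otimes> (inv y \<otimes> g)))"
    proof (rule sum.cong[OF refl])
      fix y assume y: "y \<in> carrier G"
      show "(\<Sum>x\<in>carrier G.
        a y * b (inv y \<otimes> x) * \<alpha> y (inv y \<otimes> x) * c (inv x \<otimes> g) * \<alpha> x (inv x \<otimes> g))
        = (\<Sum>z\<in>carrier G.
        a y * b z * \<alpha> y z * c (inv z \<otimes> (inv y \<otimes> g)) * \<alpha> (y \<otimes> z) (inv z \<otimes> (inv y \<otimes> g)))"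
        by (rule sum.reindex_bij_witness[of _ "\<lambda>z. y \<otimes> z" "\<lambda>x. inv y \<otimes> x"])
          (use y g in \<open>simp_all add: m_assoc inv_mult_cancel inv_mult_group\<close>)
    qed
    also have "\<dots> = (\<Sum>y\<in>carrier G. \<Sum>z\<in>carrier G. a y * (b z * c (inv z \<otimes> (inv y \<otimes> g)) *
        \<alpha> z (inv z \<otimes> (inv y \<otimes> g))) * \<alpha> y (inv y \<otimes> g))"
    proof (intro sum.cong[OF refl])
      fix y z assume yz: "y \<in> carrier G" "z \<in> carrier G"
      have "\<alpha> y z * \<alpha> (y \<otimes> z) (inv z \<otimes> (inv y \<otimes> g))
          = \<alpha> y (inv y \<otimes> g) * \<alpha> z (inv z \<otimes> (inv y \<otimes> g))"
        using cocycle_eq[of y z "inv z \<otimes> (inv y \<otimes> g)"] yz g by (simp add: inv_mult_cancel)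
      then show "a y * b z * \<alpha> y z * c (inv z \<otimes> (inv y \<otimes> g)) * \<alpha> (y \<otimes> z) (inv z \<otimes> (inv y \<otimes> g))
        = a y * (b z * c (inv z \<otimes> (inv y \<otimes> g)) * \<alpha> z (inv z \<otimes> (inv y \<otimes> g))) * \<alpha> y (inv y \<otimes> g)"
        by (simp add: mult_ac)
    qed
    also have "\<dots> = (a \<star> (b \<star> c)) g"
      using g by (simp add: star_def sum_distrib_left sum_distrib_right)
    finally show ?thesis .
  qed (simp add: star_def)
qed

lemma star_closed [simp]: "a \<star> b \<in> carrier A"
  by (simp add: A_carrier star_def)

lemma delta_star:
  assumes "h \<in> carrier G" "g \<in> carrier G"
  shows "(delta h \<star> a) g = a (inv h \<otimes> g) * \<alpha> h (inv h \<otimes> g)"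
  using assms fin_G by (simp add: star_def delta_def if_distrib[of "\<lambda>x. x * _"] sum.delta cong: if_cong)

lemma star_delta:
  assumes "h \<in> carrier G" "g \<in> carrier G"
  shows "(a \<star> delta h) g = a (g \<otimes> inv h) * \<alpha> (g \<otimes> inv h) h"
proof -
  have eq: "inv x \<otimes> g = h \<longleftrightarrow> x = g \<otimes> inv h" if "x \<in> carrier G" for x
    using that assms by (metis inv_closed inv_inv inv_solve_left inv_solve_right m_closed)
  have cancel: "inv (g \<otimes> inv h) \<otimes> g = h"
    using eq[of "g \<otimes> inv h"] assms by simp
  have "(a \<star> delta h) g = (\<Sum>x\<in>carrier G. if x = g \<otimes> inv h then a x * \<alpha> x h else 0)"
    using assms by (simp add: star_def delta_def eq) (rule sum.cong; simp add: eq cancel assms)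
  then show ?thesis
    using assms fin_G by simp
qed

lemma one_star [simp]: "a \<in> carrier A \<Longrightarrow> \<one>\<^bsub>A\<^esub> \<star> a = a"
proof (rule ext)
  fix g assume a: "a \<in> carrier A"
  show "(\<one>\<^bsub>A\<^esub> \<star> a) g = a g"
  proof (cases "g \<in> carrier G")
    case True
    then show ?thesis using cocycle_nonzero[of \<one> \<one>] by (simp add: A_one delta_star cocycle_one(1)[OF True])
  qed (use a in \<open>simp add: A_carrier star_def\<close>)
qed

lemma star_one [simp]: "a \<in> carrier A \<Longrightarrow> a \<star> \<one>\<^bsub>A\<^esub> = a"
proof (rule ext)
  fix g assume a: "a \<in> carrier A"
  show "(a \<star> \<one>\<^bsub>A\<^esub>) g = a g"
  proof (cases "g \<in> carrier G")
    case True
    then show ?thesis using cocycle_nonzero[of \<one> \<one>] by (simp add: A_one star_delta cocycle_one(2)[OF True])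
  qed (use a in \<open>simp add: A_carrier star_def\<close>)
qed

lemma A_subspace: "fsp.subspace (carrier A)"
  by (auto simp: fsp.subspace_def A_carrier)

lemmas A_closed [simp] =
  fsp.subspace_0[OF A_subspace] fsp.subspace_add[OF A_subspace]
  fsp.subspace_scale[OF A_subspace] fsp.subspace_diff[OF A_subspace]
  fsp.subspace_neg[OF A_subspace] fsp.subspace_sum[OF A_subspace]

lemma delta_closed [simp]: "g \<in> carrier G \<Longrightarrow> delta g \<in> carrier A"
  by (auto simp: A_carrier delta_def)

lemma one_closed_A [simp]: "\<one>\<^bsub>A\<^esub> \<in> carrier A"
  by (simp add: A_one)

lemma delta_star_delta:
  assumes "g \<in> carrier G" "h \<in> carrier G"
  shows "delta g \<star> delta h = fscale (\<alpha> g h) (delta (g \<otimes> h))"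
proof (rule ext)
  fix x
  show "(delta g \<star> delta h) x = fscale (\<alpha> g h) (delta (g \<otimes> h)) x"
  proof (cases "x \<in> carrier G")
    case x: True
    have "inv g \<otimes> x = h \<longleftrightarrow> x = g \<otimes> h"
      using x assms by (metis inv_closed inv_inv inv_solve_left)
    then show ?thesis
      using assms x by (auto simp: delta_star) (auto simp: delta_def)
  qed (use assms in \<open>auto simp: star_def delta_def\<close>)
qed

lemma delta_expand:
  assumes "a \<in> carrier A"
  shows "a = (\<Sum>g\<in>carrier G. fscale (a g) (delta g))"
proof (rule ext)
  fix h
  show "a h = (\<Sum>g\<in>carrier G. fscale (a g) (delta g)) h"
    using assms fin_G by (cases "h \<in> carrier G")
      (auto simp: sum_apply delta_def A_carrier if_distrib[of "\<lambda>x. _ * x"] sum.delta cong: if_cong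
         intro!: sum.neutral[symmetric])
qed

lemma ring_A: "ring A"
proof (rule ringI)
  show "abelian_group A"
  proof (rule abelian_groupI)
    fix x assume "x \<in> carrier A"
    then show "\<exists>y\<in>carrier A. y \<oplus>\<^bsub>A\<^esub> x = \<zero>\<^bsub>A\<^esub>"
      by (intro bexI[of _ "- x"]) (auto simp: A_add A_zero)
  qed (auto simp: A_add A_zero add_ac)
  show "monoid A"
    by standard (auto simp: A_mult star_assoc)
qed (auto simp: A_mult A_add star_add_left star_add_right)

lemma A_minus: "a \<in> carrier A \<Longrightarrow> b \<in> carrier A \<Longrightarrow> a \<ominus>\<^bsub>A\<^esub> b = a - b"
proof -
  interpret ring A by (rule ring_A)
  assume ab: "a \<in> carrier A" "b \<in> carrier A"
  have "\<ominus>\<^bsub>A\<^esub> b = - b"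
    using ab minus_equality[of "- b" b] by (simp add: A_add A_zero)
  then show ?thesis
    by (simp add: a_minus_def A_add)
qed

end

section \<open>The twisted group algebra of the semidirect product\<close>

text \<open>This is how [P,E] = P enters: an E-invariant homomorphism vanishes on the generators
  e(u) u^{-1}.\<close>

lemma (in comm_group) hom_generate_trivial:
  fixes f :: "'a \<Rightarrow> 'k::ab_group_add"
  assumes hom: "\<And>u v. u \<in> carrier G \<Longrightarrow> v \<in> carrier G \<Longrightarrow> f (u \<otimes> v) = f u + f v"
    and S: "S \<subseteq> carrier G" "\<And>s. s \<in> S \<Longrightarrow> f s = 0" and u: "u \<in> generate G S"
  shows "f u = 0"
proof -
  have one: "f \<one> = 0" using hom[of \<one> \<one>] by simp
  have inv: "f (inv x) = - f x" if "x \<in> carrier G" for x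
    using hom[of "inv x" x] that one by (simp add: eq_neg_iff_add_eq_0)
  show ?thesis using u
  proof (induction rule: generate.induct)
    case (eng h1 h2)
    then show ?case using hom[of h1 h2] generate_in_carrier[OF S(1)] by simp
  qed (use S one inv in auto)
qed

section \<open>The action of E on P and the basis elements of the algebra\<close>

locale p_setting = P?: comm_group P for P :: "('a, 'm) monoid_scheme" (structure) +
  fixes E :: "('a \<Rightarrow> 'a) set"
    and \<alpha> :: "('a \<Rightarrow> 'a) \<Rightarrow> ('a \<Rightarrow> 'a) \<Rightarrow> 'k::field"
    and p :: nat
  assumes prime_p: "Factorial_Ring.prime p"
    and char_p: "CHAR('k) = p"
    and fin_P: "finite (carrier P)" and p_group: "\<exists>n. order P = p ^ n"
    and E_submod: "subgroup E (AutoGroup P)" and E_comm: "comm_group (aut_group P E)"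
    and E_coprime: "coprime (card E) p"
    and coc_E: "two_cocycle (aut_group P E) \<alpha>"
    and PE: "comm_aut P E = carrier P"
begin

abbreviation "H \<equiv> aut_group P E"
abbreviation emult (infixl "\<cdot>" 70) where "x \<cdot> y \<equiv> x \<otimes>\<^bsub>H\<^esub> y"
abbreviation eone ("\<one>\<^sub>E") where "\<one>\<^sub>E \<equiv> \<one>\<^bsub>H\<^esub>"
abbreviation einv where "einv x \<equiv> inv\<^bsub>H\<^esub> x"
abbreviation "S \<equiv> semidirect P E"

sublocale H: comm_group H
  by (rule E_comm)

lemma H_carrier [simp]: "carrier H = E"
  by (simp add: aut_group_def)

lemma E_auto: "x \<in> E \<Longrightarrow> x \<in> auto P"
  using subgroup.subset[OF E_submod] by (auto simp: AutoGroup_def)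

lemma E_Bij: "x \<in> E \<Longrightarrow> x \<in> Bij (carrier P)"
  using E_auto by (auto simp: auto_def)

lemma act_hom: "x \<in> E \<Longrightarrow> x \<in> hom P P"
  using E_auto by (auto simp: auto_def)

lemma act_closed [simp]: "x \<in> E \<Longrightarrow> u \<in> carrier P \<Longrightarrow> x u \<in> carrier P"
  using act_hom by (auto simp: hom_def)

lemma act_mult [simp]:
  "x \<in> E \<Longrightarrow> u \<in> carrier P \<Longrightarrow> v \<in> carrier P \<Longrightarrow> x (u \<otimes> v) = x u \<otimes> x v"
  using act_hom by (auto simp: hom_def)

lemma emult_act [simp]:
  assumes "x \<in> E" "y \<in> E" "u \<in> carrier P"
  shows "(x \<cdot> y) u = x (y u)"
  using assms E_Bij by (simp add: aut_group_def AutoGroup_def BijGroup_def compose_def)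

lemma eone_act [simp]: "u \<in> carrier P \<Longrightarrow> \<one>\<^sub>E u = u"
  by (simp add: aut_group_def AutoGroup_def BijGroup_def)

lemma act_one [simp]: "x \<in> E \<Longrightarrow> x \<one> = \<one>"
  using hom_one[OF act_hom] P.is_group by auto

lemma act_inv [simp]: "x \<in> E \<Longrightarrow> u \<in> carrier P \<Longrightarrow> x (inv u) = inv (x u)"
  using group_hom.hom_inv[of P P x u] act_hom P.is_group
  by (auto simp: group_hom_def group_hom_axioms_def)

lemma E_closed [simp]:
  "\<one>\<^sub>E \<in> E" "x \<in> E \<Longrightarrow> y \<in> E \<Longrightarrow> x \<cdot> y \<in> E" "x \<in> E \<Longrightarrow> einv x \<in> E"
  using H.one_closed H.m_closed[of x y] H.inv_closed[of x] by auto

lemma einv_act [simp]: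
  assumes "x \<in> E" "u \<in> carrier P"
  shows "x (einv x u) = u" "einv x (x u) = u"
  using assms emult_act[of x "einv x" u] emult_act[of "einv x" x u] by auto

lemma act_inj: "x \<in> E \<Longrightarrow> u \<in> carrier P \<Longrightarrow> v \<in> carrier P \<Longrightarrow> x u = x v \<Longrightarrow> u = v"
  by (metis einv_act(2))

lemma act_commute:
  assumes "x \<in> E" "y \<in> E" "u \<in> carrier P"
  shows "x (y u) = y (x u)"
  using assms by (metis H.m_comm H_carrier emult_act)

lemma E_eqI:
  assumes "x \<in> E" "y \<in> E" "\<And>u. u \<in> carrier P \<Longrightarrow> x u = y u"
  shows "x = y"
  using assms E_Bij[of x] E_Bij[of y]
  by (metis Bij_imp_extensional extensionalityI)

lemma E_cancel [simp]:
  assumes "x \<in> E" "y \<in> E"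
  shows "x \<cdot> (einv x \<cdot> y) = y" "einv x \<cdot> (x \<cdot> y) = y" "x \<cdot> y \<cdot> einv y = x" "x \<cdot> einv y \<cdot> y = x"
  using assms H.m_assoc[of x y "einv y"] H.m_assoc[of x "einv y" y]
    H.m_assoc[of x "einv x" y] H.m_assoc[of "einv x" x y] by auto

lemma P_cancel [simp]:
  assumes "x \<in> carrier P" "y \<in> carrier P"
  shows "x \<otimes> (inv x \<otimes> y) = y" "inv x \<otimes> (x \<otimes> y) = y"
    "x \<otimes> y \<otimes> inv y = x" "x \<otimes> inv y \<otimes> y = x"
  using assms by (auto simp: m_assoc[symmetric]) (auto simp: m_assoc)

lemma fin_E: "finite E"
proof -
  have "E \<subseteq> carrier P \<rightarrow>\<^sub>E carrier P"
    using E_Bij by (auto simp: Bij_imp_extensional PiE_def Pi_def)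
  then show ?thesis
    using finite_PiE[OF fin_P, of "\<lambda>_. carrier P"] fin_P finite_subset by blast
qed

lemma card_E_nz: "(of_nat (card E) :: 'k) \<noteq> 0"
proof -
  have "\<not> p dvd card E"
    using E_coprime prime_p by (metis coprime_common_divisor dvd_refl not_prime_unit)
  then show ?thesis
    using char_p by (simp add: of_nat_eq_0_iff_char_dvd)
qed

lemma S_simps [simp]:
  "carrier S = carrier P \<times> E" "\<one>\<^bsub>S\<^esub> = (\<one>, \<one>\<^sub>E)"
  "(u, x) \<otimes>\<^bsub>S\<^esub> (v, y) = (u \<otimes> x v, x \<cdot> y)"
  by (simp_all add: semidirect_def)

sublocale S: group S
proof (rule groupI)
  fix g assume "g \<in> carrier S"
  then obtain u x where "g = (u, x)" "u \<in> carrier P" "x \<in> E"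
    by (cases g) auto
  then show "\<exists>h\<in>carrier S. h \<otimes>\<^bsub>S\<^esub> g = \<one>\<^bsub>S\<^esub>"
    by (intro bexI[of _ "(einv x (inv u), einv x)"]) auto
qed (auto simp: m_assoc H.m_assoc)

lemma S_inv [simp]:
  assumes "u \<in> carrier P" "x \<in> E"
  shows "inv\<^bsub>S\<^esub> (u, x) = (einv x (inv u), einv x)"
  using assms by (intro S.inv_equality) auto

lemma coc_infl: "two_cocycle S (inflate \<alpha>)"
  using coc_E by (auto simp: two_cocycle_def inflate_def)

sublocale T: twisted_algebra S "inflate \<alpha>"
  rewrites "twisted_group_algebra S (inflate \<alpha>) \<equiv> twisted_semidirect P E \<alpha>"
proof -
  show "twisted_algebra S (inflate \<alpha>)"
    using fin_P fin_E coc_infl by unfold_locales auto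
qed (simp add: twisted_semidirect_def)

notation T.star (infixl "\<star>" 70)
abbreviation "A \<equiv> twisted_semidirect P E \<alpha>"

text \<open>The factor makes \<open>U\<close> multiplicative with \<open>U \<one>\<close> the unit
  of \<open>A\<close>, although \<alpha> need not be normalised. \<open>W\<close> is left unscaled:
  its products carry the factor \<alpha>, and \<open>W \<one>\<^sub>E\<close> is only a multiple of
  the unit.\<close>

definition U :: "'a \<Rightarrow> 'a \<times> ('a \<Rightarrow> 'a) \<Rightarrow> 'k" where
  "U u = fscale (inverse (\<alpha> \<one>\<^sub>E \<one>\<^sub>E)) (delta (u, \<one>\<^sub>E))"
definition W :: "('a \<Rightarrow> 'a) \<Rightarrow> 'a \<times> ('a \<Rightarrow> 'a) \<Rightarrow> 'k" where
  "W x = delta (\<one>, x)"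

lemma cocycle_nonzeroE: "x \<in> E \<Longrightarrow> y \<in> E \<Longrightarrow> \<alpha> x y \<noteq> 0"
  using coc_E unfolding two_cocycle_def by simp

lemma cocycle_eqE:
  "x \<in> E \<Longrightarrow> y \<in> E \<Longrightarrow> z \<in> E \<Longrightarrow> \<alpha> x y * \<alpha> (x \<cdot> y) z = \<alpha> x (y \<cdot> z) * \<alpha> y z"
  using coc_E unfolding two_cocycle_def by simp

lemma cocycle_oneE:
  assumes "x \<in> E"
  shows "\<alpha> \<one>\<^sub>E x = \<alpha> \<one>\<^sub>E \<one>\<^sub>E" "\<alpha> x \<one>\<^sub>E = \<alpha> \<one>\<^sub>E \<one>\<^sub>E"
  using T.cocycle_one[of "(\<one>, x)"] assms by (auto simp: inflate_def)

lemma U_closed [simp]: "u \<in> carrier P \<Longrightarrow> U u \<in> carrier A"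
  unfolding U_def by (intro T.A_closed T.delta_closed) auto

lemma W_closed [simp]: "x \<in> E \<Longrightarrow> W x \<in> carrier A"
  unfolding W_def by (intro T.delta_closed) auto

lemma U_star:
  assumes "u \<in> carrier P" "v \<in> carrier P" "x \<in> E"
  shows "(U u \<star> a) (v, x) = a (inv u \<otimes> v, x)"
  using assms cocycle_nonzeroE[of "\<one>\<^sub>E" "\<one>\<^sub>E"]
  by (simp add: U_def T.delta_star inflate_def cocycle_oneE(1)[of x])

lemma star_U:
  assumes "u \<in> carrier P" "v \<in> carrier P" "x \<in> E"
  shows "(a \<star> U u) (v, x) = a (v \<otimes> inv (x u), x)"
  using assms cocycle_nonzeroE[of "\<one>\<^sub>E" "\<one>\<^sub>E"]
  by (simp add: U_def T.star_delta inflate_def cocycle_oneE(2)[of x])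

lemma W_star:
  assumes "x \<in> E" "v \<in> carrier P" "y \<in> E"
  shows "(W x \<star> a) (v, y) = \<alpha> x (einv x \<cdot> y) * a (einv x v, einv x \<cdot> y)"
  using assms by (simp add: W_def T.delta_star inflate_def)

lemma star_W:
  assumes "x \<in> E" "v \<in> carrier P" "y \<in> E"
  shows "(a \<star> W x) (v, y) = \<alpha> (y \<cdot> einv x) x * a (v, y \<cdot> einv x)"
  using assms by (simp add: W_def T.star_delta inflate_def)

lemma A_eqI:
  assumes "a \<in> carrier A" "b \<in> carrier A"
    "\<And>u x. u \<in> carrier P \<Longrightarrow> x \<in> E \<Longrightarrow> a (u, x) = b (u, x)"
  shows "a = b"
proof (rule ext)
  fix g show "a g = b g"
    using assms by (cases g) (cases "g \<in> carrier S", auto simp: T.A_carrier)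
qed

lemma U_one: "U \<one> = \<one>\<^bsub>A\<^esub>"
  by (simp add: U_def T.A_one inflate_def)

lemma U_mult: "u \<in> carrier P \<Longrightarrow> v \<in> carrier P \<Longrightarrow> U u \<star> U v = U (u \<otimes> v)"
  using cocycle_nonzeroE[of "\<one>\<^sub>E" "\<one>\<^sub>E"]
  by (simp add: U_def T.delta_star_delta inflate_def fun_eq_iff)

lemma W_mult: "x \<in> E \<Longrightarrow> y \<in> E \<Longrightarrow> W x \<star> W y = fscale (\<alpha> x y) (W (x \<cdot> y))"
  by (simp add: W_def T.delta_star_delta inflate_def)

lemma U_W: "u \<in> carrier P \<Longrightarrow> x \<in> E \<Longrightarrow> U u \<star> W x = delta (u, x)"
  using cocycle_nonzeroE[of "\<one>\<^sub>E" "\<one>\<^sub>E"]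
  by (simp add: U_def W_def T.delta_star_delta inflate_def cocycle_oneE(1)[of x] fun_eq_iff)

lemma W_U: "u \<in> carrier P \<Longrightarrow> x \<in> E \<Longrightarrow> W x \<star> U u = U (x u) \<star> W x"
  using cocycle_nonzeroE[of "\<one>\<^sub>E" "\<one>\<^sub>E"]
  by (simp add: U_W) (simp add: U_def W_def T.delta_star_delta inflate_def cocycle_oneE(2)[of x] fun_eq_iff)

lemma W_one: "W \<one>\<^sub>E = fscale (\<alpha> \<one>\<^sub>E \<one>\<^sub>E) \<one>\<^bsub>A\<^esub>"
  using cocycle_nonzeroE[of "\<one>\<^sub>E" "\<one>\<^sub>E"] by (simp add: W_def T.A_one inflate_def fun_eq_iff)

text \<open>The inverse of \<open>W x\<close>. The scalar undoes the two factors in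
  \<open>W x \<star> W (einv x)\<close>: one from \<alpha>(x,x^{-1}), one from
  \<open>W \<one>\<^sub>E\<close>.\<close>

definition Wi :: "('a \<Rightarrow> 'a) \<Rightarrow> 'a \<times> ('a \<Rightarrow> 'a) \<Rightarrow> 'k" where
  "Wi x = fscale (inverse (\<alpha> x (einv x) * \<alpha> \<one>\<^sub>E \<one>\<^sub>E)) (W (einv x))"

lemma Wi_closed [simp]: "x \<in> E \<Longrightarrow> Wi x \<in> carrier A"
  unfolding Wi_def by (intro T.A_closed W_closed) auto

lemma W_Wi [simp]: "x \<in> E \<Longrightarrow> W x \<star> Wi x = \<one>\<^bsub>A\<^esub>"
  using cocycle_nonzeroE[of "\<one>\<^sub>E" "\<one>\<^sub>E"] cocycle_nonzeroE[of x "einv x"]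
  by (simp add: Wi_def W_mult W_one fun_eq_iff field_simps)

lemma Wi_W [simp]:
  assumes "x \<in> E" shows "Wi x \<star> W x = \<one>\<^bsub>A\<^esub>"
proof -
  \<comment> \<open>The cocycle identity at x, x^{-1}, x, in which \<alpha>(1,x) = \<alpha>(x,1)
    cancels.\<close>
  have "\<alpha> (einv x) x = \<alpha> x (einv x)"
    using cocycle_eqE[of x "einv x" x] assms cocycle_oneE[OF assms] cocycle_nonzeroE[of "\<one>\<^sub>E" "\<one>\<^sub>E"] by simp
  then show ?thesis
    using cocycle_nonzeroE[of "\<one>\<^sub>E" "\<one>\<^sub>E"] cocycle_nonzeroE[of x "einv x"] assms
    by (simp add: Wi_def W_mult W_one fun_eq_iff field_simps)
qed

lemma A_expand:
  assumes "a \<in> carrier A"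
  shows "a = (\<Sum>(u, x)\<in>carrier P \<times> E. fscale (a (u, x)) (U u \<star> W x))"
proof -
  have "a = (\<Sum>g\<in>carrier S. fscale (a g) (delta g))"
    by (rule T.delta_expand[OF assms])
  also have "\<dots> = (\<Sum>(u, x)\<in>carrier P \<times> E. fscale (a (u, x)) (U u \<star> W x))"
    by (intro sum.cong) (auto simp: U_W)
  finally show ?thesis .
qed

end

section \<open>Powers of the augmentation ideal\<close>

text \<open>Commuting letters of a word can be sorted, with all occurrences of one letter outermost.
  So a long word in the operators u - 1 contains a high power of one of them.\<close>

lemma funpow_commute_foldr:
  fixes T :: "'i \<Rightarrow> 'b \<Rightarrow> 'b"
  assumes comm: "\<And>i j. T i \<circ> T j = T j \<circ> T i"
  shows "foldr T ws b = (T i ^^ count_list ws i) (foldr T (filter (\<lambda>j. j \<noteq> i) ws) b)"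
proof (induction ws)
  case (Cons j ws)
  have "T j ((T i ^^ n) b) = (T i ^^ n) (T j b)" for n b
    by (induction n) (use comm in \<open>auto simp: fun_eq_iff\<close>)
  from this this[of _ "foldr T (filter (\<lambda>j. j \<noteq> i) ws) b", symmetric] Cons show ?case by auto
qed simp

context p_setting
begin

text \<open>\<open>J m\<close> is the m-th power of J. One factor u - 1 is put on the left at a
  time, so that claims about \<open>J (Suc m)\<close> are checked on generators; that this gives
  two-sided ideals rests on E permuting the elements u - 1 by conjugation.\<close>

fun J :: "nat \<Rightarrow> ('a \<times> ('a \<Rightarrow> 'a) \<Rightarrow> 'k) set" where
  "J 0 = carrier A"
| "J (Suc m) = fsp.span {U u \<star> a - a | u a. u \<in> carrier P \<and> a \<in> J m}"

lemma J_subspace: "fsp.subspace (J m)"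
  by (cases m) (auto simp: T.A_subspace)

lemmas J_closed =
  fsp.subspace_0[OF J_subspace] fsp.subspace_add[OF J_subspace]
  fsp.subspace_scale[OF J_subspace] fsp.subspace_diff[OF J_subspace]
  fsp.subspace_neg[OF J_subspace] fsp.subspace_sum[OF J_subspace]

lemma J_gen: "u \<in> carrier P \<Longrightarrow> a \<in> J m \<Longrightarrow> U u \<star> a - a \<in> J (Suc m)"
  by (auto intro: fsp.span_base)

lemma J_Suc_induct [consumes 1, case_names gen subspace]:
  assumes "b \<in> J (Suc m)"
    and "\<And>u a. u \<in> carrier P \<Longrightarrow> a \<in> J m \<Longrightarrow> Q (U u \<star> a - a)"
    and "fsp.subspace {b. Q b}"
  shows "Q b"
  using fsp.span_induct[of b "{U u \<star> a - a | u a. u \<in> carrier P \<and> a \<in> J m}" Q] assms by auto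

declare J.simps(2) [simp del]

lemma subspace_star_left: "fsp.subspace V \<Longrightarrow> fsp.subspace {b. b \<star> c \<in> V}"
  by (auto simp: fsp.subspace_def T.star_add_left)

lemma subspace_star_right: "fsp.subspace V \<Longrightarrow> fsp.subspace {b. c \<star> b \<in> V}"
  by (auto simp: fsp.subspace_def T.star_add_right)

lemma J_Suc_subset: "J (Suc m) \<subseteq> J m"
proof (induction m)
  case 0
  have "b \<in> carrier A" if "b \<in> J (Suc 0)" for b
    using that
  proof (induction rule: J_Suc_induct)
    case (gen u a)
    then show "U u \<star> a - a \<in> carrier A" by simp
  qed (simp add: T.A_subspace)
  then show ?case by auto
next
  case (Suc m)
  have "b \<in> J (Suc m)" if "b \<in> J (Suc (Suc m))" for b
    using that
  proof (induction rule: J_Suc_induct)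
    case (gen u a)
    then show ?case using Suc J_gen[of u a m] by blast
  next
    case subspace
    then show ?case using J_subspace[of "Suc m"] by (simp only: Collect_mem_eq)
  qed
  then show ?case by blast
qed

lemma J_mono: "m \<le> n \<Longrightarrow> J n \<subseteq> J m"
  by (rule lift_Suc_antimono_le[of J]) (use J_Suc_subset in auto)

lemma J_A: "a \<in> J m \<Longrightarrow> a \<in> carrier A"
  using J_mono[of 0 m] by auto

lemma A_induct [consumes 1, case_names delta subspace]:
  assumes "a \<in> carrier A"
    and "\<And>u x. u \<in> carrier P \<Longrightarrow> x \<in> E \<Longrightarrow> a (u, x) \<noteq> 0 \<Longrightarrow> Q (U u \<star> W x)"
    and "fsp.subspace {b. Q b}"
  shows "Q a"
proof -
  have "(\<Sum>(u, x)\<in>carrier P \<times> E. fscale (a (u, x)) (U u \<star> W x)) \<in> {b. Q b}"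
    using assms(2) fsp.subspace_0[OF assms(3)] fsp.subspace_scale[OF assms(3)]
    by (intro fsp.subspace_sum[OF assms(3)]) (smt (verit) SigmaE case_prod_conv fsp.scale_zero_left mem_Collect_eq)
  then show ?thesis using A_expand[OF assms(1)] by simp
qed

text \<open>Left multiplication by u is the identity up to the next power: u a = (u a - a) +
  a.\<close>

lemma U_left_J: "u \<in> carrier P \<Longrightarrow> a \<in> J m \<Longrightarrow> U u \<star> a \<in> J m"
  using J_closed(2)[of "U u \<star> a - a" m a] J_gen J_Suc_subset by fastforce

text \<open>Conjugation by x carries u - 1 to x(u) - 1, so \<open>W x\<close> passes through the
  factors of a generator.\<close>

lemma W_left_J: "x \<in> E \<Longrightarrow> a \<in> J m \<Longrightarrow> W x \<star> a \<in> J m"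
proof (induction m arbitrary: a)
  case (Suc m)
  show ?case using Suc.prems(2)
  proof (induction rule: J_Suc_induct)
    case (gen u a)
    have "W x \<star> (U u \<star> a - a) = U (x u) \<star> (W x \<star> a) - W x \<star> a"
      using gen Suc.prems W_U[of u x] by (simp add: T.star_diff_right T.star_assoc[symmetric])
    then show "W x \<star> (U u \<star> a - a) \<in> J (Suc m)" using gen Suc J_gen[of "x u" "W x \<star> a" m] by simp
  qed (intro subspace_star_right J_subspace)
qed simp

lemma star_J_left:
  assumes "b \<in> carrier A" "a \<in> J m"
  shows "b \<star> a \<in> J m"
  using assms(1)
proof (induction rule: A_induct)
  case (delta u x)
  then show "U u \<star> W x \<star> a \<in> J m" using assms(2) by (simp add: T.star_assoc U_left_J W_left_J)
qed (intro subspace_star_left J_subspace)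

lemma J_mult: "a \<in> J m \<Longrightarrow> b \<in> J n \<Longrightarrow> a \<star> b \<in> J (m + n)"
proof (induction m arbitrary: a)
  case 0
  then show ?case by (simp add: star_J_left)
next
  case (Suc m)
  show ?case using Suc.prems(1)
  proof (induction rule: J_Suc_induct)
    case (gen u a)
    have "(U u \<star> a - a) \<star> b = U u \<star> (a \<star> b) - a \<star> b"
      by (simp add: T.star_diff_left T.star_assoc)
    then show "(U u \<star> a - a) \<star> b \<in> J (Suc m + n)" using Suc.IH[OF gen(2) Suc.prems(2)] J_gen[OF gen(1), of "a \<star> b" "m + n"] by simp
  qed (intro subspace_star_left J_subspace)
qed

lemma star_J_right: "a \<in> J m \<Longrightarrow> b \<in> carrier A \<Longrightarrow> a \<star> b \<in> J m"
  using J_mult[of a m b 0] by simp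

lemma U_minus_one: "u \<in> carrier P \<Longrightarrow> U u - \<one>\<^bsub>A\<^esub> \<in> J 1"
  using J_gen[of u "\<one>\<^bsub>A\<^esub>" 0] by simp

lemma U_right_J: "u \<in> carrier P \<Longrightarrow> a \<in> J m \<Longrightarrow> a \<star> U u - a \<in> J (Suc m)"
  using J_mult[of a m "U u - \<one>\<^bsub>A\<^esub>" 1] U_minus_one J_A[of a m] by (simp add: T.star_diff_right)

text \<open>Under the hypothesis the expansion of a does not change when each
  \<open>U u \<star> W x\<close> is replaced by its difference with \<open>W x\<close>. Together
  with \<open>sum_J1\<close>: J is the kernel of the augmentation onto
  \<open>k_\<alpha>E\<close>.\<close>

lemma J1_I:
  assumes "a \<in> carrier A" "\<And>x. x \<in> E \<Longrightarrow> (\<Sum>u\<in>carrier P. a (u, x)) = 0"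
  shows "a \<in> J 1"
proof -
  have "a = (\<Sum>(u, x)\<in>carrier P \<times> E. fscale (a (u, x)) (U u \<star> W x))"
    by (rule A_expand[OF assms(1)])
  also have "\<dots> = (\<Sum>(u, x)\<in>carrier P \<times> E. fscale (a (u, x)) (U u \<star> W x - W x))
      + (\<Sum>u\<in>carrier P. \<Sum>x\<in>E. fscale (a (u, x)) (W x))"
    unfolding sum.cartesian_product sum.distrib[symmetric]
    by (intro sum.cong refl) (auto simp: fun_eq_iff algebra_simps)
  also have "(\<Sum>u\<in>carrier P. \<Sum>x\<in>E. fscale (a (u, x)) (W x)) = 0"
    by (subst sum.swap, rule sum.neutral) (simp add: fsp.scale_sum_left[symmetric] assms(2))
  also have "(\<Sum>(u, x)\<in>carrier P \<times> E. fscale (a (u, x)) (U u \<star> W x - W x)) + 0 \<in> J 1"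
    unfolding add_0_right
  proof (rule J_closed(6))
    fix g assume "g \<in> carrier P \<times> E"
    then show "(case g of (u, x) \<Rightarrow> fscale (a (u, x)) (U u \<star> W x - W x)) \<in> J 1"
      using J_gen[of _ _ 0] by (cases g) (auto intro!: J_closed(3))
  qed
  finally show ?thesis .
qed

lemma sum_J1:
  assumes "a \<in> J 1" "x \<in> E"
  shows "(\<Sum>u\<in>carrier P. a (u, x)) = 0"
  using assms(1) unfolding One_nat_def
proof (induction rule: J_Suc_induct)
  case (gen u a)
  have "(\<Sum>v\<in>carrier P. (U u \<star> a) (v, x)) = (\<Sum>v\<in>carrier P. a (v, x))"
    using gen assms(2)
    by (intro sum.reindex_bij_witness[of _ "\<lambda>v. u \<otimes> v" "\<lambda>v. inv u \<otimes> v"]) (auto simp: U_star)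
  then show "(\<Sum>v\<in>carrier P. (U u \<star> a - a) (v, x)) = 0" by (simp add: sum_subtractf)
qed (auto simp: fsp.subspace_def sum.distrib sum_distrib_left[symmetric])

section \<open>The grading by E\<close>

definition pr :: "('a \<Rightarrow> 'a) \<Rightarrow> ('a \<times> ('a \<Rightarrow> 'a) \<Rightarrow> 'k) \<Rightarrow> 'a \<times> ('a \<Rightarrow> 'a) \<Rightarrow> 'k" where
  "pr y a = (\<lambda>(u, x). if x = y then a (u, x) else 0)"

lemma pr_apply [simp]: "pr y a (u, x) = (if x = y then a (u, x) else 0)"
  by (simp add: pr_def)

lemma pr_closed [simp]: "a \<in> carrier A \<Longrightarrow> pr y a \<in> carrier A"
  by (auto simp: T.A_carrier)

lemma pr_linear: "pr y (a + b) = pr y a + pr y b" "pr y (a - b) = pr y a - pr y b"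
  "pr y (fscale c a) = fscale c (pr y a)" "pr y 0 = 0" "pr y (- a) = - pr y a"
  by (auto simp: fun_eq_iff)

lemma pr_pr: "pr y (pr z a) = (if y = z then pr y a else 0)"
  by (auto simp: fun_eq_iff)

lemma pr_sum: "pr y (sum f I) = (\<Sum>i\<in>I. pr y (f i))"
proof (rule ext)
  fix g show "pr y (sum f I) g = (\<Sum>i\<in>I. pr y (f i)) g"
    by (cases g) (simp add: sum_apply)
qed

lemma sum_pr: "a \<in> carrier A \<Longrightarrow> (\<Sum>y\<in>E. pr y a) = a"
  by (rule A_eqI) (auto simp: sum_apply fin_E sum.delta)

lemma pr_U_star: "u \<in> carrier P \<Longrightarrow> y \<in> E \<Longrightarrow> pr y (U u \<star> a) = U u \<star> pr y a"
  by (rule A_eqI) (auto simp: U_star)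

lemma pr_star_U: "u \<in> carrier P \<Longrightarrow> y \<in> E \<Longrightarrow> pr y (a \<star> U u) = pr y a \<star> U u"
  by (rule A_eqI) (auto simp: star_U)

lemma pr_J: "y \<in> E \<Longrightarrow> a \<in> J m \<Longrightarrow> pr y a \<in> J m"
proof (induction m arbitrary: a)
  case (Suc m)
  show ?case using Suc.prems(2)
  proof (induction rule: J_Suc_induct)
    case (gen u a)
    then show "pr y (U u \<star> a - a) \<in> J (Suc m)" using J_gen[of u "pr y a" m] Suc by (simp add: pr_linear pr_U_star)
  qed (use J_subspace[of "Suc m"] in \<open>auto simp: fsp.subspace_def pr_linear\<close>)
qed simp

lemma pr_W_star:
  assumes "x \<in> E" "y \<in> E"
  shows "pr (x \<cdot> y) (W x \<star> a) = W x \<star> pr y a"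
proof (rule A_eqI)
  fix u z assume uz: "u \<in> carrier P" "z \<in> E"
  have "z = x \<cdot> y \<longleftrightarrow> einv x \<cdot> z = y" using uz assms by auto
  then show "pr (x \<cdot> y) (W x \<star> a) (u, z) = (W x \<star> pr y a) (u, z)"
    using uz assms by (auto simp: W_star)
qed (use assms in auto)

lemma pr_star_W:
  assumes "x \<in> E" "y \<in> E"
  shows "pr (y \<cdot> x) (a \<star> W x) = pr y a \<star> W x"
proof (rule A_eqI)
  fix u z assume uz: "u \<in> carrier P" "z \<in> E"
  have "z = y \<cdot> x \<longleftrightarrow> z \<cdot> einv x = y" using uz assms by auto
  then show "pr (y \<cdot> x) (a \<star> W x) (u, z) = (pr y a \<star> W x) (u, z)"
    using uz assms by (auto simp: star_W)
qed (use assms in auto)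

section \<open>Nilpotency of J\<close>

definition diff_op :: "'a \<Rightarrow> ('a \<times> ('a \<Rightarrow> 'a) \<Rightarrow> 'k) \<Rightarrow> 'a \<times> ('a \<Rightarrow> 'a) \<Rightarrow> 'k" where
  "diff_op u a = (if u \<in> carrier P then U u \<star> a - a else a)"

text \<open>Outside \<open>carrier P\<close> the operator is the identity, so the family commutes
  over the whole index type, as \<open>funpow_commute_foldr\<close> demands.\<close>

lemma diff_op_comm: "diff_op u \<circ> diff_op v = diff_op v \<circ> diff_op u"
proof (rule ext)
  fix a
  have "U u \<star> (U v \<star> a) = U v \<star> (U u \<star> a)" if "u \<in> carrier P" "v \<in> carrier P"
    using that by (simp add: T.star_assoc[symmetric] U_mult m_comm)
  then show "(diff_op u \<circ> diff_op v) a = (diff_op v \<circ> diff_op u) a"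
    by (simp add: diff_op_def T.star_diff_right)
qed

lemma diff_op_linear: "diff_op u (a + b) = diff_op u a + diff_op u b" "diff_op u (fscale c a) = fscale c (diff_op u a)" "diff_op u 0 = 0"
  by (auto simp: diff_op_def T.star_add_right fun_eq_iff algebra_simps)

lemma diff_op_funpow_0: "(diff_op u ^^ n) 0 = 0"
  by (induction n) (simp_all only: funpow.simps comp_apply id_apply diff_op_linear)

lemma foldr_diff_op_linear:
  "foldr diff_op ws (a + b) = foldr diff_op ws a + foldr diff_op ws b"
  "foldr diff_op ws (fscale c a) = fscale c (foldr diff_op ws a)" "foldr diff_op ws 0 = 0"
  by (induction ws) (simp_all only: foldr.simps comp_apply id_apply diff_op_linear)

text \<open>The binomial theorem for u = 1 + (u - 1), with Pascal's rule in the inductive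
  step.\<close>

lemma U_pow_expand:
  assumes u: "u \<in> carrier P" and a: "a \<in> carrier A"
  shows "U (u [^] (k::nat)) \<star> a = (\<Sum>j\<le>k. fscale (of_nat (k choose j)) ((diff_op u ^^ j) a))"
proof (induction k)
  case 0
  then show "U (u [^] (0::nat)) \<star> a = (\<Sum>j\<le>0. fscale (of_nat (0 choose j)) ((diff_op u ^^ j) a))"
    using a by (simp add: U_one)
next
  case (Suc k)
  let ?x = "\<lambda>j. (diff_op u ^^ j) a"
  have s: "U u \<star> ?x j = ?x j + ?x (Suc j)" for j
    using u by (simp add: diff_op_def)
  have "U (u [^] Suc k) \<star> a = U u \<star> (U (u [^] k) \<star> a)"
    using u by (simp add: T.star_assoc[symmetric] U_mult m_comm)
  also have "\<dots> = (\<Sum>j\<le>k. fscale (of_nat (k choose j)) (?x j)) + (\<Sum>j\<le>k. fscale (of_nat (k choose j)) (?x (Suc j)))"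
    unfolding Suc.IH T.star_sum_right T.star_fscale_right s fsp.scale_right_distrib sum.distrib by (rule refl)
  also have "(\<Sum>j\<le>k. fscale (of_nat (k choose j)) (?x j)) = (\<Sum>j\<le>Suc k. fscale (of_nat (k choose j)) (?x j))"
    by (simp add: binomial_eq_0)
  also have "\<dots> = fscale 1 (?x 0) + (\<Sum>j\<le>k. fscale (of_nat (k choose Suc j)) (?x (Suc j)))"
    by (subst sum.atMost_Suc_shift) simp
  also have "\<dots> + (\<Sum>j\<le>k. fscale (of_nat (k choose j)) (?x (Suc j)))
    = fscale 1 (?x 0) + (\<Sum>j\<le>k. fscale (of_nat (Suc k choose Suc j)) (?x (Suc j)))"
    by (simp only: binomial_Suc_Suc of_nat_add fsp.scale_left_distrib sum.distrib ac_simps)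
  also have "\<dots> = (\<Sum>j\<le>Suc k. fscale (of_nat (Suc k choose j)) (?x j))"
    by (subst sum.atMost_Suc_shift) simp
  finally show "U (u [^] Suc k) \<star> a = (\<Sum>j\<le>Suc k. fscale (of_nat (Suc k choose j)) (?x j))" .
qed

lemma diff_op_closed: "a \<in> carrier A \<Longrightarrow> diff_op u a \<in> carrier A"
  by (auto simp: diff_op_def)

lemma diff_op_funpow_closed: "a \<in> carrier A \<Longrightarrow> (diff_op u ^^ n) a \<in> carrier A"
  by (induction n) (auto simp: diff_op_closed)

text \<open>In characteristic p the inner binomial coefficients vanish, so (u - 1)^p = u^p -
  1.\<close>

lemma diff_op_pow_p:
  assumes "u \<in> carrier P" "a \<in> carrier A"
  shows "(diff_op u ^^ p) a = diff_op (u [^] p) a"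
proof -
  have p: "p > 0" using prime_p by (simp add: prime_gt_0_nat)
  have "U (u [^] p) \<star> a = (\<Sum>j\<in>{..p}. fscale (of_nat (p choose j)) ((diff_op u ^^ j) a))"
    by (rule U_pow_expand[OF assms])
  also have "\<dots> = (\<Sum>j\<in>{0, p}. fscale (of_nat (p choose j)) ((diff_op u ^^ j) a))"
  proof (rule sum.mono_neutral_right)
    show "\<forall>j\<in>{..p} - {0, p}. fscale (of_nat (p choose j)) ((diff_op u ^^ j) a) = 0"
    proof
      fix j assume "j \<in> {..p} - {0, p}"
      then have "p dvd (p choose j)"
        using prime_p by (intro dvd_choose_prime) auto
      then have "(of_nat (p choose j) :: 'k) = 0"
        using char_p by (simp add: of_nat_eq_0_iff_char_dvd)
      then show "fscale (of_nat (p choose j)) ((diff_op u ^^ j) a) = 0"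
        by (simp only: fsp.scale_zero_left)
    qed
  qed auto
  also have "\<dots> = a + (diff_op u ^^ p) a"
    using p by (simp add: fun_eq_iff)
  finally show ?thesis using assms by (simp add: diff_op_def)
qed

lemma diff_op_funpow_comm: "(diff_op u ^^ m) (diff_op v b) = diff_op v ((diff_op u ^^ m) b)"
proof (induction m)
  case (Suc m)
  have "diff_op u ((diff_op u ^^ m) (diff_op v b)) = diff_op v (diff_op u ((diff_op u ^^ m) b))"
    unfolding Suc.IH using fun_cong[OF diff_op_comm] by simp
  then show "(diff_op u ^^ Suc m) (diff_op v b) = diff_op v ((diff_op u ^^ Suc m) b)" by simp
qed simp

lemma diff_op_pow_p_power:
  assumes "u \<in> carrier P" "a \<in> carrier A"
  shows "(diff_op u ^^ (p ^ n)) a = diff_op (u [^] (p ^ n)) a"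
proof (induction n)
  case (Suc n)
  have eq: "(diff_op u ^^ (p ^ n * k)) a = (diff_op (u [^] (p ^ n)) ^^ k) a" for k
    using assms
  proof (induction k)
    case (Suc k)
    have "(diff_op u ^^ (p ^ n * Suc k)) a = (diff_op u ^^ (p ^ n * k)) ((diff_op u ^^ (p ^ n)) a)"
      by (simp add: add.commute flip: funpow_add comp_apply[of "_ ^^ _" "_ ^^ _"])
    also have "(diff_op u ^^ (p ^ n)) a = diff_op (u [^] (p ^ n)) a"
      by (rule \<open>(diff_op u ^^ (p ^ n)) a = diff_op (u [^] (p ^ n)) a\<close>)
    also have "(diff_op u ^^ (p ^ n * k)) (diff_op (u [^] (p ^ n)) a) = diff_op (u [^] (p ^ n)) ((diff_op u ^^ (p ^ n * k)) a)"
      by (rule diff_op_funpow_comm)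
    finally show ?case using Suc by simp
  qed simp
  show ?case
    using eq[of p] diff_op_pow_p[of "u [^] (p ^ n)" a] assms by (simp add: nat_pow_pow mult.commute)
qed (use assms in simp)

text \<open>Iterating the p-th power, the exponent |P| turns u - 1 into u^|P| - 1 = 0.\<close>

lemma diff_op_order:
  assumes "u \<in> carrier P" "a \<in> carrier A" "card (carrier P) \<le> n"
  shows "(diff_op u ^^ n) a = 0"
proof -
  obtain m where m: "order P = p ^ m" using p_group by blast
  have "(diff_op u ^^ order P) b = 0" if "b \<in> carrier A" for b
    using diff_op_pow_p_power[OF assms(1) that, of m] P.pow_order_eq_1[of u] assms(1) m that
    by (simp add: diff_op_def U_one)
  moreover have "n = order P + (n - order P)"
    using assms(3) by (simp add: order_def)
  ultimately show ?thesis
    using diff_op_funpow_closed[OF assms(2), of "n - order P" u] funpow_add[of "order P" "n - order P" "diff_op u"]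
    by simp
qed

lemma foldr_diff_op_closed: "a \<in> carrier A \<Longrightarrow> foldr diff_op ws a \<in> carrier A"
  by (induction ws) (auto simp: diff_op_closed)

text \<open>Pigeonhole: if N is a bound for the letters in F, then a word of length N + |P| over one
  more letter u contains u at least |P| times or has at least N letters from F.\<close>

lemma words_vanish:
  assumes "finite F" "F \<subseteq> carrier P"
  shows "\<exists>N. \<forall>ws a. set ws \<subseteq> F \<longrightarrow> N \<le> length ws \<longrightarrow> a \<in> carrier A \<longrightarrow> foldr diff_op ws a = 0"
  using assms
proof (induction F rule: finite_induct)
  case empty
  \<comment> \<open>The only word without letters is empty and acts as the identity, so the bound
    has to exceed its length 0.\<close>
  then show ?case by (intro exI[of _ 1]) auto
next
  case (insert u F)
  then obtain N where N: "\<forall>ws a. set ws \<subseteq> F \<longrightarrow> N \<le> length ws \<longrightarrow> a \<in> carrier A \<longrightarrow> foldr diff_op ws a = 0"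
    by blast
  have "foldr diff_op ws a = 0" if ws: "set ws \<subseteq> insert u F" "N + card (carrier P) \<le> length ws"
    and a: "a \<in> carrier A" for ws a
  proof -
    let ?vs = "filter (\<lambda>j. j \<noteq> u) ws"
    have len: "length ws = count_list ws u + length ?vs"
      by (induction ws) auto
    have eq: "foldr diff_op ws a = (diff_op u ^^ count_list ws u) (foldr diff_op ?vs a)"
      by (rule funpow_commute_foldr[OF diff_op_comm])
    show ?thesis
    proof (cases "N \<le> length ?vs")
      case True
      then have "foldr diff_op ?vs a = 0" using ws by (intro N[rule_format] a) auto
      then show ?thesis using eq by (simp add: diff_op_funpow_0)
    next
      case False
      then have "card (carrier P) \<le> count_list ws u" using len ws by linarith
      then show ?thesis
        using eq diff_op_order[of u "foldr diff_op ?vs a"] foldr_diff_op_closed[OF a] insert.prems by auto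
    qed
  qed
  then show ?case by blast
qed

lemma J_nilpotent: obtains N where "J N = {0}"
proof -
  have submod: "fsp.subspace {b. \<forall>ws. set ws \<subseteq> carrier P \<longrightarrow> N \<le> length ws + m \<longrightarrow> foldr diff_op ws b = 0}" for N m
    by (auto simp: fsp.subspace_def foldr_diff_op_linear)
  obtain N where N: "\<And>ws a. set ws \<subseteq> carrier P \<Longrightarrow> N \<le> length ws \<Longrightarrow> a \<in> carrier A \<Longrightarrow> foldr diff_op ws a = 0"
    using words_vanish[OF fin_P] by auto
  \<comment> \<open>An element of \<open>J m\<close> already carries m factors, so words of length N
    - m kill it. For m = N the empty word does, which means that the element is 0.\<close>
  have "\<forall>ws. set ws \<subseteq> carrier P \<longrightarrow> N \<le> length ws + m \<longrightarrow> foldr diff_op ws b = 0" if "b \<in> J m" for m b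
    using that
  proof (induction m arbitrary: b)
    case 0
    then show ?case using N by auto
  next
    case (Suc m)
    show ?case using Suc.prems
    proof (induction rule: J_Suc_induct)
      case (gen u a)
      have "foldr diff_op ws (U u \<star> a - a) = 0"
        if "set ws \<subseteq> carrier P" "N \<le> length ws + Suc m" for ws
        using Suc.IH[OF gen(2), rule_format, of "ws @ [u]"] that gen by (simp add: diff_op_def)
      then show "\<forall>ws. set ws \<subseteq> carrier P \<longrightarrow> N \<le> length ws + Suc m \<longrightarrow> foldr diff_op ws (U u \<star> a - a) = 0"
        by blast
    qed (rule submod)
  qed
  from this[of _ N] have "b = 0" if "b \<in> J N" for b
    using that by (metis add.left_neutral foldr.simps(1) id_apply le_refl list.set(1) list.size(3) empty_subsetI)
  then have "J N = {0}" using J_closed(1)[of N] by auto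
  then show thesis by (rule that)
qed

section \<open>Nilpotent ideals and the Jacobson radical\<close>

lemma left_ideal_scale:
  assumes "left_ideal L A" "a \<in> L"
  shows "fscale c a \<in> L"
proof -
  have "a \<in> carrier A"
    using assms by (meson additive_subgroup.a_subset left_ideal_def subsetD)
  moreover have "fscale c \<one>\<^bsub>A\<^esub> \<in> carrier A" by simp
  moreover have "fscale c \<one>\<^bsub>A\<^esub> \<star> a \<in> L"
    using assms calculation by (auto simp: left_ideal_def T.A_mult simp del: T.star_fscale_left)
  ultimately show ?thesis by simp
qed

text \<open>\<open>left_ideal\<close> only knows the ring structure; closure under scalars is
  multiplication by multiples of the unit.\<close>

lemma left_ideal_iff:
  "left_ideal L A \<longleftrightarrow> fsp.subspace L \<and> L \<subseteq> carrier A \<and> (\<forall>r\<in>carrier A. \<forall>x\<in>L. r \<star> x \<in> L)"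
proof
  assume L: "left_ideal L A"
  then have "additive_subgroup L A" by (simp add: left_ideal_def)
  then interpret additive_subgroup L A .
  show "fsp.subspace L \<and> L \<subseteq> carrier A \<and> (\<forall>r\<in>carrier A. \<forall>x\<in>L. r \<star> x \<in> L)"
    using L left_ideal_scale[OF L] a_subset zero_closed a_closed
    by (auto simp: left_ideal_def T.A_mult fsp.subspace_def T.A_zero T.A_add)
next
  assume L: "fsp.subspace L \<and> L \<subseteq> carrier A \<and> (\<forall>r\<in>carrier A. \<forall>x\<in>L. r \<star> x \<in> L)"
  interpret ring A by (rule T.ring_A)
  have "inv\<^bsub>add_monoid A\<^esub> x = - x" if "x \<in> L" for x
    using that L T.A_minus[of 0 x] by (auto simp: a_minus_def T.A_add a_inv_def)
  then have "subgroup L (add_monoid A)"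
    using L fsp.subspace_neg[of L]
    by (intro subgroup.intro) (auto simp: fsp.subspace_def T.A_zero T.A_add)
  then show "left_ideal L A"
    using L by (simp add: left_ideal_def additive_subgroup_def T.A_mult)
qed

lemma J1_jacobson: "J 1 \<subseteq> jacobson_radical A"
proof -
  have "J 1 \<subseteq> L" if L: "maximal_left_ideal L A" for L
  proof -
    have L': "fsp.subspace L" "L \<subseteq> carrier A" "\<And>r x. r \<in> carrier A \<Longrightarrow> x \<in> L \<Longrightarrow> r \<star> x \<in> L"
      using L by (auto simp: maximal_left_ideal_def left_ideal_iff)
    obtain N where N: "J N = {0}" by (rule J_nilpotent)
    \<comment> \<open>If not, maximality gives 1 = l + j with l \<in> L and j in
      \<open>J (Suc m)\<close>. For i in \<open>J (Suc m)\<close> then i = i l + i j, and i j lies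
      in the power 2m + 2 of J, hence in L by assumption.\<close>
    have step: "J (Suc m) \<subseteq> L" if "J (Suc (Suc m)) \<subseteq> L" for m
    proof (rule ccontr)
      assume not: "\<not> J (Suc m) \<subseteq> L"
      let ?K = "{x + y | x y. x \<in> L \<and> y \<in> J (Suc m)}"
      have "left_ideal ?K A"
        unfolding left_ideal_iff
      proof (intro conjI ballI)
        show "fsp.subspace ?K" by (rule fsp.subspace_sums[OF L'(1) J_subspace])
        show "?K \<subseteq> carrier A" using L'(2) J_A by auto
        fix r x assume "r \<in> carrier A" "x \<in> ?K"
        then show "r \<star> x \<in> ?K"
          using L'(3) star_J_left[of r _ "Suc m"] by (auto simp: T.star_add_right) blast
      qed
      moreover have "L \<subseteq> ?K"
        using J_closed(1)[of "Suc m"] add_0_right[symmetric] by blast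
      moreover have "J (Suc m) \<subseteq> ?K"
        using fsp.subspace_0[OF L'(1)] add_0_left[symmetric] by blast
      ultimately have "?K = carrier A"
        using L not unfolding maximal_left_ideal_def by blast
      then have "\<one>\<^bsub>A\<^esub> \<in> ?K" by simp
      then obtain l j where lj: "\<one>\<^bsub>A\<^esub> = l + j" "l \<in> L" "j \<in> J (Suc m)" by blast
      have "J (Suc m) \<subseteq> L"
      proof
        fix i assume i: "i \<in> J (Suc m)"
        have "i \<star> j \<in> J (Suc (Suc m))"
          using J_mult[OF i lj(3)] J_mono[of "Suc (Suc m)" "Suc m + Suc m"] by auto
        then have "i \<star> l + i \<star> j \<in> L"
          using that L' J_A[OF i] lj(2) fsp.subspace_add[OF L'(1)] by blast
        then show "i \<in> L" using lj(1) J_A[OF i] by (metis T.star_add_right T.star_one)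
      qed
      then show False using not by simp
    qed
    have "J (Suc N) \<subseteq> L"
      using N J_Suc_subset[of N] fsp.subspace_0[OF L'(1)] by auto
    \<comment> \<open>Descent from the zero ideal to \<open>J 1\<close>; once k reaches N the
      truncated difference stays 0 and the step is trivial.\<close>
    then have "J (Suc (N - k)) \<subseteq> L" for k
    proof (induction k)
      case (Suc k)
      then show ?case using step[of "N - Suc k"]
        by (cases "k < N") (auto simp: Suc_diff_Suc)
    qed simp
    from this[of N] show ?thesis by simp
  qed
  then show ?thesis
    using J_A by (auto simp: jacobson_radical_def)
qed

section \<open>Displacement by an automorphism\<close>

text \<open>Since P is abelian this is an endomorphism of P, with kernel C_P(y) and image [P,y],
  called \<open>theta_range\<close> below.\<close>

definition theta :: "('a \<Rightarrow> 'a) \<Rightarrow> 'a \<Rightarrow> 'a" where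
  "theta y u = inv u \<otimes> y u"

lemma theta_closed [simp]: "y \<in> E \<Longrightarrow> u \<in> carrier P \<Longrightarrow> theta y u \<in> carrier P"
  by (simp add: theta_def)

lemma theta_mult: "y \<in> E \<Longrightarrow> u \<in> carrier P \<Longrightarrow> v \<in> carrier P \<Longrightarrow> theta y (u \<otimes> v) = theta y u \<otimes> theta y v"
  by (simp add: theta_def inv_mult m_ac)

lemma theta_inv: "y \<in> E \<Longrightarrow> u \<in> carrier P \<Longrightarrow> theta y (inv u) = inv (theta y u)"
  by (simp add: theta_def inv_mult)

lemma theta_eq_one: "y \<in> E \<Longrightarrow> u \<in> carrier P \<Longrightarrow> theta y u = \<one> \<longleftrightarrow> y u = u"
  unfolding theta_def by (metis act_closed inv_closed inv_inv inv_equality l_inv m_comm)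

lemma act_theta: "x \<in> E \<Longrightarrow> y \<in> E \<Longrightarrow> u \<in> carrier P \<Longrightarrow> x (theta y u) = theta y (x u)"
  by (simp add: theta_def act_commute[of x y])

lemma coprime_pow_one:
  assumes z: "z \<in> carrier P" and "z [^] card E = \<one>"
  shows "z = \<one>"
proof -
  obtain m where m: "order P = p ^ m" using p_group by blast
  have "P.ord z dvd card E" using assms pow_eq_id by blast
  moreover have "P.ord z dvd p ^ m" using pow_order_eq_1[OF z] m pow_eq_id z by auto
  ultimately have "P.ord z = 1"
    using E_coprime by (metis coprime_common_divisor coprime_power_right_iff nat_dvd_1_iff_1 dvd_refl)
  then show ?thesis using z ord_eq_1 by blast
qed

text \<open>Put z = \<open>theta y u\<close>. If y fixes z, then the n-th power of y sends u to u
  z^n. Taking n = |E| gives z^|E| = 1, while z has p-power order. Thus C_P(y) and [P,y] meet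
  trivially.\<close>

lemma theta_fixed:
  assumes y: "y \<in> E" and u: "u \<in> carrier P" and fix_: "y (theta y u) = theta y u"
  shows "theta y u = \<one>"
proof -
  let ?z = "theta y u"
  have z: "?z \<in> carrier P" using y u by simp
  have yu: "y u = u \<otimes> ?z" using y u by (simp add: theta_def)
  have yz: "y (?z [^] n) = ?z [^] n" for n :: nat
    using y z fix_ by (induction n) auto
  have "(y [^]\<^bsub>H\<^esub> n) u = u \<otimes> ?z [^] n" for n :: nat
  proof (induction n)
    case (Suc n)
    have "y [^]\<^bsub>H\<^esub> n \<in> E" using H.nat_pow_closed[of y n] y by simp
    then have "(y [^]\<^bsub>H\<^esub> Suc n) u = y ((y [^]\<^bsub>H\<^esub> n) u)"
      using H.nat_pow_Suc2[of y n] y u by simp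
    also have "\<dots> = u \<otimes> ?z [^] Suc n"
      using Suc y u z yz by (simp add: yu m_assoc m_comm)
    finally show ?case .
  qed (use u in simp)
  from this[of "card E"] have "u = u \<otimes> ?z [^] card E"
    using H.pow_order_eq_1[of y] y u by (simp add: order_def)
  then have "?z [^] card E = \<one>"
    using u z by (metis l_cancel_one' nat_pow_closed)
  then show ?thesis by (rule coprime_pow_one[OF z])
qed

definition theta_range :: "('a \<Rightarrow> 'a) \<Rightarrow> 'a set" where
  "theta_range y = theta y ` carrier P"

lemma theta_range_closed: "y \<in> E \<Longrightarrow> q \<in> theta_range y \<Longrightarrow> q \<in> carrier P"
  by (auto simp: theta_range_def)

lemma theta_range_subgroup:
  assumes y: "y \<in> E"
  shows "subgroup (theta_range y) P"
proof (rule subgroupI)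
  show "theta_range y \<noteq> {}" by (auto simp: theta_range_def)
  fix a assume "a \<in> theta_range y"
  then obtain u where u: "a = theta y u" "u \<in> carrier P" by (auto simp: theta_range_def)
  then show "inv a \<in> theta_range y" using theta_inv[OF y u(2)] by (auto simp: theta_range_def intro!: image_eqI[of _ _ "inv u"])
  fix b assume "b \<in> theta_range y"
  then obtain v where v: "b = theta y v" "v \<in> carrier P" by (auto simp: theta_range_def)
  then show "a \<otimes> b \<in> theta_range y" using u theta_mult[OF y u(2) v(2)] by (auto simp: theta_range_def intro!: image_eqI[of _ _ "u \<otimes> v"])
qed (use y in \<open>auto simp: theta_range_def\<close>)

lemma theta_range_fixed: "y \<in> E \<Longrightarrow> q \<in> theta_range y \<Longrightarrow> y q = q \<Longrightarrow> q = \<one>"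
  using theta_fixed by (auto simp: theta_range_def)

lemma theta_theta_range: "y \<in> E \<Longrightarrow> u \<in> carrier P \<Longrightarrow> theta y u \<in> theta_range y"
  by (simp add: theta_range_def)

lemma theta_inj:
  assumes y: "y \<in> E" shows "inj_on (theta y) (theta_range y)"
proof (rule inj_onI)
  fix a b assume a: "a \<in> theta_range y" and b: "b \<in> theta_range y" and eq: "theta y a = theta y b"
  interpret QS: subgroup "theta_range y" P by (rule theta_range_subgroup[OF y])
  have ab: "a \<in> carrier P" "b \<in> carrier P" using a b y theta_range_closed by auto
  have "theta y (a \<otimes> inv b) = \<one>"
    using y ab eq by (simp add: theta_mult theta_inv)
  then have "y (a \<otimes> inv b) = a \<otimes> inv b" using theta_eq_one[OF y] ab by simp
  then have "a \<otimes> inv b = \<one>"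
    using theta_range_fixed[OF y, of "a \<otimes> inv b"] a b by blast
  then show "a = b" using ab by (metis inv_equality inv_inv inv_closed)
qed

lemma theta_image_theta_range: "y \<in> E \<Longrightarrow> theta y ` theta_range y = theta_range y"
  using theta_inj[of y] fin_P by (intro endo_inj_surj) (auto simp: theta_range_def)

lemma tau_ex1:
  assumes y: "y \<in> E" and g: "g \<in> carrier P"
  shows "\<exists>!q. q \<in> theta_range y \<and> theta y (theta y q) = theta y g"
proof -
  obtain q1 where q1: "q1 \<in> theta_range y" "theta y q1 = theta y g"
    using theta_image_theta_range[OF y] theta_theta_range[OF y g] by (metis imageE)
  obtain q where q: "q \<in> theta_range y" "theta y q = q1"
    using theta_image_theta_range[OF y] q1 by (metis imageE)
  show ?thesis
  proof (rule ex1I[of _ q])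
    fix r assume r: "r \<in> theta_range y \<and> theta y (theta y r) = theta y g"
    then have "theta y r \<in> theta_range y" "theta y q \<in> theta_range y" using y q theta_theta_range theta_range_closed by auto
    then have "theta y r = theta y q" using r q q1 theta_inj[OF y] by (metis inj_onD)
    then show "r = q" using r q theta_inj[OF y] by (metis inj_onD)
  qed (use q q1 in auto)
qed

text \<open>Projection of P onto [P,y] along C_P(y), followed by the inverse of
  \<open>theta y\<close> on [P,y]. Comparing after one more application of \<open>theta y\<close>
  kills the part in C_P(y), so the projection need not be constructed.\<close>

definition tau :: "('a \<Rightarrow> 'a) \<Rightarrow> 'a \<Rightarrow> 'a" where
  "tau y g = (THE q. q \<in> theta_range y \<and> theta y (theta y q) = theta y g)"

lemma tau: "y \<in> E \<Longrightarrow> g \<in> carrier P \<Longrightarrow> tau y g \<in> theta_range y \<and> theta y (theta y (tau y g)) = theta y g"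
  unfolding tau_def by (rule theI'[OF tau_ex1])

lemma tau_eqI: "y \<in> E \<Longrightarrow> g \<in> carrier P \<Longrightarrow> q \<in> theta_range y \<Longrightarrow> theta y (theta y q) = theta y g \<Longrightarrow> tau y g = q"
  unfolding tau_def by (rule the1_equality[OF tau_ex1]) auto

lemma tau_closed [simp]: "y \<in> E \<Longrightarrow> g \<in> carrier P \<Longrightarrow> tau y g \<in> carrier P"
  using tau theta_range_closed by blast

text \<open>This translation rule is what lets the cocycle identity be read as a coboundary formula
  for \<open>prim\<close>.\<close>

lemma tau_shift:
  assumes y: "y \<in> E" and g: "g \<in> carrier P" and v: "v \<in> theta_range y"
  shows "tau y (inv (theta y v) \<otimes> g) = tau y g \<otimes> inv v"
proof (rule tau_eqI[OF y])
  interpret QS: subgroup "theta_range y" P by (rule theta_range_subgroup[OF y])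
  have v': "v \<in> carrier P" using v y theta_range_closed by auto
  show "inv (theta y v) \<otimes> g \<in> carrier P" using y v' g by simp
  show "tau y g \<otimes> inv v \<in> theta_range y" using tau[OF y g] v by blast
  show "theta y (theta y (tau y g \<otimes> inv v)) = theta y (inv (theta y v) \<otimes> g)"
    using y v' g tau[OF y g] by (simp add: theta_mult theta_inv m_comm)
qed

lemma tau_act:
  assumes y: "y \<in> E" and x: "x \<in> E" and g: "g \<in> carrier P"
  shows "tau y (x g) = x (tau y g)"
proof (rule tau_eqI[OF y])
  obtain u where u: "u \<in> carrier P" "tau y g = theta y u" using tau[OF y g] by (auto simp: theta_range_def)
  then show "x (tau y g) \<in> theta_range y" using act_theta[OF x y u(1)] x theta_theta_range[OF y, of "x u"] by simp
  show "theta y (theta y (x (tau y g))) = theta y (x g)"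
    using x y g tau[OF y g] by (simp add: act_theta[symmetric])
qed (use x g in simp)

text \<open>The action of y permutes [P,y], so it fixes the product of all elements, and 1 is its
  only fixed point there.\<close>

lemma theta_range_prod:
  assumes y: "y \<in> E"
  shows "finprod P (\<lambda>q. q) (theta_range y) = \<one>"
proof (rule theta_range_fixed[OF y])
  interpret QS: subgroup "theta_range y" P by (rule theta_range_subgroup[OF y])
  have submod: "theta_range y \<subseteq> carrier P" using theta_range_closed[OF y] by auto
  have fin: "finite (theta_range y)" using fin_P submod finite_subset by blast
  have "finprod P (\<lambda>q. q) F \<in> theta_range y" if "finite F" "F \<subseteq> theta_range y" for F
    using that
  proof (induction F)
    case (insert q F)
    then have "(\<lambda>q. q) \<in> F \<rightarrow> carrier P" "q \<in> carrier P" using submod by auto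
    then show ?case using insert by (simp add: QS.m_closed)
  qed simp
  then show "finprod P (\<lambda>q. q) (theta_range y) \<in> theta_range y" using fin by simp
  have yQ: "y ` theta_range y = theta_range y"
  proof (rule endo_inj_surj[OF fin])
    show "y ` theta_range y \<subseteq> theta_range y" using y act_theta[OF y y] by (auto simp: theta_range_def)
    show "inj_on y (theta_range y)" using act_inj[OF y] submod by (auto intro!: inj_onI)
  qed
  have hom: "y (finprod P (\<lambda>q. q) F) = finprod P y F" if "finite F" "F \<subseteq> carrier P" for F
    using that
  proof (induction F)
    case (insert q F)
    then have "(\<lambda>q. q) \<in> F \<rightarrow> carrier P" "q \<in> carrier P" "y \<in> F \<rightarrow> carrier P"
      using y by auto
    then show ?case using insert y by simp
  qed (use y in simp)
  have "finprod P (\<lambda>q. q) (y ` theta_range y) = finprod P y (theta_range y)"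
    using act_inj[OF y] submod y by (subst finprod_reindex) (auto intro!: inj_onI)
  then show "y (finprod P (\<lambda>q. q) (theta_range y)) = finprod P (\<lambda>q. q) (theta_range y)"
    using hom[OF fin submod] yQ by simp
qed

text \<open>Modulo J^2 the map u \<mapsto> u - 1 turns products into sums, because (q - 1)(z - 1)
  lies in J^2.\<close>

lemma U_prod_mod_J2:
  assumes "finite F" "F \<subseteq> carrier P"
  shows "(\<Sum>q\<in>F. U q) - fscale (of_nat (card F)) \<one>\<^bsub>A\<^esub> - (U (finprod P (\<lambda>q. q) F) - \<one>\<^bsub>A\<^esub>) \<in> J 2"
  using assms
proof (induction F)
  case empty
  then show "(\<Sum>q\<in>{}. U q) - fscale (of_nat (card {})) \<one>\<^bsub>A\<^esub> - (U (finprod P (\<lambda>q. q) {}) - \<one>\<^bsub>A\<^esub>) \<in> J 2"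
    using J_closed(1)[of 2] by (simp add: U_one fsp.scale_zero_left)
next
  case (insert q F)
  let ?z = "finprod P (\<lambda>q. q) F"
  have fn: "(\<lambda>q. q) \<in> F \<rightarrow> carrier P" and q: "q \<in> carrier P" using insert by auto
  have z: "?z \<in> carrier P" using fn by (rule finprod_closed)
  have "(U q - \<one>\<^bsub>A\<^esub>) \<star> (U ?z - \<one>\<^bsub>A\<^esub>) \<in> J (1 + 1)"
    using q z by (intro J_mult U_minus_one)
  then have "(U q - \<one>\<^bsub>A\<^esub>) \<star> (U ?z - \<one>\<^bsub>A\<^esub>) \<in> J 2" by (simp add: numeral_2_eq_2)
  moreover have "(U q - \<one>\<^bsub>A\<^esub>) \<star> (U ?z - \<one>\<^bsub>A\<^esub>) = U (q \<otimes> ?z) - U q - U ?z + \<one>\<^bsub>A\<^esub>"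
    using q z by (simp add: T.star_diff_left T.star_diff_right U_mult)
  moreover have "finprod P (\<lambda>q. q) (insert q F) = q \<otimes> ?z"
    using insert.hyps fn q by simp
  moreover have "(\<Sum>q\<in>insert q F. U q) = U q + (\<Sum>q\<in>F. U q)"
    using insert.hyps by (rule sum.insert)
  moreover have "fscale (of_nat (card (insert q F))) \<one>\<^bsub>A\<^esub> = \<one>\<^bsub>A\<^esub> + fscale (of_nat (card F)) \<one>\<^bsub>A\<^esub>"
    using insert.hyps by (simp add: fsp.scale_left_distrib)
  moreover have "(U q + s) - (e + c) - (qz - e) = (s - c - (zz - e)) - (qz - U q - zz + e)"
    for s e c qz zz :: "'a \<times> ('a \<Rightarrow> 'a) \<Rightarrow> 'k" by (simp add: algebra_simps)
  ultimately show "(\<Sum>q\<in>insert q F. U q) - fscale (of_nat (card (insert q F))) \<one>\<^bsub>A\<^esub>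
      - (U (finprod P (\<lambda>q. q) (insert q F)) - \<one>\<^bsub>A\<^esub>) \<in> J 2"
    using insert J_closed(4)[of "(\<Sum>q\<in>F. U q) - fscale (of_nat (card F)) \<one>\<^bsub>A\<^esub> - (U ?z - \<one>\<^bsub>A\<^esub>)" 2]
    by (metis insert_subset)
qed

text \<open>The order of [P,y] divides that of P and is not 1, as only the identity of E acts
  trivially on P; hence p divides it.\<close>

lemma theta_range_card:
  assumes y: "y \<in> E" "y \<noteq> \<one>\<^sub>E"
  shows "(of_nat (card (theta_range y)) :: 'k) = 0"
proof -
  obtain m where m: "order P = p ^ m" using p_group by blast
  have "card (theta_range y) dvd p ^ m"
    using lagrange[OF theta_range_subgroup[OF y(1)]] m by (metis dvd_triv_right)
  moreover have "card (theta_range y) \<noteq> 1"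
  proof
    assume "card (theta_range y) = 1"
    then obtain q where q: "theta_range y = {q}" by (metis card_1_singletonE)
    have "\<one> \<in> theta_range y" using subgroup.one_closed[OF theta_range_subgroup[OF y(1)]] .
    then have "theta y u = \<one>" if "u \<in> carrier P" for u
      using theta_theta_range[OF y(1) that] q by auto
    then have "y = \<one>\<^sub>E"
      using y theta_eq_one[OF y(1)] by (intro E_eqI) auto
    with y show False by simp
  qed
  ultimately have "p dvd card (theta_range y)"
    using prime_p by (metis divides_primepow_nat dvd_power neq0_conv power_0)
  then show ?thesis using char_p by (simp add: of_nat_eq_0_iff_char_dvd)
qed

lemma sum_theta_range_J2: "y \<in> E \<Longrightarrow> y \<noteq> \<one>\<^sub>E \<Longrightarrow> (\<Sum>q\<in>theta_range y. U q) \<in> J 2"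
  using U_prod_mod_J2[of "theta_range y"] finite_subset[OF _ fin_P, of "theta_range y"] theta_range_closed[of y]
  by (auto simp: theta_range_prod U_one theta_range_card fsp.scale_zero_left)

text \<open>Modulo \<open>J\<^sup>2\<close> the sum over \<open>[P,y]\<close> is \<open>w - 1\<close>, with \<open>w\<close> the product of all elements;
  \<open>w\<close> is fixed by \<open>y\<close>, hence trivial.\<close>
lemma theta_range_invariant_J2:
  assumes y: "y \<in> E" "y \<noteq> \<one>\<^sub>E" and a: "a \<in> carrier A"
    and invar: "\<And>q. q \<in> theta_range y \<Longrightarrow> U q \<star> a = a"
  shows "a \<in> J 2"
proof -
  interpret QS: subgroup "theta_range y" P by (rule theta_range_subgroup[OF y(1)])
  have submod: "theta_range y \<subseteq> carrier P" using theta_range_closed[OF y(1)] by auto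
  have fin: "finite (theta_range y)" using fin_P submod finite_subset by blast
  \<comment> \<open>\<open>rep g\<close> picks one element of each coset of [P,y], and b keeps only
    the coefficients of a at these elements. As a is constant on cosets, it is the sum over [P,y]
    times b.\<close>
  define rep where "rep g = (SOME h. h \<in> theta_range y #> g)" for g
  define b where "b = (\<lambda>(g, x). if g = rep g then a (g, x) else 0)"
  have b: "b \<in> carrier A" using a by (auto simp: b_def T.A_carrier)
  have "a = (\<Sum>q\<in>theta_range y. U q) \<star> b"
  proof (rule A_eqI[OF a])
    fix g x assume g: "g \<in> carrier P" and x: "x \<in> E"
    have rep: "rep g \<in> theta_range y #> g"
      unfolding rep_def using rcos_self[OF g theta_range_subgroup[OF y(1)]] by (rule someI)
    then obtain r where r: "r \<in> theta_range y" "rep g = r \<otimes> g" by (auto simp: r_coset_def)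
    have rep_shift: "rep (inv q \<otimes> g) = rep g" if q: "q \<in> theta_range y" for q
    proof -
      have "theta_range y #> (inv q \<otimes> g) = theta_range y #> g"
        using q submod g theta_range_subgroup[OF y(1)]
        by (intro repr_independence[symmetric]) (auto simp: r_coset_def)
      then show ?thesis by (simp add: rep_def)
    qed
    have "((\<Sum>q\<in>theta_range y. U q) \<star> b) (g, x) = (\<Sum>q\<in>theta_range y. b (inv q \<otimes> g, x))"
      unfolding T.star_sum_left sum_apply using g x submod by (intro sum.cong) (auto simp: U_star)
    \<comment> \<open>In the coset of g exactly one translate is the representative, the one for q =
      r^{-1}.\<close>
    also have "\<dots> = (\<Sum>q\<in>theta_range y. if q = inv r then a (g, x) else 0)"
    proof (rule sum.cong)
      fix q assume q: "q \<in> theta_range y"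
      have "a (inv q \<otimes> g, x) = a (g, x)"
        using invar[OF q] U_star[of q g x a] g x q submod by auto
      moreover have "inv q \<otimes> g = rep (inv q \<otimes> g) \<longleftrightarrow> q = inv r"
      proof -
        have qr: "q \<in> carrier P" "r \<in> carrier P" using q r submod by auto
        then have "inv q \<otimes> g = r \<otimes> g \<longleftrightarrow> inv q = r" using g by simp
        also have "\<dots> \<longleftrightarrow> q = inv r" using qr inv_inv by metis
        finally show ?thesis using rep_shift[OF q] r by simp
      qed
      ultimately show "b (inv q \<otimes> g, x) = (if q = inv r then a (g, x) else 0)"
        by (simp only: b_def prod.case)
    qed simp
    also have "\<dots> = a (g, x)" using r fin by (simp add: sum.delta)
    finally show "a (g, x) = ((\<Sum>q\<in>theta_range y. U q) \<star> b) (g, x)" by simp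
  qed simp
  then show ?thesis using star_J_right[OF sum_theta_range_J2[OF y] b] by simp
qed

end

section \<open>Derivations\<close>

text \<open>Left in the simpset, the pointwise rules would turn sums in the algebra into abstractions.\<close>
declare plus_fun_apply [simp del] zero_fun_apply [simp del] minus_apply [simp del]
  uminus_apply [simp del] fscale_apply [simp del]

lemmas fun_apply = fscale_apply plus_fun_apply zero_fun_apply minus_apply uminus_apply

context p_setting
begin

definition ad :: "('a \<times> ('a \<Rightarrow> 'a) \<Rightarrow> 'k) \<Rightarrow> ('a \<times> ('a \<Rightarrow> 'a) \<Rightarrow> 'k) \<Rightarrow> 'a \<times> ('a \<Rightarrow> 'a) \<Rightarrow> 'k" where
  "ad c = (\<lambda>a\<in>carrier A. c \<star> a - a \<star> c)"

lemma inner_iff: "D \<in> inner_derivations A \<longleftrightarrow> (\<exists>c\<in>carrier A. D = ad c)"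
proof -
  have "(\<lambda>a\<in>carrier A. (c \<otimes>\<^bsub>A\<^esub> a) \<ominus>\<^bsub>A\<^esub> (a \<otimes>\<^bsub>A\<^esub> c)) = ad c" for c
    unfolding ad_def by (rule restrict_ext) (simp add: T.A_mult T.A_minus)
  then show ?thesis unfolding inner_derivations_def by auto
qed

lemma derivation_iff:
  "D \<in> derivations A \<longleftrightarrow> D \<in> carrier A \<rightarrow>\<^sub>E carrier A \<and>
    (\<forall>a\<in>carrier A. \<forall>b\<in>carrier A. D (a + b) = D a + D b) \<and>
    (\<forall>c. \<forall>a\<in>carrier A. D (fscale c a) = fscale c (D a)) \<and>
    (\<forall>a\<in>carrier A. \<forall>b\<in>carrier A. D (a \<star> b) = D a \<star> b + a \<star> D b)"
  by (simp add: derivations_def T.A_add T.A_smult T.A_mult)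

lemma der_closed [simp]: "D \<in> derivations A \<Longrightarrow> a \<in> carrier A \<Longrightarrow> D a \<in> carrier A"
  unfolding derivation_iff by auto

lemma der_add: "D \<in> derivations A \<Longrightarrow> a \<in> carrier A \<Longrightarrow> b \<in> carrier A \<Longrightarrow> D (a + b) = D a + D b"
  unfolding derivation_iff by auto

lemma der_fscale: "D \<in> derivations A \<Longrightarrow> a \<in> carrier A \<Longrightarrow> D (fscale c a) = fscale c (D a)"
  unfolding derivation_iff by auto

lemma der_star: "D \<in> derivations A \<Longrightarrow> a \<in> carrier A \<Longrightarrow> b \<in> carrier A \<Longrightarrow> D (a \<star> b) = D a \<star> b + a \<star> D b"
  unfolding derivation_iff by auto

lemma der_zero: "D \<in> derivations A \<Longrightarrow> D 0 = 0"
  using der_fscale[of D 0 0] by (simp add: fsp.scale_zero_left)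

lemma der_diff: "D \<in> derivations A \<Longrightarrow> a \<in> carrier A \<Longrightarrow> b \<in> carrier A \<Longrightarrow> D (a - b) = D a - D b"
  using der_add[of D "a - b" b] by simp

lemma der_one: "D \<in> derivations A \<Longrightarrow> D \<one>\<^bsub>A\<^esub> = 0"
  using der_star[of D "\<one>\<^bsub>A\<^esub>" "\<one>\<^bsub>A\<^esub>"] by simp

lemma der_subspace:
  assumes "D \<in> derivations A" "fsp.subspace V"
  shows "fsp.subspace {a. a \<in> carrier A \<and> D a \<in> V}"
  using assms der_add[OF assms(1)] der_fscale[OF assms(1)] der_zero[OF assms(1)]
  by (auto simp: fsp.subspace_def)

text \<open>With D zero on the \<open>W x\<close>, the product rule gives D(u x) = D(u) x, so the
  values of D are controlled by those on P.\<close>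

lemma der_vanish:
  assumes D: "D \<in> derivations A" and W: "\<And>x. x \<in> E \<Longrightarrow> D (W x) = 0" and a: "a \<in> carrier A"
    and U: "\<And>u. u \<in> carrier P \<Longrightarrow> D (U u) \<in> J m"
  shows "D a \<in> J m"
proof -
  have "a \<in> carrier A \<and> D a \<in> J m" using a
  proof (induction rule: A_induct)
    case (delta u x)
    then show "U u \<star> W x \<in> carrier A \<and> D (U u \<star> W x) \<in> J m"
      using der_star[OF D, of "U u" "W x"] W U by (simp add: star_J_right)
  qed (intro der_subspace D J_subspace)
  then show ?thesis by simp
qed

lemma ad_der: "c \<in> carrier A \<Longrightarrow> ad c \<in> derivations A"
  unfolding derivation_iff
  by (auto simp: ad_def T.star_add_left T.star_add_right T.star_diff_left T.star_diff_right T.star_assoc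
      fsp.scale_right_diff_distrib)

lemma diff_der:
  assumes "D \<in> derivations A" "D' \<in> derivations A"
  shows "(\<lambda>a\<in>carrier A. D a - D' a) \<in> derivations A"
  unfolding derivation_iff
  using assms by (auto simp: der_add der_fscale der_star T.star_diff_left T.star_diff_right
      fsp.scale_right_diff_distrib)

definition bracket where
  "bracket D D' = (\<lambda>a\<in>carrier A. D (D' a) - D' (D a))"

lemma bracket_der:
  assumes "D \<in> derivations A" "D' \<in> derivations A"
  shows "bracket D D' \<in> derivations A"
  unfolding derivation_iff bracket_def
  using assms by (auto simp: der_add der_fscale der_star T.star_diff_left T.star_diff_right
      fsp.scale_right_diff_distrib algebra_simps)

lemma Wi_mult:
  assumes x: "x \<in> E" and y: "y \<in> E"
  shows "Wi (x \<cdot> y) = fscale (\<alpha> x y) (Wi y \<star> Wi x)"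
proof -
  have "Wi y \<star> Wi x \<star> (W x \<star> W y) = Wi y \<star> (Wi x \<star> W x) \<star> W y"
    by (simp add: T.star_assoc)
  also have "\<dots> = \<one>\<^bsub>A\<^esub>" using x y by simp
  finally have "fscale (\<alpha> x y) (Wi y \<star> Wi x) \<star> W (x \<cdot> y) = \<one>\<^bsub>A\<^esub>"
    using x y by (simp add: W_mult)
  then have "fscale (\<alpha> x y) (Wi y \<star> Wi x) \<star> W (x \<cdot> y) \<star> Wi (x \<cdot> y) = Wi (x \<cdot> y)"
    using x y by simp
  then show ?thesis using x y by (simp add: T.star_assoc)
qed

text \<open>Averaging over \<open>E\<close>: \<open>D(x) x\<^sup>-\<^sup>1\<close> is a \<open>1\<close>-cocycle on \<open>E\<close>, and \<open>|E|\<close> is invertible.\<close>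
lemma der_normalise:
  assumes D: "D \<in> derivations A"
  obtains c where "c \<in> carrier A" "\<And>x. x \<in> E \<Longrightarrow> D (W x) = c \<star> W x - W x \<star> c"
proof -
  define t where "t x = D (W x) \<star> Wi x" for x
  have t: "t x \<in> carrier A" if "x \<in> E" for x by (simp add: t_def)
  have t_mult: "t (x \<cdot> y) = t x + W x \<star> t y \<star> Wi x" if x: "x \<in> E" and y: "y \<in> E" for x y
  proof -
    have "fscale (\<alpha> x y) (D (W (x \<cdot> y))) = D (W x \<star> W y)"
      using x y D by (simp add: W_mult der_fscale)
    also have "\<dots> = D (W x) \<star> W y + W x \<star> D (W y)"
      using x y D by (simp add: der_star)
    finally have "t (x \<cdot> y) = (D (W x) \<star> W y + W x \<star> D (W y)) \<star> (Wi y \<star> Wi x)"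
      unfolding t_def Wi_mult[OF x y] by (metis T.star_fscale_left T.star_fscale_right)
    also have "\<dots> = D (W x) \<star> (W y \<star> Wi y) \<star> Wi x + W x \<star> t y \<star> Wi x"
      by (simp add: T.star_add_left T.star_assoc t_def)
    finally show ?thesis using x y D by (simp add: t_def)
  qed
  \<comment> \<open>Summing \<open>t_mult\<close> over y gives s = n t(x) + x s x^{-1}. Multiplied
    by x and divided by n, this says that D and the inner derivation of s/n agree at
    \<open>W x\<close>.\<close>
  define s where "s = (\<Sum>y\<in>E. t y)"
  have s: "s \<in> carrier A" unfolding s_def by (simp add: t)
  define n where "n = (of_nat (card E) :: 'k)"
  have main: "s \<star> W x = fscale n (D (W x)) + W x \<star> s" if x: "x \<in> E" for x
  proof -
    have "s = (\<Sum>y\<in>E. t (x \<cdot> y))"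
      unfolding s_def by (rule sum.reindex_bij_witness[of _ "\<lambda>y. x \<cdot> y" "\<lambda>y. einv x \<cdot> y"]) (use x in auto)
    also have "\<dots> = fscale n (t x) + W x \<star> s \<star> Wi x"
      using x by (simp add: t_mult sum.distrib T.star_sum_left T.star_sum_right s_def n_def
          fsp.sum_constant_scale del: sum_constant)
    finally have "s \<star> W x = (fscale n (t x) + W x \<star> s \<star> Wi x) \<star> W x" by simp
    also have "\<dots> = fscale n (D (W x)) + W x \<star> s"
      using x D s by (simp add: T.star_add_left T.star_assoc t_def)
    finally show ?thesis .
  qed
  show thesis
  proof (rule that[of "fscale (inverse n) s"])
    show "fscale (inverse n) s \<in> carrier A" using s by simp
    fix x assume x: "x \<in> E"
    have "n \<noteq> 0" using card_E_nz by (simp add: n_def)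
    then have "D (W x) = fscale (inverse n) (fscale n (D (W x)))" by simp
    also have "fscale n (D (W x)) = s \<star> W x - W x \<star> s" using main[OF x] by simp
    finally show "D (W x) = fscale (inverse n) s \<star> W x - W x \<star> fscale (inverse n) s"
      by (simp add: fsp.scale_right_diff_distrib)
  qed
qed

text \<open>The degree y part is kP times y with kP commutative, so u moves to the left as y(u). For
  y = 1 this says that degree 1 commutes with kP, which later rules out nonzero inner lifts.\<close>

lemma pr_supp: "y \<in> E \<Longrightarrow> u \<in> carrier P \<Longrightarrow> pr y a \<star> U u = U (y u) \<star> pr y a"
  by (rule A_eqI) (auto simp: star_U U_star m_comm)

text \<open>The map \<open>d\<close> of the introduction: \<open>u \<mapsto> u\<^sup>-\<^sup>1 D\<^sub>y(u)\<close>.\<close>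
definition der_coc where
  "der_coc D y u = U (inv u) \<star> pr y (D (U u))"

lemma der_coc_closed [simp]: "der_coc D y u \<in> carrier A"
  by (simp add: der_coc_def)

lemma der_coc_pr: "y \<in> E \<Longrightarrow> u \<in> carrier P \<Longrightarrow> pr y (der_coc D y u) = der_coc D y u"
  by (simp add: der_coc_def pr_U_star pr_pr)

lemma der_coc_mult:
  assumes D: "D \<in> derivations A" and y: "y \<in> E" and u: "u \<in> carrier P" and v: "v \<in> carrier P"
  shows "der_coc D y (u \<otimes> v) = U (theta y v) \<star> der_coc D y u + der_coc D y v"
proof -
  have "pr y (D (U (u \<otimes> v))) = pr y (D (U u)) \<star> U v + U u \<star> pr y (D (U v))"
    using u v y D by (simp add: U_mult[symmetric] der_star pr_linear pr_star_U pr_U_star)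
  also have "\<dots> = U (y v) \<star> pr y (D (U u)) + U u \<star> pr y (D (U v))"
    using y v by (simp add: pr_supp)
  finally have "der_coc D y (u \<otimes> v) = U (inv (u \<otimes> v)) \<star> U (y v) \<star> pr y (D (U u))
      + U (inv (u \<otimes> v)) \<star> U u \<star> pr y (D (U v))"
    by (simp add: der_coc_def T.star_add_right T.star_assoc)
  also have "U (inv (u \<otimes> v)) \<star> U (y v) = U (theta y v) \<star> U (inv u)"
    using u v y by (simp add: U_mult theta_def inv_mult m_ac)
  also have "U (inv (u \<otimes> v)) \<star> U u = U (inv v)"
    using u v by (simp add: U_mult inv_mult m_ac)
  finally show ?thesis by (simp add: der_coc_def T.star_assoc)
qed

lemma der_coc_equivariant:
  assumes D: "D \<in> derivations A" and W: "\<And>x. x \<in> E \<Longrightarrow> D (W x) = 0"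
    and x: "x \<in> E" and y: "y \<in> E" and u: "u \<in> carrier P"
  shows "W x \<star> der_coc D y u = der_coc D y (x u) \<star> W x"
proof -
  have "W x \<star> D (U u) = D (U (x u)) \<star> W x"
    using W_U[OF u x] der_star[OF D, of "W x" "U u"] der_star[OF D, of "U (x u)" "W x"] W x u by simp
  then have "pr (x \<cdot> y) (W x \<star> D (U u)) = pr (y \<cdot> x) (D (U (x u)) \<star> W x)"
    using x y H.m_comm[of x y] by simp
  then have eq: "W x \<star> pr y (D (U u)) = pr y (D (U (x u))) \<star> W x"
    using x y by (simp add: pr_W_star pr_star_W)
  have "W x \<star> der_coc D y u = (W x \<star> U (inv u)) \<star> pr y (D (U u))"
    by (simp add: der_coc_def T.star_assoc)
  also have "\<dots> = U (inv (x u)) \<star> (W x \<star> pr y (D (U u)))"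
    using x u by (simp add: W_U T.star_assoc)
  finally show ?thesis by (simp add: eq der_coc_def T.star_assoc)
qed

text \<open>The coefficient at \<open>(x v, x \<cdot> y)\<close>. As E is abelian, conjugation by x
  keeps the degree y and contributes only the scalar \<alpha>(x,y)/\<alpha>(y,x).\<close>

lemma der_coc_equivariant_apply:
  assumes "D \<in> derivations A" "\<And>x. x \<in> E \<Longrightarrow> D (W x) = 0"
    and x: "x \<in> E" and y: "y \<in> E" and u: "u \<in> carrier P" and v: "v \<in> carrier P"
  shows "\<alpha> x y * der_coc D y u (v, y) = \<alpha> y x * der_coc D y (x u) (x v, y)"
  using arg_cong[OF der_coc_equivariant[OF assms(1-5)], of "\<lambda>f. f (x v, x \<cdot> y)"] x y u v
    H.m_comm[of x y] E_cancel(2)[of x y] E_cancel(3)[of y x]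
    by (simp add: W_star star_W del: E_cancel)

text \<open>On \<open>[P,y]\<close>, reindexing by the inverse \<open>\<tau>\<close> of \<open>\<theta>\<close> turns the cocycle identity into
  \<open>d(v) = \<theta>(v) c - c\<close> with \<open>c(g) = - d(\<tau>(g))(g)\<close>.\<close>
definition prim where
  "prim D y = (\<lambda>(g, z). if z = y \<and> g \<in> carrier P then - der_coc D y (tau y g) (g, y) else 0)"

lemma prim_apply: "g \<in> carrier P \<Longrightarrow> prim D y (g, y) = - der_coc D y (tau y g) (g, y)"
  by (simp add: prim_def)

lemma prim_closed [simp]: "y \<in> E \<Longrightarrow> prim D y \<in> carrier A"
  by (auto simp: prim_def T.A_carrier)

lemma pr_prim: "pr z (prim D y) = (if z = y then prim D y else 0)"
  by (auto simp: prim_def fun_eq_iff zero_fun_apply)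

lemma star_prim_supp:
  assumes y: "y \<in> E" and u: "u \<in> carrier P" and a: "a = pr y a" "a \<in> carrier A"
    and b: "b = pr y b" "b \<in> carrier A"
    and eq: "\<And>g. g \<in> carrier P \<Longrightarrow> a (g, y) = b (g, y)"
  shows "a = b"
proof (rule A_eqI[OF a(2) b(2)])
  fix g x assume g: "g \<in> carrier P" "x \<in> E"
  show "a (g, x) = b (g, x)"
    using eq[OF g(1)] fun_cong[OF a(1), of "(g, x)"] fun_cong[OF b(1), of "(g, x)"]
    by (cases "x = y") auto
qed

lemma prim_theta_range:
  assumes D: "D \<in> derivations A" and y: "y \<in> E" and v: "v \<in> theta_range y"
  shows "der_coc D y v = U (theta y v) \<star> prim D y - prim D y"
proof -
  interpret QS: subgroup "theta_range y" P by (rule theta_range_subgroup[OF y])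
  have v': "v \<in> carrier P" using v y theta_range_closed by auto
  then have tv: "theta y v \<in> carrier P" using y by simp
  show ?thesis
  proof (rule star_prim_supp[OF y v'])
    fix g assume g: "g \<in> carrier P"
    define w where "w = tau y (inv (theta y v) \<otimes> g)"
    have w: "w \<in> carrier P" using tv g y by (simp add: w_def)
    \<comment> \<open>The cocycle identity for w and v, read at g, compares the coefficients of
      \<open>prim\<close> at g and at \<open>inv (theta y v) \<otimes> g\<close>.\<close>
    have "tau y g = w \<otimes> v"
      using tau_shift[OF y g v] v' g y by (simp add: w_def)
    then have "der_coc D y (tau y g) (g, y) = der_coc D y w (inv (theta y v) \<otimes> g, y) + der_coc D y v (g, y)"
      using der_coc_mult[OF D y w v'] tv g y by (simp add: U_star plus_fun_apply)
    then show "der_coc D y v (g, y) = (U (theta y v) \<star> prim D y - prim D y) (g, y)"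
      using tv g y by (simp add: U_star fun_apply prim_apply w_def)
  qed (use y v' tv in \<open>simp_all add: der_coc_pr pr_linear pr_U_star pr_prim\<close>)
qed

text \<open>Follows from the equivariance of \<open>der_coc\<close> and of \<open>tau\<close>. Hence
  subtracting the inner derivation of \<open>prim D y\<close> keeps D zero on the
  \<open>W x\<close>.\<close>

lemma prim_W:
  assumes D: "D \<in> derivations A" "\<And>x. x \<in> E \<Longrightarrow> D (W x) = 0" and y: "y \<in> E" and x: "x \<in> E"
  shows "W x \<star> prim D y = prim D y \<star> W x"
proof (rule A_eqI)
  fix g z assume g: "g \<in> carrier P" and z: "z \<in> E"
  have comm: "einv x \<cdot> z = z \<cdot> einv x"
    using x z H.m_comm[of "einv x" z] by simp
  show "(W x \<star> prim D y) (g, z) = (prim D y \<star> W x) (g, z)"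
  proof (cases "z \<cdot> einv x = y")
    case True
    have xg: "einv x g \<in> carrier P" using x g by simp
    have "tau y (einv x g) \<in> carrier P" "x (tau y (einv x g)) = tau y g"
      using xg y x g tau_act[OF y x xg] by auto
    then have "\<alpha> x y * der_coc D y (tau y (einv x g)) (einv x g, y) = \<alpha> y x * der_coc D y (tau y g) (g, y)"
      using der_coc_equivariant_apply[OF D x y _ xg, of "tau y (einv x g)"] x g by simp
    then show ?thesis using True x g z xg comm by (simp add: W_star star_W prim_apply)
  next
    case False
    then show ?thesis using x g z comm by (simp add: W_star star_W prim_def)
  qed
qed auto

text \<open>Subtracting the coboundary leaves a cocycle that is zero on [P,y], so only its values on
  C_P(y) matter.\<close>

lemma der_coc_minus_prim:
  assumes D: "D \<in> derivations A" and y: "y \<in> E" "y \<noteq> \<one>\<^sub>E" and u: "u \<in> carrier P"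
  shows "der_coc D y u - (U (theta y u) \<star> prim D y - prim D y) \<in> J 2"
proof -
  define d where "d u = der_coc D y u - (U (theta y u) \<star> prim D y - prim D y)" for u
  have d_closed: "d v \<in> carrier A" if "v \<in> carrier P" for v
    using that y by (simp add: d_def)
  have d_mult: "d (v \<otimes> w) = U (theta y w) \<star> d v + d w" if "v \<in> carrier P" "w \<in> carrier P" for v w
  proof -
    have "U (theta y (v \<otimes> w)) = U (theta y w) \<star> U (theta y v)"
      using that y by (simp add: theta_mult U_mult m_comm)
    then show ?thesis
      using that y D by (simp add: d_def der_coc_mult T.star_diff_right T.star_assoc)
  qed
  have d_theta_range: "d q = 0" if "q \<in> theta_range y" for q
    using prim_theta_range[OF D y(1) that] by (simp add: d_def)
  \<comment> \<open>Evaluating d at v w = w v gives q d(v) = d(v) for q = \<open>theta y w\<close>,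
    so d(v) is invariant under [P,y].\<close>
  have fixed: "d v \<in> J 2" if v: "v \<in> carrier P" "theta y v = \<one>" for v
  proof (rule theta_range_invariant_J2[OF y d_closed[OF v(1)]])
    fix q assume "q \<in> theta_range y"
    then obtain w where w: "w \<in> carrier P" "q = theta y w" by (auto simp: theta_range_def)
    have "d (v \<otimes> w) = d (w \<otimes> v)" using v w by (simp add: m_comm)
    then have "U q \<star> d v + d w = d w + d v"
      using d_mult[OF v(1) w(1)] d_mult[OF w(1) v(1)] v w d_closed[OF w(1)] by (simp add: U_one)
    then show "U q \<star> d v = d v" by (simp add: add.commute)
  qed
  \<comment> \<open>The splitting u = (u q^{-1}) q along P = C_P(y) [P,y].\<close>
  obtain q where q: "q \<in> theta_range y" "theta y q = theta y u"
    using theta_image_theta_range[OF y(1)] theta_theta_range[OF y(1) u] by (metis imageE)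
  have q': "q \<in> carrier P" using q y theta_range_closed by auto
  have "theta y (u \<otimes> inv q) = \<one>"
    using u q q' y by (simp add: theta_mult theta_inv)
  then have "d (u \<otimes> inv q) \<in> J 2" using u q' by (intro fixed) auto
  then have "U (theta y q) \<star> d (u \<otimes> inv q) + d q \<in> J 2"
    using q' y d_theta_range[OF q(1)] by (simp add: U_left_J)
  then have "d (u \<otimes> inv q \<otimes> q) \<in> J 2"
    using d_mult[of "u \<otimes> inv q" q] u q' by simp
  then show ?thesis using u q' by (simp add: d_def)
qed

text \<open>The augmentation of \<open>D\<^sub>1\<close> is an \<open>E\<close>-invariant homomorphism \<open>P \<rightarrow> k\<close>, hence trivial
  because \<open>P = [P,E]\<close>.\<close>
lemma der_coc_one_J1:
  assumes D: "D \<in> derivations A" "\<And>x. x \<in> E \<Longrightarrow> D (W x) = 0" and u: "u \<in> carrier P"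
  shows "der_coc D \<one>\<^sub>E u \<in> J 1"
proof -
  define s where "s v = (\<Sum>g\<in>carrier P. der_coc D \<one>\<^sub>E v (g, \<one>\<^sub>E))" for v
  have th1: "theta \<one>\<^sub>E v = \<one>" if "v \<in> carrier P" for v
    using that by (simp add: theta_def)
  have s_mult: "s (v \<otimes> w) = s v + s w" if "v \<in> carrier P" "w \<in> carrier P" for v w
    using der_coc_mult[OF D(1) _ that, of "\<one>\<^sub>E"] that
    by (simp add: s_def th1 U_one plus_fun_apply sum.distrib)
  have s_act: "s (x v) = s v" if x: "x \<in> E" and v: "v \<in> carrier P" for x v
  proof -
    \<comment> \<open>In degree 1 the two scalars of the equivariance agree and cancel.\<close>
    have "\<alpha> x \<one>\<^sub>E = \<alpha> \<one>\<^sub>E x" "\<alpha> x \<one>\<^sub>E \<noteq> 0" using cocycle_oneE[OF x] cocycle_nonzeroE[of x "\<one>\<^sub>E"] x by auto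
    then have "der_coc D \<one>\<^sub>E v (g, \<one>\<^sub>E) = der_coc D \<one>\<^sub>E (x v) (x g, \<one>\<^sub>E)" if "g \<in> carrier P" for g
      using der_coc_equivariant_apply[OF D x E_closed(1) v that] by simp
    then have "s v = (\<Sum>g\<in>carrier P. der_coc D \<one>\<^sub>E (x v) (x g, \<one>\<^sub>E))"
      by (simp add: s_def)
    also have "\<dots> = s (x v)"
      unfolding s_def
      by (rule sum.reindex_bij_witness[of _ "einv x" x]) (use x in auto)
    finally show ?thesis by simp
  qed
  have s1: "s (x v \<otimes> inv v) = 0" if "x \<in> E" "v \<in> carrier P" for x v
  proof -
    have "s (x v) = s (x v \<otimes> inv v) + s v"
      using s_mult[of "x v \<otimes> inv v" v] that by simp
    then show ?thesis using s_act that by simp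
  qed
  have "s u = 0"
  proof (rule hom_generate_trivial[where f = s])
    show "u \<in> generate P {e u \<otimes> inv u |e u. e \<in> E \<and> u \<in> carrier P}"
      using PE u by (simp add: comm_aut_def)
  qed (use s_mult s1 in auto)
  moreover have "(\<Sum>g\<in>carrier P. der_coc D \<one>\<^sub>E u (g, x)) = 0" if "x \<in> E" "x \<noteq> \<one>\<^sub>E" for x
  proof -
    have "der_coc D \<one>\<^sub>E u (g, x) = 0" for g
      using fun_cong[OF der_coc_pr[OF E_closed(1) u, of D], of "(g, x)"] that by simp
    then show ?thesis by simp
  qed
  ultimately show ?thesis
    by (intro J1_I) (auto simp: s_def)
qed

text \<open>The shape of the chosen representatives. Components of degree other than 1 are invisible
  modulo J^2, so modulo J^2 only the part in kP counts.\<close>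

definition reduced_der where
  "reduced_der D \<longleftrightarrow> D \<in> derivations A \<and> (\<forall>x\<in>E. D (W x) = 0) \<and>
    (\<forall>u\<in>carrier P. D (U u) \<in> J 1 \<and> (\<forall>y\<in>E. y \<noteq> \<one>\<^sub>E \<longrightarrow> pr y (D (U u)) \<in> J 2))"

lemma reduced_der_decomp0:
  assumes D: "D \<in> derivations A" "\<And>x. x \<in> E \<Longrightarrow> D (W x) = 0"
  obtains c where "c \<in> carrier A" "reduced_der (\<lambda>a\<in>carrier A. D a - ad c a)"
proof -
  \<comment> \<open>One correction for all degrees at once: \<open>pr y\<close> separates the
    primitives, and degree 1 is left untouched.\<close>
  define c where "c = (\<Sum>y\<in>E - {\<one>\<^sub>E}. prim D y)"
  have c: "c \<in> carrier A" unfolding c_def by (intro T.A_closed(6)) auto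
  have pr_c: "pr y c = (if y = \<one>\<^sub>E then 0 else prim D y)" if "y \<in> E" for y
    using that fin_E by (simp add: c_def pr_sum pr_prim sum.delta)
  have cW: "W x \<star> c = c \<star> W x" if "x \<in> E" for x
    unfolding c_def T.star_sum_left T.star_sum_right by (intro sum.cong) (use prim_W[OF D _ that] in auto)
  define D' where "D' = (\<lambda>a\<in>carrier A. D a - ad c a)"
  have D': "D' \<in> derivations A" unfolding D'_def by (intro diff_der D ad_der c)
  have D'U: "D' (U u) = D (U u) - (c \<star> U u - U u \<star> c)" if "u \<in> carrier P" for u
    using that by (simp add: D'_def ad_def)
  have pr_D': "pr y (D' (U u)) \<in> J (if y = \<one>\<^sub>E then 1 else 2)" if u: "u \<in> carrier P" and y: "y \<in> E" for u y
  proof -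
    have UU: "U u \<star> U (inv u) = \<one>\<^bsub>A\<^esub>" using u by (simp add: U_mult U_one)
    have dcU: "pr y (D (U u)) = U u \<star> der_coc D y u"
      using u y D(1) by (simp add: der_coc_def T.star_assoc[symmetric] UU)
    have eq: "pr y (D' (U u)) = pr y (D (U u)) - (pr y c \<star> U u - U u \<star> pr y c)"
      using u y by (simp add: D'U pr_linear pr_star_U pr_U_star)
    show ?thesis
    proof (cases "y = \<one>\<^sub>E")
      case True
      then show ?thesis
        using eq dcU u y pr_c[OF y] U_left_J[OF u der_coc_one_J1[OF D u]] by simp
    next
      case False
      \<comment> \<open>In degree y the commutator of c with u is u times the coboundary of
        \<open>prim D y\<close>.\<close>
      have "pr y (prim D y) \<star> U u = U (y u) \<star> pr y (prim D y)" using y u by (rule pr_supp)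
      then have "prim D y \<star> U u = U u \<star> (U (theta y u) \<star> prim D y)"
        using u y by (simp add: pr_prim T.star_assoc[symmetric] U_mult theta_def)
      then have "pr y (D' (U u)) = U u \<star> (der_coc D y u - (U (theta y u) \<star> prim D y - prim D y))"
        using eq dcU pr_c[OF y] False by (simp add: T.star_diff_right)
      then show ?thesis using False U_left_J[OF u der_coc_minus_prim[OF D(1) y False u]] by simp
    qed
  qed
  have "reduced_der D'"
    unfolding reduced_der_def
  proof (intro conjI ballI impI D')
    fix x assume x: "x \<in> E"
    then show "D' (W x) = 0" using D(2)[OF x] cW[OF x] by (simp add: D'_def ad_def)
  next
    fix u assume u: "u \<in> carrier P"
    have "pr y (D' (U u)) \<in> J 1" if "y \<in> E" for y
      using pr_D'[OF u that] J_mono[of 1 2] by (auto split: if_splits)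
    then have "(\<Sum>y\<in>E. pr y (D' (U u))) \<in> J 1" by (intro J_closed(6)) auto
    then show "D' (U u) \<in> J 1" using sum_pr[of "D' (U u)"] D' u by simp
    fix y assume "y \<in> E" "y \<noteq> \<one>\<^sub>E"
    then show "pr y (D' (U u)) \<in> J 2" using pr_D'[OF u, of y] by simp
  qed
  then show thesis using that c D'_def by blast
qed

lemma ad_add: "c \<in> carrier A \<Longrightarrow> c' \<in> carrier A \<Longrightarrow> a \<in> carrier A \<Longrightarrow> ad (c + c') a = ad c a + ad c' a"
  by (simp add: ad_def T.star_add_left T.star_add_right)

lemma reduced_der_decomp:
  assumes D: "D \<in> derivations A"
  obtains D' c where "reduced_der D'" "c \<in> carrier A" "D = (\<lambda>a\<in>carrier A. D' a + ad c a)"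
proof -
  obtain c where c: "c \<in> carrier A" "\<And>x. x \<in> E \<Longrightarrow> D (W x) = c \<star> W x - W x \<star> c"
    using der_normalise[OF D] by blast
  define D1 where "D1 = (\<lambda>a\<in>carrier A. D a - ad c a)"
  have D1: "D1 \<in> derivations A" unfolding D1_def by (intro diff_der D ad_der c)
  have "D1 (W x) = 0" if "x \<in> E" for x
    using that c by (simp add: D1_def ad_def)
  from reduced_der_decomp0[OF D1 this]
  obtain c' where c': "c' \<in> carrier A" "reduced_der (\<lambda>a\<in>carrier A. D1 a - ad c' a)"
    by blast
  define D2 where "D2 = (\<lambda>a\<in>carrier A. D1 a - ad c' a)"
  have D2: "reduced_der D2" using c'(2) by (simp only: D2_def)
  have cc: "c + c' \<in> carrier A" using c c' by simp
  have D_eq: "D = (\<lambda>a\<in>carrier A. D2 a + ad (c + c') a)"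
  proof (rule extensionalityI[of _ "carrier A"])
    show "D \<in> extensional (carrier A)" using D unfolding derivation_iff PiE_def by blast
    fix a assume a: "a \<in> carrier A"
    have "D a = (D a - ad c a - ad c' a) + (ad c a + ad c' a)" by (simp add: algebra_simps)
    also have "\<dots> = D2 a + ad (c + c') a"
      unfolding D1_def D2_def restrict_apply'[OF a] ad_add[OF c(1) c'(1) a] ..
    finally show "D a = (\<lambda>a\<in>carrier A. D2 a + ad (c + c') a) a"
      unfolding restrict_apply'[OF a] .
  qed (rule restrict_extensional)
  show thesis by (rule that[OF D2 cc D_eq])
qed

lemma reduced_der_J1: "reduced_der D \<Longrightarrow> a \<in> carrier A \<Longrightarrow> D a \<in> J 1"
  unfolding reduced_der_def by (rule der_vanish) auto

end

section \<open>The first Hochschild cohomology as a Lie algebra\<close>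

lemma lie_span_least: "lie_subspace L W \<Longrightarrow> S \<subseteq> W \<Longrightarrow> lie_span L S \<subseteq> W"
  unfolding lie_span_def by blast

lemma lie_span_zero: "lie_zero L \<in> lie_span L S"
  unfolding lie_span_def lie_subspace_def by blast

lemma derived_zero: "0 < n \<Longrightarrow> lie_zero L \<in> (lie_derived L ^^ n) S"
  by (cases n) (auto simp: lie_derived_def lie_span_zero)

context p_setting
begin

abbreviation "DL \<equiv> derivation_lie_algebra A"
abbreviation "cls \<equiv> lie_coset DL (inner_derivations A)"

definition der_plus where "der_plus D D' = (\<lambda>a\<in>carrier A. D a + D' a)"
definition der_scale where "der_scale c D = (\<lambda>a\<in>carrier A. fscale c (D a))"

lemma DL_simps: "carrier DL = derivations A" "lie_zero DL = (\<lambda>a\<in>carrier A. 0)"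
  "lie_add DL D D' = der_plus D D'" "lie_scale DL c D = der_scale c D"
  by (simp_all add: derivation_lie_algebra_def der_plus_def der_scale_def T.A_zero T.A_add T.A_smult)

lemma DL_bracket:
  assumes "D \<in> derivations A" "D' \<in> derivations A"
  shows "lie_bracket DL D D' = bracket D D'"
  unfolding derivation_lie_algebra_def bracket_def lie_algebra.simps
  by (rule restrict_ext) (use assms in \<open>simp add: T.A_minus\<close>)

lemma der_plus_der:
  assumes "D \<in> derivations A" "D' \<in> derivations A"
  shows "der_plus D D' \<in> derivations A"
  unfolding derivation_iff der_plus_def
  using assms by (auto simp: der_add der_fscale der_star T.star_add_left T.star_add_right
      fsp.scale_right_distrib algebra_simps)

lemma der_scale_der:
  assumes "D \<in> derivations A"
  shows "der_scale c D \<in> derivations A"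
  unfolding derivation_iff der_scale_def
  using assms by (auto simp: der_add der_fscale der_star fsp.scale_right_distrib mult.commute)

lemma ad_zero: "ad 0 = (\<lambda>a\<in>carrier A. 0)"
  by (simp add: ad_def)

lemma zero_der: "(\<lambda>a\<in>carrier A. 0) \<in> derivations A"
  using ad_der[of 0] by (simp add: ad_zero)

lemma ad_neg: "ad (- c) a = - ad c a" if "a \<in> carrier A"
  using that by (simp add: ad_def T.star_minus)

lemma ad_fscale: "a \<in> carrier A \<Longrightarrow> ad (fscale r c) a = fscale r (ad c a)"
  by (simp add: ad_def fsp.scale_right_diff_distrib)

lemma der_ext: "D \<in> derivations A \<Longrightarrow> D' \<in> derivations A \<Longrightarrow> (\<And>a. a \<in> carrier A \<Longrightarrow> D a = D' a) \<Longrightarrow> D = D'"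
  unfolding derivation_iff PiE_def by (blast intro: extensionalityI)

text \<open>Congruence modulo inner derivations. The operations of the quotient are unions over all
  representatives, so each of them needs compatibility with it.\<close>

definition inner_eq where
  "inner_eq D T \<longleftrightarrow> D \<in> derivations A \<and> T \<in> derivations A \<and> (\<exists>c\<in>carrier A. \<forall>a\<in>carrier A. T a = D a + ad c a)"

lemma cls_iff:
  assumes D: "D \<in> derivations A"
  shows "T \<in> cls D \<longleftrightarrow> inner_eq D T"
proof
  assume "T \<in> cls D"
  then obtain c where c: "c \<in> carrier A" "T = der_plus D (ad c)"
    unfolding lie_coset_def DL_simps inner_iff by blast
  then have "T \<in> derivations A" using der_plus_der[OF D ad_der] by simp
  moreover have "\<forall>a\<in>carrier A. T a = D a + ad c a" using c by (simp add: der_plus_def)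
  ultimately show "inner_eq D T" unfolding inner_eq_def using D c(1) by blast
next
  assume "inner_eq D T"
  then obtain c where c: "c \<in> carrier A" "\<forall>a\<in>carrier A. T a = D a + ad c a" "T \<in> derivations A"
    unfolding inner_eq_def by blast
  have "T = der_plus D (ad c)"
    by (rule der_ext[OF c(3) der_plus_der[OF D ad_der[OF c(1)]]]) (use c in \<open>simp add: der_plus_def\<close>)
  then show "T \<in> cls D" unfolding lie_coset_def DL_simps using c(1) inner_iff by blast
qed

lemma inner_eq_refl: "D \<in> derivations A \<Longrightarrow> inner_eq D D"
  unfolding inner_eq_def by (auto intro!: bexI[of _ 0] simp: ad_zero)

lemma inner_eq_sym: "inner_eq D T \<Longrightarrow> inner_eq T D"
proof -
  assume "inner_eq D T"
  then obtain c where c: "c \<in> carrier A" "\<forall>a\<in>carrier A. T a = D a + ad c a"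
    "D \<in> derivations A" "T \<in> derivations A"
    unfolding inner_eq_def by blast
  then have "\<forall>a\<in>carrier A. D a = T a + ad (- c) a" by (simp add: ad_neg)
  moreover have "- c \<in> carrier A" using c by simp
  ultimately show ?thesis using c unfolding inner_eq_def by blast
qed

lemma inner_eq_trans:
  assumes "inner_eq D T" "inner_eq T R" shows "inner_eq D R"
proof -
  obtain c c' where c: "c \<in> carrier A" "\<forall>a\<in>carrier A. T a = D a + ad c a"
    "c' \<in> carrier A" "\<forall>a\<in>carrier A. R a = T a + ad c' a"
    using assms unfolding inner_eq_def by blast
  then have "\<forall>a\<in>carrier A. R a = D a + ad (c + c') a"
    by (simp add: ad_add add.assoc)
  moreover have "c + c' \<in> carrier A" using c by simp
  ultimately show ?thesis using assms unfolding inner_eq_def by blast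
qed

lemma cls_eq_iff:
  assumes "D \<in> derivations A" "T \<in> derivations A"
  shows "cls D = cls T \<longleftrightarrow> inner_eq D T"
proof
  assume "cls D = cls T"
  then have "T \<in> cls D" using cls_iff[OF assms(2)] inner_eq_refl[OF assms(2)] by simp
  then show "inner_eq D T" using cls_iff[OF assms(1)] by simp
next
  assume eq: "inner_eq D T"
  show "cls D = cls T"
  proof (rule Set.set_eqI)
    fix R show "R \<in> cls D \<longleftrightarrow> R \<in> cls T"
      unfolding cls_iff[OF assms(1)] cls_iff[OF assms(2)]
      using inner_eq_trans[OF eq] inner_eq_trans[OF inner_eq_sym[OF eq]] by blast
  qed
qed

lemma cls_self: "D \<in> derivations A \<Longrightarrow> D \<in> cls D"
  using cls_iff inner_eq_refl by blast

lemma inner_eq_der_plus: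
  assumes "inner_eq D T" "inner_eq D' T'" shows "inner_eq (der_plus D D') (der_plus T T')"
proof -
  obtain c c' where c: "c \<in> carrier A" "\<forall>a\<in>carrier A. T a = D a + ad c a"
    "c' \<in> carrier A" "\<forall>a\<in>carrier A. T' a = D' a + ad c' a"
    using assms unfolding inner_eq_def by blast
  then have "\<forall>a\<in>carrier A. der_plus T T' a = der_plus D D' a + ad (c + c') a"
    by (simp add: ad_add der_plus_def algebra_simps)
  moreover have "c + c' \<in> carrier A" using c by simp
  ultimately show ?thesis using assms der_plus_der unfolding inner_eq_def by blast
qed

lemma inner_eq_der_scale:
  assumes "inner_eq D T" shows "inner_eq (der_scale r D) (der_scale r T)"
proof -
  obtain c where c: "c \<in> carrier A" "\<forall>a\<in>carrier A. T a = D a + ad c a"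
    using assms unfolding inner_eq_def by blast
  then have "\<forall>a\<in>carrier A. der_scale r T a = der_scale r D a + ad (fscale r c) a"
    by (simp add: ad_fscale der_scale_def fsp.scale_right_distrib)
  moreover have "fscale r c \<in> carrier A" using c by simp
  ultimately show ?thesis using assms der_scale_der unfolding inner_eq_def by blast
qed

lemma bracket_apply: "a \<in> carrier A \<Longrightarrow> bracket D D' a = D (D' a) - D' (D a)"
  by (simp add: bracket_def)

text \<open>Inner derivations form an ideal: [D, ad c] = ad (D c).\<close>

lemma inner_eq_bracket_right:
  assumes D: "D \<in> derivations A" and "inner_eq D' T'" shows "inner_eq (bracket D D') (bracket D T')"
proof -
  obtain c where c: "c \<in> carrier A" "\<forall>a\<in>carrier A. T' a = D' a + ad c a"
    using assms unfolding inner_eq_def by blast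
  have D': "D' \<in> derivations A" "T' \<in> derivations A" using assms unfolding inner_eq_def by auto
  have "bracket D T' a = bracket D D' a + ad (D c) a" if a: "a \<in> carrier A" for a
  proof -
    have Da: "D a \<in> carrier A" "D' a \<in> carrier A" using a D D' by auto
    have adc: "ad c a = c \<star> a - a \<star> c" "ad c (D a) = c \<star> D a - D a \<star> c" "ad (D c) a = D c \<star> a - a \<star> D c"
      using a Da by (simp_all add: ad_def)
    have "bracket D T' a = D (D' a + ad c a) - (D' (D a) + ad c (D a))"
      using a Da c by (simp add: bracket_apply)
    also have "D (D' a + ad c a) = D (D' a) + (D (c \<star> a) - D (a \<star> c))"
      using Da by (simp add: adc der_add[OF D] der_diff[OF D])
    also have "\<dots> = D (D' a) + (D c \<star> a + c \<star> D a - (D a \<star> c + a \<star> D c))"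
      using a c(1) by (simp add: der_star[OF D])
    finally show ?thesis using a by (simp add: bracket_apply adc algebra_simps)
  qed
  then show ?thesis using bracket_der[OF D] D' der_closed[OF D c(1)] unfolding inner_eq_def by blast
qed

lemma bracket_swap:
  assumes "D \<in> derivations A" "D' \<in> derivations A"
  shows "bracket D D' = der_scale (- 1) (bracket D' D)"
  using assms by (intro der_ext bracket_der der_scale_der)
    (simp_all add: der_scale_def bracket_apply fsp.scale_right_diff_distrib)

lemma inner_eq_bracket:
  assumes "inner_eq D T" "inner_eq D' T'" shows "inner_eq (bracket D D') (bracket T T')"
proof -
  have d: "D \<in> derivations A" "T \<in> derivations A" "D' \<in> derivations A" "T' \<in> derivations A"
    using assms unfolding inner_eq_def by auto
  have "inner_eq (bracket D D') (bracket D T')" by (rule inner_eq_bracket_right[OF d(1) assms(2)])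
  moreover have "inner_eq (bracket D T') (bracket T T')"
    unfolding bracket_swap[OF d(1) d(4)] bracket_swap[OF d(2) d(4)]
    by (intro inner_eq_der_scale inner_eq_bracket_right d assms)
  ultimately show ?thesis by (rule inner_eq_trans)
qed

abbreviation "HH \<equiv> HH1 A"

lemma HH_carrier: "carrier HH = cls ` derivations A"
  by (simp add: HH1_def lie_quotient_def DL_simps)

lemma HH_zero: "lie_zero HH = cls (\<lambda>a\<in>carrier A. 0)"
  by (simp add: HH1_def lie_quotient_def DL_simps)

lemma HH_add:
  assumes D: "D \<in> derivations A" "D' \<in> derivations A"
  shows "lie_add HH (cls D) (cls D') = cls (der_plus D D')"
proof -
  have "cls (der_plus T T') = cls (der_plus D D')" if "T \<in> cls D" "T' \<in> cls D'" for T T'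
    using that D inner_eq_der_plus[of D T D' T'] cls_eq_iff[of "der_plus D D'" "der_plus T T'"]
    by (auto simp: cls_iff inner_eq_def)
  then have "(\<Union>x\<in>cls D. \<Union>y\<in>cls D'. cls (der_plus x y)) = cls (der_plus D D')"
    using cls_self[OF D(1)] cls_self[OF D(2)] by (intro SUP_eq_const) blast+
  then show ?thesis by (simp add: HH1_def lie_quotient_def DL_simps)
qed

lemma HH_scale:
  assumes D: "D \<in> derivations A"
  shows "lie_scale HH c (cls D) = cls (der_scale c D)"
proof -
  have "cls (der_scale c T) = cls (der_scale c D)" if "T \<in> cls D" for T
    using that D inner_eq_der_scale[of D T c] cls_eq_iff[of "der_scale c D" "der_scale c T"]
    by (auto simp: cls_iff inner_eq_def)
  then have "(\<Union>x\<in>cls D. cls (der_scale c x)) = cls (der_scale c D)"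
    using cls_self[OF D] by (intro SUP_eq_const) blast+
  then show ?thesis by (simp add: HH1_def lie_quotient_def DL_simps)
qed

lemma HH_bracket:
  assumes D: "D \<in> derivations A" "D' \<in> derivations A"
  shows "lie_bracket HH (cls D) (cls D') = cls (bracket D D')"
proof -
  have "cls (lie_bracket DL T T') = cls (bracket D D')" if "T \<in> cls D" "T' \<in> cls D'" for T T'
    using that D inner_eq_bracket[of D T D' T'] cls_eq_iff[of "bracket D D'" "bracket T T'"]
    by (auto simp: cls_iff inner_eq_def DL_bracket)
  then have "(\<Union>x\<in>cls D. \<Union>y\<in>cls D'. cls (lie_bracket DL x y)) = cls (bracket D D')"
    using cls_self[OF D(1)] cls_self[OF D(2)] by (intro SUP_eq_const) blast+
  then show ?thesis by (simp add: HH1_def lie_quotient_def)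
qed

lemma HH_subspace:
  assumes Y: "Y \<subseteq> derivations A" "(\<lambda>a\<in>carrier A. 0) \<in> Y"
    "\<And>D D'. D \<in> Y \<Longrightarrow> D' \<in> Y \<Longrightarrow> der_plus D D' \<in> Y" "\<And>c D. D \<in> Y \<Longrightarrow> der_scale c D \<in> Y"
  shows "lie_subspace HH (cls ` Y)"
  unfolding lie_subspace_def
proof (intro conjI ballI allI)
  show "cls ` Y \<subseteq> carrier HH" using Y(1) HH_carrier by auto
  show "lie_zero HH \<in> cls ` Y" unfolding HH_zero using Y(2) by blast
next
  fix x y assume "x \<in> cls ` Y" "y \<in> cls ` Y"
  then obtain D D' where "D \<in> Y" "D' \<in> Y" "x = cls D" "y = cls D'" by blast
  then show "lie_add HH x y \<in> cls ` Y" using HH_add[of D D'] Y by blast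
next
  fix c x assume "x \<in> cls ` Y"
  then obtain D where "D \<in> Y" "x = cls D" by blast
  then show "lie_scale HH c x \<in> cls ` Y" using HH_scale[of D] Y by blast
qed

section \<open>The filtration of derivations by powers of J\<close>

definition der_filt where
  "der_filt m = {D \<in> derivations A. (\<forall>x\<in>E. D (W x) = 0) \<and> (\<forall>u\<in>carrier P. D (U u) \<in> J m)}"

lemma der_filt_subspace: "lie_subspace HH (cls ` der_filt m)"
proof (rule HH_subspace)
  show "(\<lambda>a\<in>carrier A. 0) \<in> der_filt m" by (simp add: der_filt_def zero_der J_closed)
  show "der_plus D D' \<in> der_filt m" if "D \<in> der_filt m" "D' \<in> der_filt m" for D D'
    using that by (simp add: der_filt_def der_plus_der) (simp add: der_plus_def J_closed)
  show "der_scale c D \<in> der_filt m" if "D \<in> der_filt m" for c D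
    using that by (simp add: der_filt_def der_scale_der) (simp add: der_scale_def J_closed)
qed (auto simp: der_filt_def)

text \<open>Applied to a product with n factors u - 1, D trades one factor for an element of
  \<open>J (Suc m)\<close>, a gain of m.\<close>

lemma der_J:
  assumes D: "D \<in> derivations A" and m: "\<And>a. a \<in> carrier A \<Longrightarrow> D a \<in> J (Suc m)"
  shows "a \<in> J n \<Longrightarrow> D a \<in> J (n + m)"
proof (induction n arbitrary: a)
  case 0
  then show ?case using m J_Suc_subset[of m] by auto
next
  case (Suc n)
  have "a \<in> carrier A \<and> D a \<in> J (Suc n + m)" using Suc.prems
  proof (induction rule: J_Suc_induct)
    case (gen u a)
    have aA: "a \<in> carrier A" using gen J_A by blast
    have "D (U u \<star> a - a) = D (U u) \<star> a + (U u \<star> D a - D a)"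
      using gen(1) aA D by (simp add: der_diff der_star algebra_simps)
    moreover have "D (U u) \<star> a \<in> J (Suc m + n)"
      using m gen by (intro J_mult) auto
    moreover have "U u \<star> D a - D a \<in> J (Suc (n + m))"
      using J_gen[OF gen(1) Suc.IH[OF gen(2)]] .
    ultimately have "D (U u \<star> a - a) \<in> J (Suc n + m)"
      using J_closed(2)[of "D (U u) \<star> a" "Suc (n + m)" "U u \<star> D a - D a"] by (simp add: add.commute[of n])
    then show "U u \<star> a - a \<in> carrier A \<and> D (U u \<star> a - a) \<in> J (Suc n + m)"
      using aA by simp
  qed (intro der_subspace D J_subspace)
  then show ?case by simp
qed

lemma der_filt_J:
  assumes "D \<in> der_filt m" "a \<in> carrier A"
  shows "D a \<in> J m"
  by (rule der_vanish) (use assms in \<open>auto simp: der_filt_def\<close>)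

lemma der_filt_bracket:
  assumes D: "D \<in> der_filt (Suc m)" and D': "D' \<in> der_filt (Suc n)"
  shows "bracket D D' \<in> der_filt (Suc m + n)"
proof -
  have d: "D \<in> derivations A" "D' \<in> derivations A" using D D' by (auto simp: der_filt_def)
  have "bracket D D' (U u) \<in> J (Suc m + n)" if u: "u \<in> carrier P" for u
  proof -
    have "D (D' (U u)) \<in> J (Suc n + m)"
      by (rule der_J[OF d(1) der_filt_J[OF D]]) (use der_filt_J[OF D'] u in auto)
    moreover have "D' (D (U u)) \<in> J (Suc m + n)"
      by (rule der_J[OF d(2) der_filt_J[OF D']]) (use der_filt_J[OF D] u in auto)
    ultimately show ?thesis
      using u J_closed(4) by (simp add: bracket_apply add.commute)
  qed
  moreover have "bracket D D' (W x) = 0" if "x \<in> E" for x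
    using that D D' by (simp add: bracket_apply der_filt_def der_zero)
  ultimately show ?thesis using bracket_der[OF d] by (simp add: der_filt_def)
qed

lemma der_filt_mono: "m \<le> n \<Longrightarrow> der_filt n \<subseteq> der_filt m"
  using J_mono[of m n] by (auto simp: der_filt_def)

lemma derived_subset:
  assumes V: "V \<subseteq> cls ` Y" and Y: "Y \<subseteq> derivations A"
    and bracket: "\<And>D D'. D \<in> Y \<Longrightarrow> D' \<in> Y \<Longrightarrow> bracket D D' \<in> der_filt m"
  shows "lie_derived HH V \<subseteq> cls ` der_filt m"
  unfolding lie_derived_def
proof (rule lie_span_least[OF der_filt_subspace], safe)
  fix x y assume "x \<in> V" "y \<in> V"
  then obtain D D' where "D \<in> Y" "D' \<in> Y" "x = cls D" "y = cls D'" using V by blast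
  then show "lie_bracket HH x y \<in> cls ` der_filt m"
    using HH_bracket[of D D'] Y bracket[of D D'] by blast
qed

lemma HH_carrier_reduced_der: "carrier HH = cls ` {D. reduced_der D}"
proof
  show "carrier HH \<subseteq> cls ` {D. reduced_der D}"
  proof
    fix C assume "C \<in> carrier HH"
    then obtain D where D: "D \<in> derivations A" "C = cls D" using HH_carrier by auto
    obtain D' c where D': "reduced_der D'" "c \<in> carrier A" "D = (\<lambda>a\<in>carrier A. D' a + ad c a)"
      using reduced_der_decomp[OF D(1)] by blast
    have "inner_eq D' D" using D' D(1) unfolding inner_eq_def reduced_der_def by auto
    then have "C = cls D'" using D cls_eq_iff[of D' D] by (auto simp: inner_eq_def)
    then show "C \<in> cls ` {D. reduced_der D}" using D' by blast
  qed
qed (auto simp: HH_carrier reduced_der_def)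

lemma HH1_represented_in_radical:
  assumes "C \<in> carrier HH"
  shows "\<exists>D\<in>C. D ` carrier A \<subseteq> jacobson_radical A"
proof -
  obtain D where D: "reduced_der D" "C = cls D" using assms HH_carrier_reduced_der by auto
  then have "D \<in> C" using cls_self by (auto simp: reduced_der_def)
  moreover have "D ` carrier A \<subseteq> jacobson_radical A"
    using reduced_der_J1[OF D(1)] J1_jacobson by auto
  ultimately show ?thesis by blast
qed

text \<open>The first derived term needs the hypothesis, since brackets of derivations into J are
  only known to map into J. From J^2 on every bracket gains a power, and J is nilpotent.\<close>

lemma solvable_if:
  assumes "\<And>D D'. reduced_der D \<Longrightarrow> reduced_der D' \<Longrightarrow> bracket D D' \<in> der_filt 2"
  shows "lie_solvable HH"
proof -
  obtain N where N: "J N = {0}" by (rule J_nilpotent)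
  have step: "(lie_derived HH ^^ Suc n) (carrier HH) \<subseteq> cls ` der_filt (n + 2)" for n
  proof (induction n)
    case 0
    show ?case using derived_subset[of "carrier HH" "{D. reduced_der D}" 2] HH_carrier_reduced_der assms
      by (auto simp: reduced_der_def numeral_2_eq_2)
  next
    case (Suc n)
    \<comment> \<open>Two derivations into the power n + 2 of J have a bracket into the power 2n +
      3, which is at least n + 3.\<close>
    have "bracket D D' \<in> der_filt (Suc n + 2)" if "D \<in> der_filt (n + 2)" "D' \<in> der_filt (n + 2)" for D D'
      using der_filt_bracket[of D "Suc n" D' "Suc n"] that der_filt_mono[of "Suc n + 2" "Suc (Suc n) + Suc n"] by auto
    then show ?case
      using derived_subset[OF Suc, of "Suc n + 2"] by (auto simp: der_filt_def)
  qed
  have "C = lie_zero HH" if C: "C \<in> (lie_derived HH ^^ Suc N) (carrier HH)" for C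
  proof -
    obtain D where D: "D \<in> der_filt (N + 2)" "C = cls D" using step[of N] C by auto
    have "D a = 0" if "a \<in> carrier A" for a
      using der_filt_J[OF D(1) that] J_mono[of N "N + 2"] N by auto
    then have "D = (\<lambda>a\<in>carrier A. 0)"
      using D by (intro der_ext zero_der) (auto simp: der_filt_def)
    then show ?thesis using D by (simp add: HH_zero)
  qed
  then have "(lie_derived HH ^^ Suc N) (carrier HH) = {lie_zero HH}"
    using derived_zero[of "Suc N" HH "carrier HH"] by blast
  then show ?thesis unfolding lie_solvable_def by blast
qed

section \<open>Derivations modulo the square of the augmentation ideal\<close>

lemma J2_eq: "J (1 + 1) = J 2" by (simp add: numeral_2_eq_2)

text \<open>It is all of P exactly when the class of m generates P/\<Phi>(P) over F_pE, as the p-th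
  powers make up \<Phi>(P).\<close>

definition orbit_gen where
  "orbit_gen m = generate P ((\<lambda>e. e m) ` E \<union> (\<lambda>u. u [^] p) ` carrier P)"

lemma additive_mod_J2_pow:
  assumes f: "\<And>u v. u \<in> carrier P \<Longrightarrow> v \<in> carrier P \<Longrightarrow> f (u \<otimes> v) - f u - f v \<in> J 2"
    and u: "u \<in> carrier P"
  shows "f (u [^] (n::nat)) - fscale (of_nat n) (f u) \<in> J 2"
proof (induction n)
  case 0
  have "f (\<one> \<otimes> \<one>) - f \<one> - f \<one> \<in> J 2" by (rule f) auto
  then have "f \<one> \<in> J 2" using J_closed(5)[of "- f \<one>" 2] by simp
  then show "f (u [^] (0::nat)) - fscale (of_nat 0) (f u) \<in> J 2" by (simp add: fsp.scale_zero_left)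
next
  case (Suc n)
  have "(f (u [^] n \<otimes> u) - f (u [^] n) - f u) + (f (u [^] n) - fscale (of_nat n) (f u)) \<in> J 2"
    by (intro J_closed(2) f Suc.IH u nat_pow_closed)
  also have "(f (u [^] n \<otimes> u) - f (u [^] n) - f u) + (f (u [^] n) - fscale (of_nat n) (f u))
      = f (u [^] Suc n) - fscale (of_nat (Suc n)) (f u)"
    by (simp add: fsp.scale_left_distrib algebra_simps)
  finally show "f (u [^] Suc n) - fscale (of_nat (Suc n)) (f u) \<in> J 2" .
qed

text \<open>A map that is additive modulo J^2 sends p-th powers into J^2, as k has characteristic p.
  So modulo any subspace containing J^2 it is governed by the E-orbit of m.\<close>

lemma additive_mod_J2:
  assumes f: "\<And>u v. u \<in> carrier P \<Longrightarrow> v \<in> carrier P \<Longrightarrow> f (u \<otimes> v) - f u - f v \<in> J 2"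
    and V: "fsp.subspace V" "J 2 \<subseteq> V"
    and m: "m \<in> carrier P" "\<And>e. e \<in> E \<Longrightarrow> f (e m) \<in> V"
    and u: "u \<in> orbit_gen m"
  shows "f u \<in> V"
proof -
  have mult: "f (u \<otimes> v) \<in> V \<longleftrightarrow> f u + f v \<in> V" if "u \<in> carrier P" "v \<in> carrier P" for u v
  proof -
    have *: "f (u \<otimes> v) - (f u + f v) \<in> V" using f[OF that] V(2) by (auto simp: algebra_simps)
    show ?thesis
      using fsp.subspace_add[OF V(1) *, of "f u + f v"] fsp.subspace_diff[OF V(1) _ *, of "f (u \<otimes> v)"] by auto
  qed
  have pow: "f (u [^] p) \<in> V" if "u \<in> carrier P" for u
  proof -
    have "(of_nat p :: 'k) = 0" using char_p by (simp add: of_nat_eq_0_iff_char_dvd)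
    then show ?thesis
      using additive_mod_J2_pow[OF f that, of p] V(2) by (auto simp: fsp.scale_zero_left)
  qed
  have one: "f \<one> \<in> V" using pow[of \<one>] by simp
  have base: "s \<in> carrier P \<and> f s \<in> V" if "s \<in> (\<lambda>e. e m) ` E \<union> (\<lambda>u. u [^] p) ` carrier P" for s
    using that m pow by auto
  have "u \<in> carrier P \<and> f u \<in> V" using u unfolding orbit_gen_def
  proof (induction rule: generate.induct)
    case (inv h)
    have "f (inv h \<otimes> h) \<in> V" using base[OF inv] one by simp
    then have "f (inv h) + f h \<in> V" using mult[of "inv h" h] base[OF inv] by simp
    then show ?case using base[OF inv] fsp.subspace_diff[OF V(1), of "f (inv h) + f h" "f h"] by simp
  next
    case (eng h1 h2)
    then show ?case using mult[of h1 h2] fsp.subspace_add[OF V(1)] by simp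
  qed (use one base in auto)
  then show ?thesis by simp
qed

text \<open>In D(uv) = D(u) v + u D(v) the factors u and v act as 1 on J modulo J^2.\<close>

lemma der_additive_mod_J2:
  assumes D: "D \<in> derivations A" and J1: "\<And>u. u \<in> carrier P \<Longrightarrow> D (U u) \<in> J 1"
    and u: "u \<in> carrier P" and v: "v \<in> carrier P"
  shows "D (U (u \<otimes> v)) - D (U u) - D (U v) \<in> J 2"
proof -
  have "(D (U u) \<star> U v - D (U u)) + (U u \<star> D (U v) - D (U v)) \<in> J 2"
    unfolding numeral_2_eq_2 using U_right_J[OF v J1[OF u]] J_gen[OF u J1[OF v]]
    by (intro J_closed(2)) simp_all
  also have "(D (U u) \<star> U v - D (U u)) + (U u \<star> D (U v) - D (U v))
      = D (U (u \<otimes> v)) - D (U u) - D (U v)"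
    using u v by (simp add: U_mult[symmetric] der_star[OF D] algebra_simps)
  finally show ?thesis .
qed

lemma U_additive_mod_J2:
  assumes u: "u \<in> carrier P" and v: "v \<in> carrier P"
  shows "(U (u \<otimes> v) - \<one>\<^bsub>A\<^esub>) - (U u - \<one>\<^bsub>A\<^esub>) - (U v - \<one>\<^bsub>A\<^esub>) \<in> J 2"
proof -
  have "(U u - \<one>\<^bsub>A\<^esub>) \<star> (U v - \<one>\<^bsub>A\<^esub>) \<in> J 2"
    unfolding J2_eq[symmetric] using u v by (intro J_mult U_minus_one)
  also have "(U u - \<one>\<^bsub>A\<^esub>) \<star> (U v - \<one>\<^bsub>A\<^esub>)
      = (U (u \<otimes> v) - \<one>\<^bsub>A\<^esub>) - (U u - \<one>\<^bsub>A\<^esub>) - (U v - \<one>\<^bsub>A\<^esub>)"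
    using u v by (simp add: T.star_diff_left T.star_diff_right U_mult algebra_simps)
  finally show ?thesis .
qed

text \<open>The coefficients add up to 0, so each \<open>U u\<close> may be lowered by the unit; the
  factor \<alpha>(1,1) undoes the scaling of \<open>U\<close>.\<close>

lemma J1_one_component:
  assumes a: "a \<in> J 1"
  shows "pr \<one>\<^sub>E a = (\<Sum>u\<in>carrier P. fscale (a (u, \<one>\<^sub>E) * \<alpha> \<one>\<^sub>E \<one>\<^sub>E) (U u - \<one>\<^bsub>A\<^esub>))"
proof -
  have "(\<Sum>u\<in>carrier P. fscale (a (u, \<one>\<^sub>E) * \<alpha> \<one>\<^sub>E \<one>\<^sub>E) \<one>\<^bsub>A\<^esub>) = 0"
    using sum_J1[OF a, of "\<one>\<^sub>E"]
    by (simp add: fsp.scale_sum_left[symmetric] sum_distrib_right[symmetric] fsp.scale_zero_left)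
  moreover have "pr \<one>\<^sub>E a = (\<Sum>u\<in>carrier P. fscale (a (u, \<one>\<^sub>E) * \<alpha> \<one>\<^sub>E \<one>\<^sub>E) (U u))"
  proof (rule A_eqI)
    fix v x assume v: "v \<in> carrier P" "x \<in> E"
    show "pr \<one>\<^sub>E a (v, x) = (\<Sum>u\<in>carrier P. fscale (a (u, \<one>\<^sub>E) * \<alpha> \<one>\<^sub>E \<one>\<^sub>E) (U u)) (v, x)"
      using v fin_P cocycle_nonzeroE[of "\<one>\<^sub>E" "\<one>\<^sub>E"]
      by (auto simp: sum_apply U_def fscale_apply delta_def if_distrib[of "\<lambda>x. _ * x"] sum.delta cong: if_cong)
  next
    show "(\<Sum>u\<in>carrier P. fscale (a (u, \<one>\<^sub>E) * \<alpha> \<one>\<^sub>E \<one>\<^sub>E) (U u)) \<in> carrier A"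
      by (intro T.A_closed(6) T.A_closed(3) U_closed)
  qed (use J_A[OF a] in simp)
  ultimately show ?thesis
    by (simp add: fsp.scale_right_diff_distrib sum_subtractf)
qed

lemma reduced_der_one_component:
  assumes "reduced_der D" "u \<in> carrier P"
  shows "D (U u) - pr \<one>\<^sub>E (D (U u)) \<in> J 2"
proof -
  have D: "D (U u) \<in> carrier A" using assms by (simp add: reduced_der_def)
  have "D (U u) = (\<Sum>y\<in>E. pr y (D (U u)))" using sum_pr[OF D] by simp
  also have "\<dots> = pr \<one>\<^sub>E (D (U u)) + (\<Sum>y\<in>E - {\<one>\<^sub>E}. pr y (D (U u)))"
    using fin_E by (intro sum.remove) auto
  finally have "D (U u) - pr \<one>\<^sub>E (D (U u)) = (\<Sum>y\<in>E - {\<one>\<^sub>E}. pr y (D (U u)))"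
    by (simp add: algebra_simps)
  also have "\<dots> \<in> J 2" using assms by (intro J_closed(6)) (auto simp: reduced_der_def)
  finally show ?thesis .
qed

text \<open>The preimage of the kE-submodule of J/J^2 generated by the class of m - 1.\<close>

definition orbit_span where
  "orbit_span m = {a. \<exists>r. a - (\<Sum>e\<in>E. fscale (r e) (U (e m) - \<one>\<^bsub>A\<^esub>)) \<in> J 2}"

lemma orbit_span_subspace: "fsp.subspace (orbit_span m)"
  unfolding fsp.subspace_def
proof (intro conjI ballI allI)
  show "0 \<in> orbit_span m" unfolding orbit_span_def
    using J_closed(1)[of 2] by (auto intro!: exI[of _ "\<lambda>_. 0"] simp: fsp.scale_zero_left)
next
  fix a b assume "a \<in> orbit_span m" "b \<in> orbit_span m"
  then obtain r s where "a - (\<Sum>e\<in>E. fscale (r e) (U (e m) - \<one>\<^bsub>A\<^esub>)) \<in> J 2"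
    "b - (\<Sum>e\<in>E. fscale (s e) (U (e m) - \<one>\<^bsub>A\<^esub>)) \<in> J 2" unfolding orbit_span_def by blast
  then have "(a - (\<Sum>e\<in>E. fscale (r e) (U (e m) - \<one>\<^bsub>A\<^esub>))) + (b - (\<Sum>e\<in>E. fscale (s e) (U (e m) - \<one>\<^bsub>A\<^esub>))) \<in> J 2"
    by (rule J_closed(2))
  moreover have "a + b - (\<Sum>e\<in>E. fscale (r e + s e) (U (e m) - \<one>\<^bsub>A\<^esub>))
      = (a - (\<Sum>e\<in>E. fscale (r e) (U (e m) - \<one>\<^bsub>A\<^esub>))) + (b - (\<Sum>e\<in>E. fscale (s e) (U (e m) - \<one>\<^bsub>A\<^esub>)))"
    unfolding fsp.scale_left_distrib sum.distrib by (simp only: add_diff_add)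
  ultimately have "a + b - (\<Sum>e\<in>E. fscale (r e + s e) (U (e m) - \<one>\<^bsub>A\<^esub>)) \<in> J 2"
    by (simp only:)
  then show "a + b \<in> orbit_span m" unfolding orbit_span_def by (intro CollectI exI[of _ "\<lambda>e. r e + s e"])
next
  fix c a assume "a \<in> orbit_span m"
  then obtain r where "a - (\<Sum>e\<in>E. fscale (r e) (U (e m) - \<one>\<^bsub>A\<^esub>)) \<in> J 2" unfolding orbit_span_def by blast
  then have "fscale c (a - (\<Sum>e\<in>E. fscale (r e) (U (e m) - \<one>\<^bsub>A\<^esub>))) \<in> J 2"
    by (rule J_closed(3))
  then have "fscale c a - (\<Sum>e\<in>E. fscale (c * r e) (U (e m) - \<one>\<^bsub>A\<^esub>)) \<in> J 2"
    unfolding fsp.scale_right_diff_distrib[of c a] fsp.scale_sum_right fsp.scale_scale .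
  then show "fscale c a \<in> orbit_span m" unfolding orbit_span_def by (intro CollectI exI[of _ "\<lambda>e. c * r e"])
qed

lemma J2_orbit_span: "J 2 \<subseteq> orbit_span m"
  unfolding orbit_span_def by (auto intro!: exI[of _ "\<lambda>_. 0"] simp: fsp.scale_zero_left)

lemma orbit_orbit_span:
  assumes "e \<in> E" shows "U (e m) - \<one>\<^bsub>A\<^esub> \<in> orbit_span m"
proof -
  have "(\<Sum>f\<in>E. fscale (if f = e then 1 else 0) (U (f m) - \<one>\<^bsub>A\<^esub>)) = (\<Sum>f\<in>E. if f = e then U (f m) - \<one>\<^bsub>A\<^esub> else 0)"
    by (intro sum.cong) (auto simp: fsp.scale_zero_left)
  also have "\<dots> = U (e m) - \<one>\<^bsub>A\<^esub>" using assms fin_E by simp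
  finally show ?thesis
    unfolding orbit_span_def using J_closed(1)[of 2] by (intro CollectI exI[of _ "\<lambda>f. if f = e then 1 else 0"]) simp
qed

lemma reduced_der_orbit_span:
  assumes D: "reduced_der D" and m: "m \<in> carrier P" and gen: "carrier P = orbit_gen m"
    and u: "u \<in> carrier P"
  shows "D (U u) \<in> orbit_span m"
proof -
  have "U v - \<one>\<^bsub>A\<^esub> \<in> orbit_span m" if "v \<in> carrier P" for v
    by (rule additive_mod_J2[where m = m and V = "orbit_span m" and f = "\<lambda>v. U v - \<one>\<^bsub>A\<^esub>" and u = v, OF U_additive_mod_J2
        orbit_span_subspace J2_orbit_span m]) (use that gen orbit_orbit_span in auto)
  then have "pr \<one>\<^sub>E (D (U u)) \<in> orbit_span m"
    using D u by (subst J1_one_component)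
      (auto simp: reduced_der_def intro!: fsp.subspace_sum fsp.subspace_scale orbit_span_subspace)
  then have "D (U u) - pr \<one>\<^sub>E (D (U u)) + pr \<one>\<^sub>E (D (U u)) \<in> orbit_span m"
    using reduced_der_one_component[OF D u] J2_orbit_span by (intro fsp.subspace_add[OF orbit_span_subspace]) auto
  then show ?thesis by simp
qed

lemma der_act:
  assumes D: "D \<in> derivations A" "\<And>x. x \<in> E \<Longrightarrow> D (W x) = 0" and x: "x \<in> E" and u: "u \<in> carrier P"
  shows "D (U (x u)) = W x \<star> D (U u) \<star> Wi x"
proof -
  have "W x \<star> D (U u) = D (U (x u)) \<star> W x"
    using W_U[OF u x] der_star[OF D(1), of "W x" "U u"] der_star[OF D(1), of "U (x u)" "W x"] D(2) x u by simp
  then show ?thesis using x u D(1) by (simp add: T.star_assoc)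
qed

lemma U_act: "x \<in> E \<Longrightarrow> u \<in> carrier P \<Longrightarrow> W x \<star> (U u - \<one>\<^bsub>A\<^esub>) \<star> Wi x = U (x u) - \<one>\<^bsub>A\<^esub>"
  by (simp add: T.star_diff_right T.star_diff_left W_U T.star_assoc)

text \<open>Modulo J^2 both derivations commute with E. On the generator m they act as the elements
  of kE with coefficients r and s, and so their composite acts as the product of these
  elements.\<close>

lemma reduced_der_compose:
  assumes D: "reduced_der D" and D': "reduced_der D'" and m: "m \<in> carrier P"
    and r: "D (U m) - (\<Sum>e\<in>E. fscale (r e) (U (e m) - \<one>\<^bsub>A\<^esub>)) \<in> J 2"
    and s: "D' (U m) - (\<Sum>e\<in>E. fscale (s e) (U (e m) - \<one>\<^bsub>A\<^esub>)) \<in> J 2"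
  shows "D' (D (U m)) - (\<Sum>e\<in>E. \<Sum>f\<in>E. fscale (r e * s f) (U (e (f m)) - \<one>\<^bsub>A\<^esub>)) \<in> J 2"
proof -
  have d: "D \<in> derivations A" "D' \<in> derivations A" "\<And>x. x \<in> E \<Longrightarrow> D' (W x) = 0"
    using D D' by (auto simp: reduced_der_def)
  define R where "R = (\<Sum>e\<in>E. fscale (r e) (U (e m) - \<one>\<^bsub>A\<^esub>))"
  have R: "R \<in> carrier A" unfolding R_def using m by (intro T.A_closed(6)) auto
  have "D' (D (U m) - R) \<in> J (2 + 0)"
    by (rule der_J[OF d(2)]) (use reduced_der_J1[OF D'] r R_def in auto)
  then have 1: "D' (D (U m)) - D' R \<in> J 2"
    using R m d by (simp add: der_diff)
  have sum_D': "D' (sum g I) = (\<Sum>i\<in>I. D' (g i))" if "finite I" "\<And>i. i \<in> I \<Longrightarrow> g i \<in> carrier A" for g and I :: "('a \<Rightarrow> 'a) set"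
    using that
  proof (induction I rule: finite_induct)
    case empty
    then show "D' (sum g {}) = (\<Sum>i\<in>{}. D' (g i))" by (simp add: der_zero[OF d(2)])
  next
    case (insert i I)
    have "sum g I \<in> carrier A" using insert by (intro T.A_closed(6)) auto
    then show "D' (sum g (insert i I)) = (\<Sum>i\<in>insert i I. D' (g i))"
      using insert by (simp add: der_add[OF d(2)])
  qed
  have "D' R = (\<Sum>e\<in>E. fscale (r e) (D' (U (e m))))"
    unfolding R_def using m fin_E d
    by (subst sum_D') (auto intro!: sum.cong simp: der_fscale der_diff der_one)
  also have "\<dots> = (\<Sum>e\<in>E. fscale (r e) (W e \<star> D' (U m) \<star> Wi e))"
    using der_act[OF d(2,3) _ m] by (intro sum.cong) auto
  finally have D'R: "D' R = (\<Sum>e\<in>E. fscale (r e) (W e \<star> D' (U m) \<star> Wi e))" .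
  have "(\<Sum>e\<in>E. fscale (r e) (W e \<star> (D' (U m) - (\<Sum>f\<in>E. fscale (s f) (U (f m) - \<one>\<^bsub>A\<^esub>))) \<star> Wi e)) \<in> J 2"
    using s by (intro J_closed(6) J_closed(3) star_J_right star_J_left) auto
  also have "(\<Sum>e\<in>E. fscale (r e) (W e \<star> (D' (U m) - (\<Sum>f\<in>E. fscale (s f) (U (f m) - \<one>\<^bsub>A\<^esub>))) \<star> Wi e))
     = (\<Sum>e\<in>E. fscale (r e) (W e \<star> D' (U m) \<star> Wi e) - (\<Sum>f\<in>E. fscale (r e * s f) (U (e (f m)) - \<one>\<^bsub>A\<^esub>)))"
  proof (rule sum.cong[OF refl])
    fix e assume e: "e \<in> E"
    have "W e \<star> (\<Sum>f\<in>E. fscale (s f) (U (f m) - \<one>\<^bsub>A\<^esub>)) \<star> Wi e = (\<Sum>f\<in>E. fscale (s f) (U (e (f m)) - \<one>\<^bsub>A\<^esub>))"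
      unfolding T.star_sum_right T.star_sum_left T.star_fscale_right T.star_fscale_left
      by (intro sum.cong refl arg_cong[where f = "fscale _"] U_act e) (use m in auto)
    then show "fscale (r e) (W e \<star> (D' (U m) - (\<Sum>f\<in>E. fscale (s f) (U (f m) - \<one>\<^bsub>A\<^esub>))) \<star> Wi e)
      = fscale (r e) (W e \<star> D' (U m) \<star> Wi e) - (\<Sum>f\<in>E. fscale (r e * s f) (U (e (f m)) - \<one>\<^bsub>A\<^esub>))"
      unfolding T.star_diff_right T.star_diff_left
      by (simp only: fsp.scale_right_diff_distrib fsp.scale_sum_right fsp.scale_scale)
  qed
  finally have 2: "D' R - (\<Sum>e\<in>E. \<Sum>f\<in>E. fscale (r e * s f) (U (e (f m)) - \<one>\<^bsub>A\<^esub>)) \<in> J 2"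
    by (simp only: D'R sum_subtractf)
  show ?thesis using J_closed(2)[OF 1 2] by (simp add: algebra_simps)
qed

lemma reduced_der_bracket:
  assumes D: "reduced_der D" and D': "reduced_der D'" and m: "m \<in> carrier P" and gen: "carrier P = orbit_gen m"
  shows "bracket D D' \<in> der_filt 2"
proof -
  have d: "D \<in> derivations A" "D' \<in> derivations A" using D D' by (auto simp: reduced_der_def)
  have "D \<in> der_filt (Suc 0)" "D' \<in> der_filt (Suc 0)" using D D' by (auto simp: der_filt_def reduced_der_def)
  then have B: "bracket D D' \<in> der_filt (Suc 0)" using der_filt_bracket[of D 0 D' 0] by simp
  then have b: "bracket D D' \<in> derivations A" "\<And>x. x \<in> E \<Longrightarrow> bracket D D' (W x) = 0"
    "\<And>u. u \<in> carrier P \<Longrightarrow> bracket D D' (U u) \<in> J 1" by (auto simp: der_filt_def)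
  obtain r where r: "D (U m) - (\<Sum>e\<in>E. fscale (r e) (U (e m) - \<one>\<^bsub>A\<^esub>)) \<in> J 2"
    using reduced_der_orbit_span[OF D m gen m] unfolding orbit_span_def by blast
  obtain s where s: "D' (U m) - (\<Sum>e\<in>E. fscale (s e) (U (e m) - \<one>\<^bsub>A\<^esub>)) \<in> J 2"
    using reduced_der_orbit_span[OF D' m gen m] unfolding orbit_span_def by blast
  \<comment> \<open>kE is commutative, so both orders of composition agree modulo J^2.\<close>
  have "(\<Sum>e\<in>E. \<Sum>f\<in>E. fscale (r e * s f) (U (e (f m)) - \<one>\<^bsub>A\<^esub>))
      = (\<Sum>f\<in>E. \<Sum>e\<in>E. fscale (s f * r e) (U (f (e m)) - \<one>\<^bsub>A\<^esub>))"
    by (subst sum.swap) (intro sum.cong refl, simp add: act_commute[OF _ _ m] mult.commute)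
  then have "D (D' (U m)) - D' (D (U m)) \<in> J 2"
    using J_closed(4)[OF reduced_der_compose[OF D' D m s r] reduced_der_compose[OF D D' m r s]] by simp
  then have Bm: "bracket D D' (U m) \<in> J 2" using m by (simp add: bracket_apply)
  \<comment> \<open>The bracket is again E-equivariant and additive modulo J^2, so its vanishing at
    m spreads to P = \<open>orbit_gen m\<close>.\<close>
  have "bracket D D' (U u) \<in> J 2" if u: "u \<in> carrier P" for u
  proof (rule additive_mod_J2[where f = "\<lambda>u. bracket D D' (U u)", OF _ J_subspace order_refl m])
    show "u \<in> orbit_gen m" using u gen by simp
    show "bracket D D' (U (e m)) \<in> J 2" if "e \<in> E" for e
      using der_act[OF b(1,2) that m] Bm that by (simp add: star_J_left star_J_right)
  qed (rule der_additive_mod_J2[OF b(1,3)])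
  then show ?thesis using b by (simp add: der_filt_def)
qed

lemma solvable_of_cyclic:
  assumes "m \<in> carrier P" "carrier P = orbit_gen m"
  shows "lie_solvable HH"
  using solvable_if reduced_der_bracket[OF _ _ assms] by blast

end

section \<open>Semisimple and multiplicity free modules\<close>

context module
begin

section \<open>Simple modules and their annihilators\<close>

abbreviation submod where "submod N \<equiv> M\<lparr>carrier := N\<rparr>"

lemma submodule_iff_submod:
  assumes N: "submodule N R M"
  shows "submodule H R (submod N) \<longleftrightarrow> submodule H R M \<and> H \<subseteq> N"
proof -
  have mod: "module R M" by unfold_locales
  interpret SN: module R "submod N" by (rule submodule.submodule_is_module[OF N mod])
  show ?thesis
  proof
    assume H: "submodule H R (submod N)"
    have HN: "H \<subseteq> N" using SN.submoduleE(1)[OF H] by simp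
    have "module R (M\<lparr>carrier := H\<rparr>)"
      using submodule.submodule_is_module[OF H] SN.module_axioms by simp
    then have "submodule H R M"
      using module_incl_imp_submodule[of H] HN submoduleE(1)[OF N] by blast
    with HN show "submodule H R M \<and> H \<subseteq> N" by simp
  next
    assume H: "submodule H R M \<and> H \<subseteq> N"
    then have "module R (M\<lparr>carrier := H\<rparr>)"
      using submodule.submodule_is_module[of H R M] mod by blast
    then show "submodule H R (submod N)"
      using SN.module_incl_imp_submodule[of H] H by simp
  qed
qed

lemma simple_iff_submod:
  assumes N: "submodule N R M"
  shows "simple_module R (submod N) \<longleftrightarrow>
    N \<noteq> {\<zero>\<^bsub>M\<^esub>} \<and> (\<forall>H. submodule H R M \<and> H \<subseteq> N \<longrightarrow> H = {\<zero>\<^bsub>M\<^esub>} \<or> H = N)"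
proof -
  have "module R (submod N)"
    by (rule submodule.submodule_is_module[OF N]) unfold_locales
  then show ?thesis by (auto simp: simple_module_def submodule_iff_submod[OF N])
qed

lemma submod_zero: "submodule N R M \<Longrightarrow> \<zero>\<^bsub>M\<^esub> \<in> N"
  using submodule.axioms(1) subgroup.one_closed by force

lemma submod_in: "submodule N R M \<Longrightarrow> x \<in> N \<Longrightarrow> x \<in> carrier M"
  using submoduleE(1) by blast

lemma submod_minus: "submodule N R M \<Longrightarrow> x \<in> N \<Longrightarrow> y \<in> N \<Longrightarrow> x \<ominus>\<^bsub>M\<^esub> y \<in> N"
  using submoduleE(3,5) by (simp add: a_minus_def)

lemma submod_finsum:
  assumes N: "submodule N R M" and fin: "finite I" and f: "\<And>i. i \<in> I \<Longrightarrow> f i \<in> N"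
  shows "finsum M f I \<in> N"
  using fin f
proof (induction I)
  case (insert i I)
  then have "f \<in> I \<rightarrow> carrier M" "f i \<in> carrier M" using submod_in[OF N] by auto
  then show ?case using insert submoduleE(5)[OF N] by simp
qed (simp add: submod_zero[OF N])

lemma cyclic_submodule:
  assumes m: "m \<in> carrier M"
  shows "submodule {r \<odot>\<^bsub>M\<^esub> m | r. r \<in> carrier R} R M"
proof (rule submoduleI)
  show "\<zero>\<^bsub>M\<^esub> \<in> {r \<odot>\<^bsub>M\<^esub> m | r. r \<in> carrier R}"
    using m smult_l_null[OF m] R.zero_closed by (metis (mono_tags, lifting) mem_Collect_eq)
next
  fix a assume "a \<in> {r \<odot>\<^bsub>M\<^esub> m | r. r \<in> carrier R}"
  then obtain r where r: "r \<in> carrier R" "a = r \<odot>\<^bsub>M\<^esub> m" by blast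
  then have "\<ominus>\<^bsub>M\<^esub> a = (\<ominus> r) \<odot>\<^bsub>M\<^esub> m" using m smult_l_minus by simp
  then show "\<ominus>\<^bsub>M\<^esub> a \<in> {r \<odot>\<^bsub>M\<^esub> m | r. r \<in> carrier R}" using r by blast
next
  fix a b assume "a \<in> {r \<odot>\<^bsub>M\<^esub> m | r. r \<in> carrier R}" "b \<in> {r \<odot>\<^bsub>M\<^esub> m | r. r \<in> carrier R}"
  then obtain r s where "r \<in> carrier R" "a = r \<odot>\<^bsub>M\<^esub> m" "s \<in> carrier R" "b = s \<odot>\<^bsub>M\<^esub> m" by blast
  then show "a \<oplus>\<^bsub>M\<^esub> b \<in> {r \<odot>\<^bsub>M\<^esub> m | r. r \<in> carrier R}"
    using m smult_l_distr[of r s m] by (metis (mono_tags, lifting) R.a_closed mem_Collect_eq)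
next
  fix s a assume "s \<in> carrier R" "a \<in> {r \<odot>\<^bsub>M\<^esub> m | r. r \<in> carrier R}"
  then obtain r where "r \<in> carrier R" "a = r \<odot>\<^bsub>M\<^esub> m" "s \<in> carrier R" by blast
  then show "s \<odot>\<^bsub>M\<^esub> a \<in> {r \<odot>\<^bsub>M\<^esub> m | r. r \<in> carrier R}"
    using m smult_assoc1[of s r m] by (metis (mono_tags, lifting) R.m_closed mem_Collect_eq)
qed (use m in auto)

lemma simple_cyclic:
  assumes N: "submodule N R M" "simple_module R (submod N)" and n: "n \<in> N" "n \<noteq> \<zero>\<^bsub>M\<^esub>" and x: "x \<in> N"
  obtains r where "r \<in> carrier R" "x = r \<odot>\<^bsub>M\<^esub> n"
proof -
  let ?H = "{r \<odot>\<^bsub>M\<^esub> n | r. r \<in> carrier R}"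
  have nM: "n \<in> carrier M" using n N submod_in by blast
  have "?H \<subseteq> N" using submoduleE(4)[OF N(1)] n by blast
  moreover have "n \<in> ?H" using nM smult_one by (metis (mono_tags, lifting) R.one_closed mem_Collect_eq)
  moreover have "?H = {\<zero>\<^bsub>M\<^esub>} \<or> ?H = N"
    using calculation(1) cyclic_submodule[OF nM] N(2) simple_iff_submod[OF N(1)] by blast
  ultimately have "?H = N" using n(2) by auto
  then show thesis using x that by blast
qed

lemma smult_minus_eq_zero:
  assumes "r \<in> carrier R" "s \<in> carrier R" "x \<in> carrier M"
  shows "(r \<ominus> s) \<odot>\<^bsub>M\<^esub> x = \<zero>\<^bsub>M\<^esub> \<longleftrightarrow> r \<odot>\<^bsub>M\<^esub> x = s \<odot>\<^bsub>M\<^esub> x"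
proof -
  have "(r \<ominus> s) \<odot>\<^bsub>M\<^esub> x = r \<odot>\<^bsub>M\<^esub> x \<ominus>\<^bsub>M\<^esub> s \<odot>\<^bsub>M\<^esub> x"
    using assms by (simp add: a_minus_def smult_l_distr smult_l_minus)
  moreover have "a \<ominus>\<^bsub>M\<^esub> b = \<zero>\<^bsub>M\<^esub> \<longleftrightarrow> a = b" if "a \<in> carrier M" "b \<in> carrier M" for a b
  proof
    assume "a \<ominus>\<^bsub>M\<^esub> b = \<zero>\<^bsub>M\<^esub>"
    then have "\<ominus>\<^bsub>M\<^esub> (\<ominus>\<^bsub>M\<^esub> b) = a" using that M.minus_equality[of a "\<ominus>\<^bsub>M\<^esub> b"] by (simp add: a_minus_def)
    then show "a = b" using that by simp
  qed (use that in \<open>simp add: a_minus_def M.r_neg\<close>)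
  ultimately show ?thesis using assms by simp
qed

text \<open>If every r killing n' also killed n, then r n' \<mapsto> r n would be an isomorphism of
  the two simple modules.\<close>

lemma annihilator_separates:
  assumes N: "submodule N R M" "simple_module R (submod N)" and N': "submodule N' R M" "simple_module R (submod N')"
    and n: "n \<in> N" "n \<noteq> \<zero>\<^bsub>M\<^esub>" and n': "n' \<in> N'" "n' \<noteq> \<zero>\<^bsub>M\<^esub>"
    and non_iso: "\<not> module_isomorphic R (submod N') (submod N)"
  obtains r where "r \<in> carrier R" "r \<odot>\<^bsub>M\<^esub> n \<noteq> \<zero>\<^bsub>M\<^esub>" "r \<odot>\<^bsub>M\<^esub> n' = \<zero>\<^bsub>M\<^esub>"
proof (rule ccontr)
  assume "\<not> thesis"
  then have ann: "r \<odot>\<^bsub>M\<^esub> n = \<zero>\<^bsub>M\<^esub>" if "r \<in> carrier R" "r \<odot>\<^bsub>M\<^esub> n' = \<zero>\<^bsub>M\<^esub>" for r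
    using that \<open>\<And>r. \<lbrakk>r \<in> carrier R; r \<odot>\<^bsub>M\<^esub> n \<noteq> \<zero>\<^bsub>M\<^esub>; r \<odot>\<^bsub>M\<^esub> n' = \<zero>\<^bsub>M\<^esub>\<rbrakk> \<Longrightarrow> thesis\<close> by blast
  have nM: "n \<in> carrier M" "n' \<in> carrier M" using n n' N N' submod_in by blast+
  \<comment> \<open>The inclusion of annihilators makes the value independent of the chosen
    r.\<close>
  define h where "h x = (SOME r. r \<in> carrier R \<and> x = r \<odot>\<^bsub>M\<^esub> n') \<odot>\<^bsub>M\<^esub> n" for x
  have h: "h (r \<odot>\<^bsub>M\<^esub> n') = r \<odot>\<^bsub>M\<^esub> n" if r: "r \<in> carrier R" for r
  proof -
    define s where "s = (SOME s. s \<in> carrier R \<and> r \<odot>\<^bsub>M\<^esub> n' = s \<odot>\<^bsub>M\<^esub> n')"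
    have s: "s \<in> carrier R" "r \<odot>\<^bsub>M\<^esub> n' = s \<odot>\<^bsub>M\<^esub> n'"
      using someI[of "\<lambda>s. s \<in> carrier R \<and> r \<odot>\<^bsub>M\<^esub> n' = s \<odot>\<^bsub>M\<^esub> n'" r] r unfolding s_def by auto
    then have "r \<odot>\<^bsub>M\<^esub> n = s \<odot>\<^bsub>M\<^esub> n"
      using ann[of "r \<ominus> s"] smult_minus_eq_zero r nM by simp
    then show ?thesis by (simp add: h_def s_def)
  qed
  have N'_elem: "\<exists>r\<in>carrier R. x = r \<odot>\<^bsub>M\<^esub> n'" if "x \<in> N'" for x
    using simple_cyclic[OF N' n' that] by blast
  \<comment> \<open>The reverse inclusion: a nonzero r n' generates N', so n' = s r n'. Then 1 - s r
    kills n', hence n, and n = s r n = 0.\<close>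
  have inj: "r \<odot>\<^bsub>M\<^esub> n' = \<zero>\<^bsub>M\<^esub>" if r: "r \<in> carrier R" "r \<odot>\<^bsub>M\<^esub> n = \<zero>\<^bsub>M\<^esub>" for r
  proof (rule ccontr)
    assume ne: "r \<odot>\<^bsub>M\<^esub> n' \<noteq> \<zero>\<^bsub>M\<^esub>"
    have "r \<odot>\<^bsub>M\<^esub> n' \<in> N'" using submoduleE(4)[OF N'(1)] r n' by blast
    then obtain s where s: "s \<in> carrier R" "n' = s \<odot>\<^bsub>M\<^esub> (r \<odot>\<^bsub>M\<^esub> n')"
      using simple_cyclic[OF N' _ ne n'(1)] by blast
    then have "\<one> \<odot>\<^bsub>M\<^esub> n' = (s \<otimes> r) \<odot>\<^bsub>M\<^esub> n'" using r nM by (simp add: smult_assoc1)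
    then have "(\<one> \<ominus> s \<otimes> r) \<odot>\<^bsub>M\<^esub> n = \<zero>\<^bsub>M\<^esub>"
      using ann[of "\<one> \<ominus> s \<otimes> r"] r s nM smult_minus_eq_zero[of \<one> "s \<otimes> r" n'] by simp
    then have "n = (s \<otimes> r) \<odot>\<^bsub>M\<^esub> n" using r s nM smult_minus_eq_zero[of \<one> "s \<otimes> r" n] by simp
    then show False using r s nM n by (simp add: smult_assoc1)
  qed
  have "bij_betw h N' N"
    unfolding bij_betw_def
  proof
    show "inj_on h N'"
    proof (rule inj_onI)
      fix x y assume xy: "x \<in> N'" "y \<in> N'" "h x = h y"
      obtain r s where "r \<in> carrier R" "x = r \<odot>\<^bsub>M\<^esub> n'" "s \<in> carrier R" "y = s \<odot>\<^bsub>M\<^esub> n'"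
        using N'_elem xy by metis
      then show "x = y"
        using xy(3) inj[of "r \<ominus> s"] smult_minus_eq_zero nM h by simp
    qed
    show "h ` N' = N"
    proof
      show "h ` N' \<subseteq> N"
        using N'_elem h submoduleE(4)[OF N(1)] n by (metis image_subsetI)
      show "N \<subseteq> h ` N'"
      proof
        fix x assume "x \<in> N"
        then obtain r where "r \<in> carrier R" "x = r \<odot>\<^bsub>M\<^esub> n" using simple_cyclic[OF N n] by blast
        then show "x \<in> h ` N'" using h submoduleE(4)[OF N'(1)] n' by (metis imageI)
      qed
    qed
  qed
  moreover have "h (x \<oplus>\<^bsub>M\<^esub> y) = h x \<oplus>\<^bsub>M\<^esub> h y" if "x \<in> N'" "y \<in> N'" for x y
  proof -
    obtain r s where "r \<in> carrier R" "x = r \<odot>\<^bsub>M\<^esub> n'" "s \<in> carrier R" "y = s \<odot>\<^bsub>M\<^esub> n'"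
      using N'_elem \<open>x \<in> N'\<close> \<open>y \<in> N'\<close> by metis
    then show ?thesis using h[of "r \<oplus> s"] h[of r] h[of s] nM by (simp add: smult_l_distr)
  qed
  moreover have "h (r \<odot>\<^bsub>M\<^esub> x) = r \<odot>\<^bsub>M\<^esub> h x" if "r \<in> carrier R" "x \<in> N'" for r x
  proof -
    obtain s where "s \<in> carrier R" "x = s \<odot>\<^bsub>M\<^esub> n'" using N'_elem \<open>x \<in> N'\<close> by metis
    then show ?thesis using that h[of "r \<otimes> s"] h[of s] nM by (simp add: smult_assoc1)
  qed
  ultimately have "module_isomorphic R (submod N') (submod N)"
    unfolding module_isomorphic_def by (intro exI[of _ h]) simp
  with non_iso show False by simp
qed

text \<open>The Chinese remainder theorem for the annihilators of the summands, which are pairwise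
  distinct maximal ideals.\<close>
lemma multiplicity_free_cyclic:
  assumes "multiplicity_free R M"
  obtains m where "m \<in> carrier M" "\<And>x. x \<in> carrier M \<Longrightarrow> \<exists>r\<in>carrier R. x = r \<odot>\<^bsub>M\<^esub> m"
proof -
  obtain SS where SS0: "direct_sum R M SS \<and> (\<forall>N\<in>SS. simple_module R (submod N)) \<and>
      (\<forall>N\<in>SS. \<forall>N'\<in>SS. N \<noteq> N' \<longrightarrow> \<not> module_isomorphic R (submod N) (submod N'))"
    using assms unfolding multiplicity_free_def by (elim exE)
  then have SS: "direct_sum R M SS" "\<And>N. N \<in> SS \<Longrightarrow> simple_module R (submod N)"
    "\<And>N N'. N \<in> SS \<Longrightarrow> N' \<in> SS \<Longrightarrow> N \<noteq> N' \<Longrightarrow> \<not> module_isomorphic R (submod N) (submod N')"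
    by simp_all
  have fin: "finite SS" and sm: "\<And>N. N \<in> SS \<Longrightarrow> submodule N R M"
    using SS(1) unfolding direct_sum_def by simp_all
  have components: "\<exists>f. f \<in> (\<Pi>\<^sub>E N\<in>SS. N) \<and> x = finsum M f SS" if "x \<in> carrier M" for x
    using SS(1) that unfolding direct_sum_def by (meson ex1_implies_ex)
  have "\<exists>n\<in>N. n \<noteq> \<zero>\<^bsub>M\<^esub>" if "N \<in> SS" for N
    using simple_iff_submod[OF sm[OF that]] SS(2)[OF that] submod_zero[OF sm[OF that]] by blast
  then obtain n where n: "\<And>N. N \<in> SS \<Longrightarrow> n N \<in> N" "\<And>N. N \<in> SS \<Longrightarrow> n N \<noteq> \<zero>\<^bsub>M\<^esub>"
    by metis
  have nM: "n N \<in> carrier M" if "N \<in> SS" for N using n(1)[OF that] submod_in[OF sm[OF that]] by simp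
  have sep: "\<exists>r\<in>carrier R. r \<odot>\<^bsub>M\<^esub> n N \<noteq> \<zero>\<^bsub>M\<^esub> \<and> (\<forall>N'\<in>F. r \<odot>\<^bsub>M\<^esub> n N' = \<zero>\<^bsub>M\<^esub>)"
    if "finite F" "F \<subseteq> SS - {N}" "N \<in> SS" for F N
    using that
  proof (induction F)
    case empty
    then show ?case using n(2) nM by (intro bexI[of _ \<one>]) auto
  next
    case (insert N' F)
    obtain r where r: "r \<in> carrier R" "r \<odot>\<^bsub>M\<^esub> n N \<noteq> \<zero>\<^bsub>M\<^esub>" "\<forall>N'\<in>F. r \<odot>\<^bsub>M\<^esub> n N' = \<zero>\<^bsub>M\<^esub>"
      using insert by auto
    have N': "N' \<in> SS" "N' \<noteq> N" using insert by auto
    obtain s where s: "s \<in> carrier R" "s \<odot>\<^bsub>M\<^esub> n N \<noteq> \<zero>\<^bsub>M\<^esub>" "s \<odot>\<^bsub>M\<^esub> n N' = \<zero>\<^bsub>M\<^esub>"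
      using annihilator_separates[of N N' "n N" "n N'"] sm SS n N' insert.prems by metis
    have comm: "(r \<otimes> s) \<odot>\<^bsub>M\<^esub> y = s \<odot>\<^bsub>M\<^esub> (r \<odot>\<^bsub>M\<^esub> y)" if "y \<in> carrier M" for y
      using r s that by (simp add: smult_assoc1[symmetric] R.m_comm)
    \<comment> \<open>The annihilator of \<open>n N\<close> is prime: s n(N) generates N, so n(N) =
      t s n(N), and (r s) n(N) = 0 would force r n(N) = 0.\<close>
    have "(r \<otimes> s) \<odot>\<^bsub>M\<^esub> n N \<noteq> \<zero>\<^bsub>M\<^esub>"
    proof
      assume 0: "(r \<otimes> s) \<odot>\<^bsub>M\<^esub> n N = \<zero>\<^bsub>M\<^esub>"
      have "s \<odot>\<^bsub>M\<^esub> n N \<in> N" using submoduleE(4)[OF sm] s n insert.prems by blast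
      then obtain t where t: "t \<in> carrier R" "n N = t \<odot>\<^bsub>M\<^esub> (s \<odot>\<^bsub>M\<^esub> n N)"
        using simple_cyclic[OF sm SS(2) _ s(2)] n insert.prems by blast
      have "r \<odot>\<^bsub>M\<^esub> n N = (r \<otimes> (t \<otimes> s)) \<odot>\<^bsub>M\<^esub> n N"
        using t r s nM[OF insert.prems(2)] by (simp add: smult_assoc1)
      also have "r \<otimes> (t \<otimes> s) = t \<otimes> (r \<otimes> s)" using r s t by (simp add: R.m_ac)
      also have "\<dots> \<odot>\<^bsub>M\<^esub> n N = \<zero>\<^bsub>M\<^esub>"
        using t r s nM[OF insert.prems(2)] 0 smult_assoc1[of t "r \<otimes> s" "n N"] by simp
      finally show False using r by simp
    qed
    moreover have "(r \<otimes> s) \<odot>\<^bsub>M\<^esub> n N'' = \<zero>\<^bsub>M\<^esub>" if "N'' \<in> insert N' F" for N''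
    proof (cases "N'' = N'")
      case True
      then show ?thesis using r s nM[OF N'(1)] by (simp add: smult_assoc1)
    next
      case False
      then have "N'' \<in> F" "N'' \<in> SS" using that insert.prems by auto
      then show ?thesis using comm[OF nM] r s by simp
    qed
    ultimately show ?case using r s by (intro bexI[of _ "r \<otimes> s"]) auto
  qed
  \<comment> \<open>The sum of the generators generates M: an r that separates N from all other
    summands gives r m = r n(N), which generates N.\<close>
  define m where "m = finsum M n SS"
  have m: "m \<in> carrier M" unfolding m_def using nM by auto
  define K where "K = {r \<odot>\<^bsub>M\<^esub> m | r. r \<in> carrier R}"
  have K: "submodule K R M" unfolding K_def by (rule cyclic_submodule[OF m])
  have NK: "N \<subseteq> K" if N: "N \<in> SS" for N
  proof
    fix x assume x: "x \<in> N"
    obtain r where r: "r \<in> carrier R" "r \<odot>\<^bsub>M\<^esub> n N \<noteq> \<zero>\<^bsub>M\<^esub>" "\<forall>N'\<in>SS - {N}. r \<odot>\<^bsub>M\<^esub> n N' = \<zero>\<^bsub>M\<^esub>"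
      using sep[of "SS - {N}" N] fin N by auto
    have "r \<odot>\<^bsub>M\<^esub> m = (\<Oplus>\<^bsub>M\<^esub>N'\<in>SS. r \<odot>\<^bsub>M\<^esub> n N')"
      unfolding m_def using fin r nM by (intro finsum_smult_ldistr) auto
    also have "\<dots> = (\<Oplus>\<^bsub>M\<^esub>N'\<in>SS. if N = N' then r \<odot>\<^bsub>M\<^esub> n N' else \<zero>\<^bsub>M\<^esub>)"
      using r nM N by (intro M.finsum_cong') auto
    also have "\<dots> = r \<odot>\<^bsub>M\<^esub> n N"
    proof (rule M.finsum_singleton[OF N fin])
      show "(\<lambda>N'. r \<odot>\<^bsub>M\<^esub> n N') \<in> SS \<rightarrow> carrier M" using r nM by auto
    qed
    finally have "r \<odot>\<^bsub>M\<^esub> m = r \<odot>\<^bsub>M\<^esub> n N" .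
    moreover have "r \<odot>\<^bsub>M\<^esub> m \<in> K" unfolding K_def using r(1) by blast
    ultimately have rm: "r \<odot>\<^bsub>M\<^esub> n N \<in> K" by (simp only:)
    have "r \<odot>\<^bsub>M\<^esub> n N \<in> N" by (rule submoduleE(4)[OF sm[OF N] r(1) n(1)[OF N]])
    then obtain s where "s \<in> carrier R" "x = s \<odot>\<^bsub>M\<^esub> (r \<odot>\<^bsub>M\<^esub> n N)"
      using simple_cyclic[OF sm[OF N] SS(2)[OF N] _ r(2) x] by blast
    then show "x \<in> K" using submoduleE(4)[OF K _ rm] by simp
  qed
  show thesis
  proof (rule that[OF m])
    fix x assume "x \<in> carrier M"
    then obtain f where f: "f \<in> (\<Pi>\<^sub>E N\<in>SS. N)" "x = finsum M f SS" using components by metis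
    have "f N \<in> K" if "N \<in> SS" for N
      using PiE_mem[OF f(1) that] NK[OF that] by blast
    then have "finsum M f SS \<in> K" by (rule submod_finsum[OF K fin])
    then show "\<exists>r\<in>carrier R. x = r \<odot>\<^bsub>M\<^esub> m" using f unfolding K_def by blast
  qed
qed

section \<open>Decomposition into simple submodules\<close>

lemma minimal_submodule:
  assumes fin: "finite N" and N: "submodule N R M" "N \<noteq> {\<zero>\<^bsub>M\<^esub>}"
  obtains S where "submodule S R M" "S \<subseteq> N" "simple_module R (submod S)"
proof -
  define F where "F = {H. submodule H R M \<and> H \<subseteq> N \<and> H \<noteq> {\<zero>\<^bsub>M\<^esub>}}"
  have "finite F" unfolding F_def by (rule finite_subset[of _ "Pow N"]) (use fin in auto)
  moreover have "N \<in> F" using N by (simp add: F_def)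
  ultimately obtain S where S: "S \<in> F" "\<And>H. H \<in> F \<Longrightarrow> H \<subseteq> S \<Longrightarrow> H = S"
    using finite_has_minimal[of F] by (metis empty_iff)
  have "simple_module R (submod S)"
    using S unfolding F_def by (subst simple_iff_submod) auto
  then show thesis using S(1) that unfolding F_def by blast
qed

lemma submodule_Int:
  assumes "submodule N R M" "submodule N' R M"
  shows "submodule (N \<inter> N') R M"
proof (rule submoduleI)
  show "N \<inter> N' \<subseteq> carrier M" using submoduleE(1)[OF assms(1)] by blast
  show "\<zero>\<^bsub>M\<^esub> \<in> N \<inter> N'" using submod_zero assms by simp
  show "\<ominus>\<^bsub>M\<^esub> a \<in> N \<inter> N'" if "a \<in> N \<inter> N'" for a
    using that submoduleE(3)[OF assms(1), of a] submoduleE(3)[OF assms(2), of a] by simp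
  show "a \<oplus>\<^bsub>M\<^esub> b \<in> N \<inter> N'" if "a \<in> N \<inter> N'" "b \<in> N \<inter> N'" for a b
    using that submoduleE(5)[OF assms(1), of a b] submoduleE(5)[OF assms(2), of a b] by simp
  show "r \<odot>\<^bsub>M\<^esub> a \<in> N \<inter> N'" if "r \<in> carrier R" "a \<in> N \<inter> N'" for r a
    using that submoduleE(4)[OF assms(1), of r a] submoduleE(4)[OF assms(2), of r a] by simp
qed

lemma neg_cancel:
  assumes "a \<in> carrier M" "b \<in> carrier M"
  shows "\<ominus>\<^bsub>M\<^esub> a \<oplus>\<^bsub>M\<^esub> (a \<oplus>\<^bsub>M\<^esub> b) = b" "(a \<oplus>\<^bsub>M\<^esub> b) \<ominus>\<^bsub>M\<^esub> a = b"
proof -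
  show "\<ominus>\<^bsub>M\<^esub> a \<oplus>\<^bsub>M\<^esub> (a \<oplus>\<^bsub>M\<^esub> b) = b" using assms by (simp add: M.a_assoc[symmetric] M.l_neg)
  then show "(a \<oplus>\<^bsub>M\<^esub> b) \<ominus>\<^bsub>M\<^esub> a = b" using assms by (simp add: a_minus_def M.a_comm[of "a \<oplus>\<^bsub>M\<^esub> b"])
qed

lemma minus_swap:
  assumes "a \<in> carrier M" "b \<in> carrier M" "c \<in> carrier M" "d \<in> carrier M" "a \<oplus>\<^bsub>M\<^esub> b = c \<oplus>\<^bsub>M\<^esub> d"
  shows "a \<ominus>\<^bsub>M\<^esub> c = d \<ominus>\<^bsub>M\<^esub> b"
proof -
  have "a = (a \<oplus>\<^bsub>M\<^esub> b) \<oplus>\<^bsub>M\<^esub> \<ominus>\<^bsub>M\<^esub> b" using assms(1,2) by (simp add: M.a_assoc M.r_neg)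
  then have "a = c \<oplus>\<^bsub>M\<^esub> (d \<oplus>\<^bsub>M\<^esub> \<ominus>\<^bsub>M\<^esub> b)" using assms by (simp add: M.a_assoc)
  then have "\<ominus>\<^bsub>M\<^esub> c \<oplus>\<^bsub>M\<^esub> a = d \<oplus>\<^bsub>M\<^esub> \<ominus>\<^bsub>M\<^esub> b"
    using neg_cancel(1)[of c "d \<oplus>\<^bsub>M\<^esub> \<ominus>\<^bsub>M\<^esub> b"] assms(2-4) by simp
  then show ?thesis using assms by (simp add: a_minus_def M.a_comm)
qed

text \<open>The uniqueness clause of \<open>direct_sum\<close> relative to a submodule N, so that
  the induction can stay inside M.\<close>

definition uniquely_sums where
  "uniquely_sums SS N \<longleftrightarrow> (\<forall>x\<in>N. \<exists>!f. f \<in> (\<Pi>\<^sub>E T\<in>SS. T) \<and> x = finsum M f SS)"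

lemma uniquely_sums_insert:
  assumes SS: "finite SS" "\<And>T. T \<in> SS \<Longrightarrow> submodule T R M \<and> T \<subseteq> N" "uniquely_sums SS N"
    and N: "submodule N R M" and T: "submodule T R M" "T \<notin> SS" "T \<inter> N = {\<zero>\<^bsub>M\<^esub>}"
    and sum: "\<And>x. x \<in> N' \<Longrightarrow> \<exists>t\<in>T. \<exists>y\<in>N. x = t \<oplus>\<^bsub>M\<^esub> y"
  shows "uniquely_sums (insert T SS) N'"
  unfolding uniquely_sums_def
proof
  fix x assume "x \<in> N'"
  then obtain t y where ty: "t \<in> T" "y \<in> N" "x = t \<oplus>\<^bsub>M\<^esub> y" using sum by blast
  have carr: "f \<in> SS \<rightarrow> carrier M" "finsum M f SS \<in> N" if "\<And>S. S \<in> SS \<Longrightarrow> f S \<in> S" for f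
  proof -
    have "f S \<in> N" if "S \<in> SS" for S using SS(2)[OF that] \<open>\<And>S. S \<in> SS \<Longrightarrow> f S \<in> S\<close>[OF that] by blast
    then show "finsum M f SS \<in> N" "f \<in> SS \<rightarrow> carrier M"
      using submod_finsum[OF N SS(1)] submod_in[OF N] by auto
  qed
  have split: "finsum M f (insert T SS) = f T \<oplus>\<^bsub>M\<^esub> finsum M f SS"
    if "f \<in> (\<Pi>\<^sub>E S\<in>insert T SS. S)" for f
  proof (rule M.finsum_insert[OF SS(1) T(2)])
    show "f \<in> SS \<rightarrow> carrier M" by (rule carr(1)) (use that in auto)
    show "f T \<in> carrier M" using that submod_in[OF T(1)] by auto
  qed
  obtain f where f: "f \<in> (\<Pi>\<^sub>E S\<in>SS. S)" "y = finsum M f SS"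
    "\<And>g. g \<in> (\<Pi>\<^sub>E S\<in>SS. S) \<Longrightarrow> y = finsum M g SS \<Longrightarrow> g = f"
    using SS(3) ty(2) unfolding uniquely_sums_def by metis
  define f' where "f' = f(T := t)"
  have f'P: "f' \<in> (\<Pi>\<^sub>E S\<in>insert T SS. S)" using f(1) ty(1) by (auto simp: f'_def PiE_def extensional_def)
  have eqf: "finsum M f' SS = finsum M f SS"
    using T(2) carr(1)[of f] f(1) by (intro M.finsum_cong') (auto simp: f'_def)
  show "\<exists>!f. f \<in> (\<Pi>\<^sub>E S\<in>insert T SS. S) \<and> x = finsum M f (insert T SS)"
  proof (rule ex1I[of _ f'])
    show "f' \<in> (\<Pi>\<^sub>E S\<in>insert T SS. S) \<and> x = finsum M f' (insert T SS)"
      using f'P split[OF f'P] eqf f(2) ty(3) by (simp add: f'_def)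
  next
    fix g assume g: "g \<in> (\<Pi>\<^sub>E S\<in>insert T SS. S) \<and> x = finsum M g (insert T SS)"
    have gT: "g T \<in> T" and gs: "finsum M g SS \<in> N" using g carr(2)[of g] by auto
    have mem: "g T \<in> carrier M" "finsum M g SS \<in> carrier M" "t \<in> carrier M" "y \<in> carrier M"
      using gT gs ty submod_in T N by blast+
    have eq: "t \<oplus>\<^bsub>M\<^esub> y = g T \<oplus>\<^bsub>M\<^esub> finsum M g SS" using g split[of g] ty(3) by simp
    \<comment> \<open>Two decompositions differ by an element of T that also lies in N, hence by
      zero.\<close>
    have "t \<ominus>\<^bsub>M\<^esub> g T = finsum M g SS \<ominus>\<^bsub>M\<^esub> y"
      by (rule minus_swap[OF mem(3,4,1,2) eq])
    moreover have "t \<ominus>\<^bsub>M\<^esub> g T \<in> T" by (rule submod_minus[OF T(1) ty(1) gT])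
    moreover have "finsum M g SS \<ominus>\<^bsub>M\<^esub> y \<in> N" by (rule submod_minus[OF N gs ty(2)])
    ultimately have 0: "t \<ominus>\<^bsub>M\<^esub> g T = \<zero>\<^bsub>M\<^esub>" using T(3) by auto
    then have "\<ominus>\<^bsub>M\<^esub> (\<ominus>\<^bsub>M\<^esub> g T) = t" using mem M.minus_equality[of t "\<ominus>\<^bsub>M\<^esub> g T"] by (simp add: a_minus_def)
    then have tg: "g T = t" using mem by simp
    then have ys: "y = finsum M g SS" using eq mem by simp
    \<comment> \<open>Members of the extensional product over \<open>SS\<close> are
      \<open>undefined\<close> at T; the uniqueness of f speaks only of such functions.\<close>
    define g' where "g' = g(T := undefined)"
    have g'P: "g' \<in> (\<Pi>\<^sub>E S\<in>SS. S)" using g T(2) by (auto simp: g'_def PiE_def extensional_def Pi_def)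
    have "finsum M g' SS = finsum M g SS"
      using T(2) carr(1)[of g] g by (intro M.finsum_cong') (auto simp: g'_def)
    then have "g' = f" using f(3)[OF g'P] ys by simp
    then show "g = f'" using tg by (auto simp: g'_def f'_def)
  qed
qed

text \<open>Complements pass to submodules by the modular law: if C complements T \<subseteq> N in
  M, then C \<inter> N complements T in N. So a minimal submodule splits off and the cardinality
  drops.\<close>

lemma semisimple_decomposition:
  assumes fin: "finite (carrier M)"
    and compl: "\<And>N. submodule N R M \<Longrightarrow> \<exists>C. submodule C R M \<and> N \<inter> C = {\<zero>\<^bsub>M\<^esub>} \<and>
      (\<forall>x\<in>carrier M. \<exists>a\<in>N. \<exists>b\<in>C. x = a \<oplus>\<^bsub>M\<^esub> b)"
  obtains SS where "direct_sum R M SS" "\<And>N. N \<in> SS \<Longrightarrow> simple_module R (submod N)"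
proof -
  have "\<exists>SS. finite SS \<and> (\<forall>T\<in>SS. submodule T R M \<and> T \<subseteq> N \<and> simple_module R (submod T)) \<and> uniquely_sums SS N"
    if "submodule N R M" for N
    using that
  proof (induction "card N" arbitrary: N rule: less_induct)
    case less
    have finN: "finite N" using fin submoduleE(1)[OF less.prems] finite_subset by blast
    show ?case
    proof (cases "N = {\<zero>\<^bsub>M\<^esub>}")
      case True
      then show ?thesis by (intro exI[of _ "{}"]) (auto simp: uniquely_sums_def)
    next
      case False
      obtain T where T: "submodule T R M" "T \<subseteq> N" "simple_module R (submod T)"
        using minimal_submodule[OF finN less.prems False] by blast
      obtain C where C: "submodule C R M" "T \<inter> C = {\<zero>\<^bsub>M\<^esub>}"
        "\<And>x. x \<in> carrier M \<Longrightarrow> \<exists>a\<in>T. \<exists>b\<in>C. x = a \<oplus>\<^bsub>M\<^esub> b"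
        using compl[OF T(1)] by blast
      define N1 where "N1 = C \<inter> N"
      have N1: "submodule N1 R M" unfolding N1_def by (rule submodule_Int[OF C(1) less.prems])
      have TN1: "T \<inter> N1 = {\<zero>\<^bsub>M\<^esub>}" using C(2) submod_zero[OF less.prems] unfolding N1_def by auto
      have Tne: "T \<noteq> {\<zero>\<^bsub>M\<^esub>}" using T(3) simple_iff_submod[OF T(1)] by simp
      then obtain t where "t \<in> T" "t \<noteq> \<zero>\<^bsub>M\<^esub>" using submod_zero[OF T(1)] by blast
      then have "t \<in> N" "t \<notin> N1" using T(2) TN1 by auto
      then have "N1 \<subset> N" unfolding N1_def by blast
      then have "card N1 < card N" using finN psubset_card_mono by blast
      from less.hyps[OF this N1] obtain SS where SS: "finite SS"
        "\<And>T. T \<in> SS \<Longrightarrow> submodule T R M \<and> T \<subseteq> N1 \<and> simple_module R (submod T)" "uniquely_sums SS N1"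
        by blast
      have TSS: "T \<notin> SS" using SS(2)[of T] TN1 Tne by blast
      have "uniquely_sums (insert T SS) N"
      proof (rule uniquely_sums_insert[OF SS(1) _ SS(3) N1 T(1) TSS TN1])
        show "\<exists>t\<in>T. \<exists>y\<in>N1. x = t \<oplus>\<^bsub>M\<^esub> y" if x: "x \<in> N" for x
        proof -
          obtain a b where ab: "a \<in> T" "b \<in> C" "x = a \<oplus>\<^bsub>M\<^esub> b"
            using C(3) submod_in[OF less.prems x] by blast
          have mem: "a \<in> carrier M" "b \<in> carrier M" using ab submod_in T(1) C(1) by blast+
          have "x \<ominus>\<^bsub>M\<^esub> a \<in> N" using submod_minus[OF less.prems x] ab(1) T(2) by blast
          moreover have "x \<ominus>\<^bsub>M\<^esub> a = b" using neg_cancel(2)[OF mem] ab(3) by simp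
          ultimately show ?thesis using ab unfolding N1_def by blast
        qed
      qed (use SS(2) in auto)
      then show ?thesis
        using SS T N1_def by (intro exI[of _ "insert T SS"]) blast
    qed
  qed
  from this[OF carrier_is_submodule] obtain SS where SS: "finite SS"
    "\<forall>T\<in>SS. submodule T R M \<and> T \<subseteq> carrier M \<and> simple_module R (submod T)" "uniquely_sums SS (carrier M)"
    by blast
  show thesis
    by (rule that[of SS]) (use SS in \<open>auto simp: direct_sum_def uniquely_sums_def\<close>)
qed

section \<open>Endomorphisms of a direct sum\<close>

definition module_endo where
  "module_endo \<phi> \<longleftrightarrow> (\<forall>x\<in>carrier M. \<phi> x \<in> carrier M) \<and>
    (\<forall>x\<in>carrier M. \<forall>y\<in>carrier M. \<phi> (x \<oplus>\<^bsub>M\<^esub> y) = \<phi> x \<oplus>\<^bsub>M\<^esub> \<phi> y) \<and>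
    (\<forall>r\<in>carrier R. \<forall>x\<in>carrier M. \<phi> (r \<odot>\<^bsub>M\<^esub> x) = r \<odot>\<^bsub>M\<^esub> \<phi> x)"

definition components where
  "components SS x = (THE f. f \<in> (\<Pi>\<^sub>E N\<in>SS. N) \<and> x = finsum M f SS)"

lemma components:
  assumes "direct_sum R M SS" "x \<in> carrier M"
  shows "components SS x \<in> (\<Pi>\<^sub>E N\<in>SS. N)" "x = finsum M (components SS x) SS"
  using assms theI'[of "\<lambda>f. f \<in> (\<Pi>\<^sub>E N\<in>SS. N) \<and> x = finsum M f SS"]
  unfolding components_def direct_sum_def by auto

lemma components_eqI:
  assumes "direct_sum R M SS" "f \<in> (\<Pi>\<^sub>E N\<in>SS. N)" "x = finsum M f SS" "x \<in> carrier M"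
  shows "components SS x = f"
  unfolding components_def by (rule the1_equality) (use assms in \<open>auto simp: direct_sum_def\<close>)

lemma components_in: "direct_sum R M SS \<Longrightarrow> x \<in> carrier M \<Longrightarrow> N \<in> SS \<Longrightarrow> components SS x N \<in> N"
  using components(1) by blast

lemma components_carrier:
  assumes "direct_sum R M SS" "x \<in> carrier M" "N \<in> SS"
  shows "components SS x N \<in> carrier M"
  using components_in[OF assms] assms(1,3) submod_in[of N] by (simp add: direct_sum_def)

lemma components_add:
  assumes ds: "direct_sum R M SS" and x: "x \<in> carrier M" and y: "y \<in> carrier M" and N: "N \<in> SS"
  shows "components SS (x \<oplus>\<^bsub>M\<^esub> y) N = components SS x N \<oplus>\<^bsub>M\<^esub> components SS y N"
proof -
  have fin: "finite SS" and sm: "\<And>N. N \<in> SS \<Longrightarrow> submodule N R M"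
    using ds unfolding direct_sum_def by simp_all
  have "components SS (x \<oplus>\<^bsub>M\<^esub> y) = (\<lambda>N\<in>SS. components SS x N \<oplus>\<^bsub>M\<^esub> components SS y N)"
  proof (rule components_eqI[OF ds])
    show "(\<lambda>N\<in>SS. components SS x N \<oplus>\<^bsub>M\<^esub> components SS y N) \<in> (\<Pi>\<^sub>E N\<in>SS. N)"
      using submoduleE(5)[OF sm] components_in[OF ds x] components_in[OF ds y] by auto
    have "x \<oplus>\<^bsub>M\<^esub> y = finsum M (components SS x) SS \<oplus>\<^bsub>M\<^esub> finsum M (components SS y) SS"
      using components(2)[OF ds x] components(2)[OF ds y] by simp
    also have "\<dots> = (\<Oplus>\<^bsub>M\<^esub>N\<in>SS. components SS x N \<oplus>\<^bsub>M\<^esub> components SS y N)"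
      using components_carrier[OF ds x] components_carrier[OF ds y] by (intro M.finsum_addf[symmetric]) auto
    also have "\<dots> = finsum M (\<lambda>N\<in>SS. components SS x N \<oplus>\<^bsub>M\<^esub> components SS y N) SS"
      using components_carrier[OF ds x] components_carrier[OF ds y] by (intro M.finsum_cong') auto
    finally show "x \<oplus>\<^bsub>M\<^esub> y = finsum M (\<lambda>N\<in>SS. components SS x N \<oplus>\<^bsub>M\<^esub> components SS y N) SS" .
  qed (use x y in simp)
  then show ?thesis using N by simp
qed

lemma components_smult:
  assumes ds: "direct_sum R M SS" and x: "x \<in> carrier M" and r: "r \<in> carrier R" and N: "N \<in> SS"
  shows "components SS (r \<odot>\<^bsub>M\<^esub> x) N = r \<odot>\<^bsub>M\<^esub> components SS x N"
proof -
  have fin: "finite SS" and sm: "\<And>N. N \<in> SS \<Longrightarrow> submodule N R M"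
    using ds unfolding direct_sum_def by simp_all
  have "components SS (r \<odot>\<^bsub>M\<^esub> x) = (\<lambda>N\<in>SS. r \<odot>\<^bsub>M\<^esub> components SS x N)"
  proof (rule components_eqI[OF ds])
    show "(\<lambda>N\<in>SS. r \<odot>\<^bsub>M\<^esub> components SS x N) \<in> (\<Pi>\<^sub>E N\<in>SS. N)"
      using submoduleE(4)[OF sm r] components_in[OF ds x] by auto
    have "r \<odot>\<^bsub>M\<^esub> x = r \<odot>\<^bsub>M\<^esub> finsum M (components SS x) SS"
      using components(2)[OF ds x] by simp
    also have "\<dots> = (\<Oplus>\<^bsub>M\<^esub>N\<in>SS. r \<odot>\<^bsub>M\<^esub> components SS x N)"
      using components_carrier[OF ds x] fin r by (intro finsum_smult_ldistr) auto
    also have "\<dots> = finsum M (\<lambda>N\<in>SS. r \<odot>\<^bsub>M\<^esub> components SS x N) SS"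
      using components_carrier[OF ds x] r by (intro M.finsum_cong') auto
    finally show "r \<odot>\<^bsub>M\<^esub> x = finsum M (\<lambda>N\<in>SS. r \<odot>\<^bsub>M\<^esub> components SS x N) SS" .
  qed (use x r in simp)
  then show ?thesis using N by simp
qed

lemma components_summand:
  assumes ds: "direct_sum R M SS" and N: "N \<in> SS" and N': "N' \<in> SS" and x: "x \<in> N"
  shows "components SS x N' = (if N' = N then x else \<zero>\<^bsub>M\<^esub>)"
proof -
  have fin: "finite SS" and sm: "\<And>N. N \<in> SS \<Longrightarrow> submodule N R M"
    using ds unfolding direct_sum_def by simp_all
  have xM: "x \<in> carrier M" using submod_in[OF sm[OF N] x] .
  have "components SS x = (\<lambda>N'\<in>SS. if N = N' then x else \<zero>\<^bsub>M\<^esub>)"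
  proof (rule components_eqI[OF ds])
    show "(\<lambda>N'\<in>SS. if N = N' then x else \<zero>\<^bsub>M\<^esub>) \<in> (\<Pi>\<^sub>E N\<in>SS. N)"
      using submod_zero[OF sm] x by auto
    have "(\<Oplus>\<^bsub>M\<^esub>N'\<in>SS. if N = N' then x else \<zero>\<^bsub>M\<^esub>) = x"
      using M.finsum_singleton[OF N fin, of "\<lambda>_. x"] xM by auto
    moreover have "finsum M (\<lambda>N'\<in>SS. if N = N' then x else \<zero>\<^bsub>M\<^esub>) SS = (\<Oplus>\<^bsub>M\<^esub>N'\<in>SS. if N = N' then x else \<zero>\<^bsub>M\<^esub>)"
      using xM by (intro M.finsum_cong') auto
    ultimately show "x = finsum M (\<lambda>N'\<in>SS. if N = N' then x else \<zero>\<^bsub>M\<^esub>) SS" by simp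
  qed (rule xM)
  then show ?thesis using N' by auto
qed

text \<open>e is the isomorphism from N to N' extended by zero on the other summands, f likewise its
  inverse, and h the projection to N' minus the one to N. The relations are [e,f] = h, [h,e] = 2e
  and [f,h] = 2f, written without subtraction because they are later read in a multiplicative
  group.\<close>

lemma sl2_endos:
  assumes ds: "direct_sum R M SS" and N: "N \<in> SS" "N' \<in> SS" "N \<noteq> N'" "N \<noteq> {\<zero>\<^bsub>M\<^esub>}"
    and iso: "module_isomorphic R (submod N) (submod N')"
  obtains e f h where "module_endo e" "module_endo f" "module_endo h"
    "\<And>x. x \<in> carrier M \<Longrightarrow> e (f x) = h x \<oplus>\<^bsub>M\<^esub> f (e x)"
    "\<And>x. x \<in> carrier M \<Longrightarrow> h (e x) = (e x \<oplus>\<^bsub>M\<^esub> e x) \<oplus>\<^bsub>M\<^esub> e (h x)"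
    "\<And>x. x \<in> carrier M \<Longrightarrow> f (h x) = (f x \<oplus>\<^bsub>M\<^esub> f x) \<oplus>\<^bsub>M\<^esub> h (f x)"
    "\<exists>x\<in>carrier M. e x \<noteq> \<zero>\<^bsub>M\<^esub>"
proof -
  have sm: "submodule N R M" "submodule N' R M" using ds N unfolding direct_sum_def by simp_all
  obtain g where g: "bij_betw g N N'" "\<And>x y. x \<in> N \<Longrightarrow> y \<in> N \<Longrightarrow> g (x \<oplus>\<^bsub>M\<^esub> y) = g x \<oplus>\<^bsub>M\<^esub> g y"
    "\<And>r x. r \<in> carrier R \<Longrightarrow> x \<in> N \<Longrightarrow> g (r \<odot>\<^bsub>M\<^esub> x) = r \<odot>\<^bsub>M\<^esub> g x"
    using iso unfolding module_isomorphic_def by auto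
  define k where "k = inv_into N g"
  have gN: "g x \<in> N'" if "x \<in> N" for x using g(1) that bij_betwE by blast
  have kN: "k y \<in> N" if "y \<in> N'" for y unfolding k_def using g(1) that by (intro inv_into_into) (simp add: bij_betw_def)
  have gk: "g (k y) = y" if "y \<in> N'" for y unfolding k_def using bij_betw_inv_into_right[OF g(1) that] .
  have kg: "k (g x) = x" if "x \<in> N" for x unfolding k_def using bij_betw_inv_into_left[OF g(1) that] .
  have k_add: "k (x \<oplus>\<^bsub>M\<^esub> y) = k x \<oplus>\<^bsub>M\<^esub> k y" if "x \<in> N'" "y \<in> N'" for x y
    using g(2)[OF kN[OF that(1)] kN[OF that(2)]] kg[OF submoduleE(5)[OF sm(1) kN[OF that(1)] kN[OF that(2)]]]
      gk that by simp
  have k_smult: "k (r \<odot>\<^bsub>M\<^esub> x) = r \<odot>\<^bsub>M\<^esub> k x" if "r \<in> carrier R" "x \<in> N'" for r x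
    using g(3)[OF that(1) kN[OF that(2)]] kg[OF submoduleE(4)[OF sm(1) that(1) kN[OF that(2)]]]
      gk that by simp
  have gz: "g \<zero>\<^bsub>M\<^esub> = \<zero>\<^bsub>M\<^esub>"
    using g(3)[OF R.zero_closed submod_zero[OF sm(1)]] gN[OF submod_zero[OF sm(1)]] submod_in[OF sm(2)] by simp
  have kz: "k \<zero>\<^bsub>M\<^esub> = \<zero>\<^bsub>M\<^esub>" using kg[OF submod_zero[OF sm(1)]] gz by simp
  define a where "a x = components SS x N" for x
  define b where "b x = components SS x N'" for x
  have a: "a x \<in> N" "a x \<in> carrier M" if "x \<in> carrier M" for x
    unfolding a_def using components_in[OF ds that N(1)] submod_in[OF sm(1)] by simp_all
  have b: "b x \<in> N'" "b x \<in> carrier M" if "x \<in> carrier M" for x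
    unfolding b_def using components_in[OF ds that N(2)] submod_in[OF sm(2)] by simp_all
  have ab_N: "a x = x" "b x = \<zero>\<^bsub>M\<^esub>" if "x \<in> N" for x
    unfolding a_def b_def using components_summand[OF ds N(1) _ that] N by auto
  have ab_N': "a x = \<zero>\<^bsub>M\<^esub>" "b x = x" if "x \<in> N'" for x
    unfolding a_def b_def using components_summand[OF ds N(2) _ that] N by auto
  have a_lin: "a (x \<oplus>\<^bsub>M\<^esub> y) = a x \<oplus>\<^bsub>M\<^esub> a y" "b (x \<oplus>\<^bsub>M\<^esub> y) = b x \<oplus>\<^bsub>M\<^esub> b y"
    if "x \<in> carrier M" "y \<in> carrier M" for x y
    unfolding a_def b_def using components_add[OF ds that] N by auto
  have a_smult: "a (r \<odot>\<^bsub>M\<^esub> x) = r \<odot>\<^bsub>M\<^esub> a x" "b (r \<odot>\<^bsub>M\<^esub> x) = r \<odot>\<^bsub>M\<^esub> b x"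
    if "x \<in> carrier M" "r \<in> carrier R" for x r
    unfolding a_def b_def using components_smult[OF ds that] N by auto
  have gM: "g x \<in> carrier M" if "x \<in> N" for x using gN[OF that] submod_in[OF sm(2)] by simp
  have kM: "k x \<in> carrier M" if "x \<in> N'" for x using kN[OF that] submod_in[OF sm(1)] by simp
  have NM: "x \<in> carrier M" if "x \<in> N" for x using that submod_in[OF sm(1)] by simp
  have N'M: "x \<in> carrier M" if "x \<in> N'" for x using that submod_in[OF sm(2)] by simp
  define e where "e x = g (a x)" for x
  define f where "f x = k (b x)" for x
  define h where "h x = b x \<ominus>\<^bsub>M\<^esub> a x" for x
  have aM: "\<ominus>\<^bsub>M\<^esub> x \<in> carrier M" "a (\<ominus>\<^bsub>M\<^esub> x) = \<ominus>\<^bsub>M\<^esub> a x" "b (\<ominus>\<^bsub>M\<^esub> x) = \<ominus>\<^bsub>M\<^esub> b x" if "x \<in> carrier M" for x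
  proof -
    show neg: "\<ominus>\<^bsub>M\<^esub> x \<in> carrier M" using that by simp
    have "a \<zero>\<^bsub>M\<^esub> = \<zero>\<^bsub>M\<^esub>" "b \<zero>\<^bsub>M\<^esub> = \<zero>\<^bsub>M\<^esub>" using ab_N submod_zero[OF sm(1)] by simp_all
    then show "a (\<ominus>\<^bsub>M\<^esub> x) = \<ominus>\<^bsub>M\<^esub> a x" "b (\<ominus>\<^bsub>M\<^esub> x) = \<ominus>\<^bsub>M\<^esub> b x"
      using a_lin[OF neg that] that a b neg M.minus_equality by (simp_all add: M.l_neg)
  qed
  have neg_N: "\<ominus>\<^bsub>M\<^esub> x \<in> N" "g (\<ominus>\<^bsub>M\<^esub> x) = \<ominus>\<^bsub>M\<^esub> g x" if "x \<in> N" for x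
  proof -
    show n: "\<ominus>\<^bsub>M\<^esub> x \<in> N" using submoduleE(3)[OF sm(1) that] .
    show "g (\<ominus>\<^bsub>M\<^esub> x) = \<ominus>\<^bsub>M\<^esub> g x"
      using g(2)[OF n that] gz gM[OF n] gM[OF that] NM[OF that] M.minus_equality by (simp add: M.l_neg)
  qed
  show thesis
  proof (rule that[of e f h])
    show "module_endo e" unfolding module_endo_def e_def
      using a a_lin a_smult g gM by auto
    show "module_endo f" unfolding module_endo_def f_def
      using b a_lin a_smult k_add k_smult kM by auto
    show "module_endo h" unfolding module_endo_def h_def
      using a b a_lin a_smult
      by (auto simp: a_minus_def M.minus_add M.a_ac smult_r_distr smult_r_minus)
    fix x assume x: "x \<in> carrier M"
    have mem: "a x \<in> N" "b x \<in> N'" "g (a x) \<in> N'" "k (b x) \<in> N"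
      using a[OF x] b[OF x] gN kN by auto
    have mem': "a x \<in> carrier M" "b x \<in> carrier M" "g (a x) \<in> carrier M" "k (b x) \<in> carrier M"
      using a[OF x] b[OF x] gM kM mem by auto
    show "e (f x) = h x \<oplus>\<^bsub>M\<^esub> f (e x)"
      using mem mem' by (simp add: e_def f_def h_def ab_N ab_N' gk kg a_minus_def M.a_assoc M.l_neg)
    have ah: "a (h x) = \<ominus>\<^bsub>M\<^esub> a x" "b (h x) = b x"
      using mem mem' by (simp_all add: h_def a_minus_def a_lin aM ab_N ab_N')
    show "h (e x) = (e x \<oplus>\<^bsub>M\<^esub> e x) \<oplus>\<^bsub>M\<^esub> e (h x)"
      using mem mem' ah by (simp add: e_def neg_N M.a_assoc M.r_neg) (simp add: h_def ab_N' a_minus_def)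
    have "h (f x) = \<ominus>\<^bsub>M\<^esub> f x"
      using mem mem' by (simp add: f_def h_def ab_N a_minus_def)
    then show "f (h x) = (f x \<oplus>\<^bsub>M\<^esub> f x) \<oplus>\<^bsub>M\<^esub> h (f x)"
      using mem mem' ah by (simp add: f_def M.a_assoc M.r_neg)
  next
    obtain x where x: "x \<in> N" "x \<noteq> \<zero>\<^bsub>M\<^esub>" using N(4) submod_zero[OF sm(1)] by blast
    have "e x \<noteq> \<zero>\<^bsub>M\<^esub>"
    proof
      assume "e x = \<zero>\<^bsub>M\<^esub>"
      then have "k (g x) = \<zero>\<^bsub>M\<^esub>" using x kz by (simp add: e_def ab_N)
      then show False using x kg by simp
    qed
    then show "\<exists>x\<in>carrier M. e x \<noteq> \<zero>\<^bsub>M\<^esub>" using x NM by blast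
  qed
qed

end

section \<open>Group rings over the prime field\<close>

lemma (in comm_monoid) finprod_swap:
  assumes "finite I" "finite J" "\<And>i j. i \<in> I \<Longrightarrow> j \<in> J \<Longrightarrow> f i j \<in> carrier G"
  shows "(\<Otimes>i\<in>I. \<Otimes>j\<in>J. f i j) = (\<Otimes>j\<in>J. \<Otimes>i\<in>I. f i j)"
  using assms(1,3)
proof (induction I)
  case empty
  then show ?case by simp
next
  case (insert i I)
  have mem: "f k \<in> J \<rightarrow> carrier G" if "k \<in> insert i I" for k using insert.prems that by auto
  have mem': "(\<lambda>k. f k j) \<in> insert i I \<rightarrow> carrier G" if "j \<in> J" for j using insert.prems that by auto
  have "(\<Otimes>k\<in>insert i I. \<Otimes>j\<in>J. f k j) = (\<Otimes>j\<in>J. f i j) \<otimes> (\<Otimes>k\<in>I. \<Otimes>j\<in>J. f k j)"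
    using insert.hyps mem by (intro finprod_insert) auto
  also have "\<dots> = (\<Otimes>j\<in>J. f i j) \<otimes> (\<Otimes>j\<in>J. \<Otimes>k\<in>I. f k j)"
    using insert by simp
  also have "\<dots> = (\<Otimes>j\<in>J. f i j \<otimes> (\<Otimes>k\<in>I. f k j))"
    using mem mem' by (intro finprod_multf[symmetric]) auto
  also have "\<dots> = (\<Otimes>j\<in>J. \<Otimes>k\<in>insert i I. f k j)"
    using insert.hyps mem' by (intro finprod_cong') auto
  finally show ?case .
qed

lemma (in comm_monoid) finprod_hom:
  assumes \<phi>: "\<And>x. x \<in> carrier G \<Longrightarrow> \<phi> x \<in> carrier G"
    "\<And>x y. x \<in> carrier G \<Longrightarrow> y \<in> carrier G \<Longrightarrow> \<phi> (x \<otimes> y) = \<phi> x \<otimes> \<phi> y" "\<phi> \<one> = \<one>"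
    and f: "finite I" "\<And>i. i \<in> I \<Longrightarrow> f i \<in> carrier G"
  shows "\<phi> (\<Otimes>i\<in>I. f i) = (\<Otimes>i\<in>I. \<phi> (f i))"
  using f
proof (induction I)
  case (insert i I)
  then have "f \<in> I \<rightarrow> carrier G" "f i \<in> carrier G" "(\<lambda>i. \<phi> (f i)) \<in> I \<rightarrow> carrier G" using \<phi> by auto
  then show ?case using insert \<phi> by simp
qed (simp add: \<phi>)

lemma of_int_mod_char:
  assumes "CHAR('k::field) = p"
  shows "(of_int (i mod int p) :: 'k) = of_int i"
proof -
  have "(of_int i :: 'k) = of_int (int p * (i div int p) + i mod int p)" by simp
  also have "\<dots> = of_nat p * of_int (i div int p) + of_int (i mod int p)"
    unfolding of_int_add of_int_mult of_int_of_nat_eq ..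
  also have "(of_nat p :: 'k) = 0" using assms by (simp add: of_nat_eq_0_iff_char_dvd)
  finally show ?thesis by simp
qed

lemma of_int_inj_char:
  assumes "CHAR('k::field) = p" "i \<in> {0..int p - 1}" "j \<in> {0..int p - 1}" "(of_int i :: 'k) = of_int j"
  shows "i = j"
proof -
  have "(of_nat (nat i) :: 'k) = of_nat (nat j)" using assms by simp
  then have "[nat i = nat j] (mod p)" using assms(1) of_nat_eq_iff_cong_CHAR by blast
  moreover have "nat i < p" "nat j < p" using assms(2,3) by auto
  ultimately have "nat i = nat j" by (simp add: cong_def)
  then show ?thesis using assms(2,3) eq_nat_nat_iff[of i j] by simp
qed

lemma finsum_residue_ring:
  assumes p: "p > 1" and "finite I" "f \<in> I \<rightarrow> {0..int p - 1}"
  shows "finsum (residue_ring (int p)) f I = (\<Sum>i\<in>I. f i) mod int p"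
proof -
  have "residues (int p)" using p by (simp add: residues_def)
  then interpret Z: cring "residue_ring (int p)" by (rule residues.cring)
  show ?thesis using assms(2,3)
  proof (induction I)
    case empty
    have "\<zero>\<^bsub>residue_ring (int p)\<^esub> = 0" by (simp add: residue_ring_def)
    then show ?case by simp
  next
    case (insert i I)
    have mem: "f \<in> I \<rightarrow> carrier (residue_ring (int p))" "f i \<in> carrier (residue_ring (int p))"
      using insert by (auto simp: residue_ring_def)
    have "finsum (residue_ring (int p)) f (insert i I) = (f i + finsum (residue_ring (int p)) f I) mod int p"
      using Z.finsum_insert[OF insert.hyps(1,2) mem] by (simp add: residue_ring_def)
    then show ?case using insert by (simp add: mod_simps)
  qed
qed

lemma group_ring_simps:
  fixes H (structure)
  assumes p: "p > 1" and fin: "finite (carrier H)"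
  defines "R \<equiv> group_ring (residue_ring (int p)) H"
  shows "carrier R = carrier H \<rightarrow>\<^sub>E {0..int p - 1}"
    "a \<oplus>\<^bsub>R\<^esub> b = (\<lambda>g\<in>carrier H. (a g + b g) mod int p)"
    "\<zero>\<^bsub>R\<^esub> = (\<lambda>g\<in>carrier H. 0)" "\<one>\<^bsub>R\<^esub> = (\<lambda>g\<in>carrier H. if g = \<one> then 1 else 0)"
    "a \<otimes>\<^bsub>R\<^esub> b = (\<lambda>g\<in>carrier H. (\<Sum>(x, y)\<in>{(x, y). x \<in> carrier H \<and> y \<in> carrier H \<and> x \<otimes> y = g}. a x * b y) mod int p)"
proof -
  have "finite {(x, y). x \<in> carrier H \<and> y \<in> carrier H \<and> x \<otimes> y = g}" for g
    by (rule finite_subset[of _ "carrier H \<times> carrier H"]) (use fin in auto)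
  then have "finsum (residue_ring (int p)) (\<lambda>(x, y). a x \<otimes>\<^bsub>residue_ring (int p)\<^esub> b y)
      {(x, y). x \<in> carrier H \<and> y \<in> carrier H \<and> x \<otimes> y = g}
    = (\<Sum>(x, y)\<in>{(x, y). x \<in> carrier H \<and> y \<in> carrier H \<and> x \<otimes> y = g}. a x * b y) mod int p" for g
    using p by (subst finsum_residue_ring[OF p])
      (auto simp: residue_ring_def case_prod_unfold mod_sum_eq)
  then show "a \<otimes>\<^bsub>R\<^esub> b = (\<lambda>g\<in>carrier H. (\<Sum>(x, y)\<in>{(x, y). x \<in> carrier H \<and> y \<in> carrier H \<and> x \<otimes> y = g}. a x * b y) mod int p)"
    by (simp add: R_def group_ring_def)
qed (auto simp: R_def group_ring_def residue_ring_def fun_eq_iff)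

text \<open>The ring axioms of \<open>\<bbbF>\<^sub>pH\<close> are inherited from the (untwisted) group algebra \<open>kH\<close>, into which
  it embeds.\<close>
lemma group_ring_cring:
  fixes H (structure)
  assumes prime: "Factorial_Ring.prime p" and char: "CHAR('k::field) = p"
    and H: "comm_group H" and fin: "finite (carrier H)"
  shows "cring (group_ring (residue_ring (int p)) H)"
proof -
  interpret H: comm_group H by (rule H)
  interpret K: twisted_algebra H "\<lambda>_ _. 1 :: 'k"
    by unfold_locales (use fin in \<open>auto simp: two_cocycle_def\<close>)
  have p: "p > 1" using prime by (rule prime_gt_1_nat)
  let ?R = "group_ring (residue_ring (int p)) H"
  note R = group_ring_simps[OF p fin]
  define em where "em a = (\<lambda>g. if g \<in> carrier H then of_int (a g) else (0 :: 'k))" for a :: "'a \<Rightarrow> int"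
  have em_add: "em (a \<oplus>\<^bsub>?R\<^esub> b) = em a + em b" for a b
    by (auto simp: em_def R of_int_mod_char[OF char] fun_eq_iff fun_apply)
  have em_mult: "em (a \<otimes>\<^bsub>?R\<^esub> b) = K.star (em a) (em b)" for a b
  proof (rule ext)
    fix g
    have "(em a \<otimes>\<^bsub>K.A\<^esub> em b) g
      = (\<Sum>(x, y)\<in>{(x, y). x \<in> carrier H \<and> y \<in> carrier H \<and> x \<otimes> y = g}. of_int (a x * b y))"
      unfolding twisted_group_algebra_def by (auto simp: em_def intro!: sum.cong)
    also have "\<dots> = (em (a \<otimes>\<^bsub>?R\<^esub> b)) g"
    proof (cases "g \<in> carrier H")
      case True
      then show ?thesis by (simp add: em_def R of_int_mod_char[OF char] case_prod_unfold)
    next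
      case False
      then have empty: "{(x, y). x \<in> carrier H \<and> y \<in> carrier H \<and> x \<otimes> y = g} = {}" by auto
      show ?thesis unfolding empty using False by (simp add: em_def)
    qed
    finally show "em (a \<otimes>\<^bsub>?R\<^esub> b) g = K.star (em a) (em b) g" by (simp add: K.A_mult)
  qed
  have em_one: "em \<one>\<^bsub>?R\<^esub> = \<one>\<^bsub>K.A\<^esub>"
    by (auto simp: em_def R K.A_one delta_def fun_eq_iff fun_apply)
  have em_A: "em a \<in> carrier K.A" for a by (simp add: em_def K.A_carrier)
  have inj: "a = b" if "a \<in> carrier ?R" "b \<in> carrier ?R" "em a = em b" for a b
  proof (rule extensionalityI[of _ "carrier H"])
    fix g assume g: "g \<in> carrier H"
    have "a g \<in> {0..int p - 1}" "b g \<in> {0..int p - 1}" using that g unfolding R by auto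
    moreover have "(of_int (a g) :: 'k) = of_int (b g)"
      using fun_cong[OF that(3), of g] g by (simp add: em_def)
    ultimately show "a g = b g" by (rule of_int_inj_char[OF char])
  qed (use that in \<open>auto simp: R PiE_def\<close>)
  have closed: "a \<oplus>\<^bsub>?R\<^esub> b \<in> carrier ?R" "a \<otimes>\<^bsub>?R\<^esub> b \<in> carrier ?R" "\<one>\<^bsub>?R\<^esub> \<in> carrier ?R" "\<zero>\<^bsub>?R\<^esub> \<in> carrier ?R" for a b
    unfolding R using p by (auto simp: zless_imp_add1_zle)
  have em_zero: "em \<zero>\<^bsub>?R\<^esub> = 0" by (auto simp: em_def R fun_eq_iff fun_apply)
  have star_comm: "K.star a b = K.star b a" for a b
  proof (rule ext)
    fix g show "K.star a b g = K.star b a g"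
    proof (cases "g \<in> carrier H")
      case True
      then have "K.star a b g = (\<Sum>x\<in>carrier H. a x * b (inv x \<otimes> g))" by (simp add: K.star_def)
      also have "\<dots> = (\<Sum>x\<in>carrier H. b x * a (inv x \<otimes> g))"
        using True by (intro sum.reindex_bij_witness[of _ "\<lambda>x. inv x \<otimes> g" "\<lambda>x. inv x \<otimes> g"])
          (simp_all add: H.inv_mult H.m_assoc H.m_comm[of g] H.inv_mult_group K.inv_mult_cancel)
      finally show ?thesis using True by (simp add: K.star_def)
    qed (simp add: K.star_def)
  qed
  show ?thesis
  proof (rule cringI)
    show "abelian_group ?R"
    proof (rule abelian_groupI)
      fix x assume x: "x \<in> carrier ?R"
      define y where "y = (\<lambda>g\<in>carrier H. (- x g) mod int p)"
      have "y \<in> carrier ?R" unfolding R y_def using p by (auto simp: zless_imp_add1_zle)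
      moreover have "em (y \<oplus>\<^bsub>?R\<^esub> x) = em \<zero>\<^bsub>?R\<^esub>"
        unfolding em_add em_zero
        by (auto simp: em_def y_def of_int_mod_char[OF char] fun_eq_iff fun_apply)
      ultimately show "\<exists>y\<in>carrier ?R. y \<oplus>\<^bsub>?R\<^esub> x = \<zero>\<^bsub>?R\<^esub>"
        using inj closed by blast
    next
      show "x \<oplus>\<^bsub>?R\<^esub> y = y \<oplus>\<^bsub>?R\<^esub> x" for x y
        by (intro inj closed) (simp add: em_add add.commute)
      show "x \<oplus>\<^bsub>?R\<^esub> y \<oplus>\<^bsub>?R\<^esub> z = x \<oplus>\<^bsub>?R\<^esub> (y \<oplus>\<^bsub>?R\<^esub> z)" for x y z
        by (intro inj closed) (simp add: em_add add.assoc)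
      show "\<zero>\<^bsub>?R\<^esub> \<oplus>\<^bsub>?R\<^esub> x = x" if "x \<in> carrier ?R" for x
        by (intro inj closed that) (simp add: em_add em_zero)
    qed (use closed in auto)
    show "Group.comm_monoid ?R"
    proof (rule comm_monoidI)
      show "x \<otimes>\<^bsub>?R\<^esub> y = y \<otimes>\<^bsub>?R\<^esub> x" for x y
        by (intro inj closed) (simp only: em_mult star_comm[of "em x"])
      show "x \<otimes>\<^bsub>?R\<^esub> y \<otimes>\<^bsub>?R\<^esub> z = x \<otimes>\<^bsub>?R\<^esub> (y \<otimes>\<^bsub>?R\<^esub> z)" for x y z
        by (intro inj closed) (simp add: em_mult K.star_assoc)
      show "\<one>\<^bsub>?R\<^esub> \<otimes>\<^bsub>?R\<^esub> x = x" if "x \<in> carrier ?R" for x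
        by (intro inj closed that) (simp add: em_mult em_one em_A)
    qed (use closed in auto)
    show "(x \<oplus>\<^bsub>?R\<^esub> y) \<otimes>\<^bsub>?R\<^esub> z = x \<otimes>\<^bsub>?R\<^esub> z \<oplus>\<^bsub>?R\<^esub> y \<otimes>\<^bsub>?R\<^esub> z" for x y z
      by (intro inj closed) (simp add: em_mult em_add K.star_add_left)
  qed
qed

section \<open>Elementary abelian p-groups with a group action\<close>

locale fp_action = comm_group G + H: comm_group H
  for G :: "('b, 'm) monoid_scheme" (structure) and H :: "('e, 'n) monoid_scheme" +
  fixes act :: "'e \<Rightarrow> 'b \<Rightarrow> 'b" and p :: nat
  assumes prime_p: "Factorial_Ring.prime p" and fin_G: "finite (carrier G)" and fin_H: "finite (carrier H)"
    and exp_p: "x \<in> carrier G \<Longrightarrow> x [^] p = \<one>"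
    and act_closed [simp]: "e \<in> carrier H \<Longrightarrow> x \<in> carrier G \<Longrightarrow> act e x \<in> carrier G"
    and act_mult [simp]: "e \<in> carrier H \<Longrightarrow> x \<in> carrier G \<Longrightarrow> y \<in> carrier G \<Longrightarrow> act e (x \<otimes> y) = act e x \<otimes> act e y"
    and act_act: "e \<in> carrier H \<Longrightarrow> f \<in> carrier H \<Longrightarrow> x \<in> carrier G \<Longrightarrow> act (e \<otimes>\<^bsub>H\<^esub> f) x = act e (act f x)"
    and act_id [simp]: "x \<in> carrier G \<Longrightarrow> act \<one>\<^bsub>H\<^esub> x = x"
    and coprime_H: "coprime (card (carrier H)) p"
begin

abbreviation "R \<equiv> group_ring (residue_ring (int p)) H"

text \<open>Two fields are \<open>undefined\<close> so that the record coincides literally with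
  \<open>frattini_quotient\<close>.\<close>

definition fpM :: "('e \<Rightarrow> int, 'b) module" where
  "fpM = \<lparr>carrier = carrier G, monoid.mult = undefined, one = undefined, ring.zero = \<one>, add = (\<otimes>),
    module.smult = (\<lambda>r x. \<Otimes>e\<in>carrier H. act e x [^] r e)\<rparr>"

lemma p_gt_1: "p > 1"
  using prime_p by (rule prime_gt_1_nat)

lemma pow_mod_p: "x \<in> carrier G \<Longrightarrow> x [^] (i mod int p) = x [^] (i :: int)"
proof -
  assume x: "x \<in> carrier G"
  have "x [^] i = x [^] (int p * (i div int p) + i mod int p)" by simp
  also have "\<dots> = (x [^] int p) [^] (i div int p) \<otimes> x [^] (i mod int p)"
    using x by (simp only: int_pow_mult int_pow_pow int_pow_closed)
  also have "x [^] int p = \<one>" using exp_p[OF x] by (simp add: int_pow_int)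
  finally show ?thesis using x by simp
qed

lemma act_one [simp]: "e \<in> carrier H \<Longrightarrow> act e \<one> = \<one>"
  using act_mult[of e \<one> \<one>] by (metis act_closed l_cancel_one one_closed r_one)

lemma act_hom: "e \<in> carrier H \<Longrightarrow> act e \<in> hom G G"
  by (auto simp: hom_def)

lemma act_pow: "e \<in> carrier H \<Longrightarrow> x \<in> carrier G \<Longrightarrow> act e (x [^] (i :: int)) = act e x [^] i"
  using hom_int_pow[of "act e" G G x i] act_hom is_group by simp

lemma fpM_simps: "carrier fpM = carrier G" "\<zero>\<^bsub>fpM\<^esub> = \<one>" "x \<oplus>\<^bsub>fpM\<^esub> y = x \<otimes> y"
  "r \<odot>\<^bsub>fpM\<^esub> x = (\<Otimes>e\<in>carrier H. act e x [^] r e)"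
  by (simp_all add: fpM_def)

lemma R_carrier: "carrier R = carrier H \<rightarrow>\<^sub>E {0..int p - 1}"
  and R_add: "e \<in> carrier H \<Longrightarrow> (a \<oplus>\<^bsub>R\<^esub> b) e = (a e + b e) mod int p"
  and R_one: "e \<in> carrier H \<Longrightarrow> \<one>\<^bsub>R\<^esub> e = (if e = \<one>\<^bsub>H\<^esub> then 1 else 0)"
  by (simp_all add: group_ring_simps[OF p_gt_1 fin_H])

lemma R_mult:
  assumes "g \<in> carrier H"
  shows "(a \<otimes>\<^bsub>R\<^esub> b) g = (\<Sum>x\<in>carrier H. a x * b (inv\<^bsub>H\<^esub> x \<otimes>\<^bsub>H\<^esub> g)) mod int p"
proof -
  have "(\<Sum>(x, y)\<in>{(x, y). x \<in> carrier H \<and> y \<in> carrier H \<and> x \<otimes>\<^bsub>H\<^esub> y = g}. a x * b y)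
      = (\<Sum>x\<in>carrier H. a x * b (inv\<^bsub>H\<^esub> x \<otimes>\<^bsub>H\<^esub> g))"
    using assms by (intro sum.reindex_bij_witness[of _ "\<lambda>x. (x, inv\<^bsub>H\<^esub> x \<otimes>\<^bsub>H\<^esub> g)" fst])
      (auto simp: H.m_assoc[symmetric])
  then show ?thesis using assms by (simp add: group_ring_simps[OF p_gt_1 fin_H])
qed

lemma finprod_pow:
  "finite I \<Longrightarrow> x \<in> carrier G \<Longrightarrow> (\<Otimes>i\<in>I. x [^] (f i :: int)) = x [^] (\<Sum>i\<in>I. f i)"
proof (induction I rule: finite_induct)
  case (insert i I)
  then have "(\<lambda>i. x [^] f i) \<in> I \<rightarrow> carrier G" by auto
  then show ?case using insert by (simp add: int_pow_mult)
qed simp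

lemma fpM_module:
  assumes R: "cring R"
  shows "module R fpM"
proof (rule moduleI)
  show "cring R" by (rule R)
  show "abelian_group fpM"
    by (rule abelian_groupI) (auto simp: fpM_simps m_ac intro!: bexI[of _ "inv _"])
  show smc: "r \<odot>\<^bsub>fpM\<^esub> x \<in> carrier fpM" if "r \<in> carrier R" "x \<in> carrier fpM" for r x
    using that by (auto simp: fpM_simps)
  show "(a \<oplus>\<^bsub>R\<^esub> b) \<odot>\<^bsub>fpM\<^esub> x = a \<odot>\<^bsub>fpM\<^esub> x \<oplus>\<^bsub>fpM\<^esub> b \<odot>\<^bsub>fpM\<^esub> x"
    if "x \<in> carrier fpM" for a b x
  proof -
    have "(a \<oplus>\<^bsub>R\<^esub> b) \<odot>\<^bsub>fpM\<^esub> x = (\<Otimes>e\<in>carrier H. act e x [^] a e \<otimes> act e x [^] b e)"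
      using that unfolding fpM_simps
      by (intro finprod_cong') (auto simp: R_add pow_mod_p int_pow_mult)
    also have "\<dots> = a \<odot>\<^bsub>fpM\<^esub> x \<oplus>\<^bsub>fpM\<^esub> b \<odot>\<^bsub>fpM\<^esub> x"
      using that unfolding fpM_simps by (intro finprod_multf) auto
    finally show ?thesis .
  qed
  show "a \<odot>\<^bsub>fpM\<^esub> (x \<oplus>\<^bsub>fpM\<^esub> y) = a \<odot>\<^bsub>fpM\<^esub> x \<oplus>\<^bsub>fpM\<^esub> a \<odot>\<^bsub>fpM\<^esub> y"
    if "x \<in> carrier fpM" "y \<in> carrier fpM" for a x y
  proof -
    have "a \<odot>\<^bsub>fpM\<^esub> (x \<oplus>\<^bsub>fpM\<^esub> y) = (\<Otimes>e\<in>carrier H. act e x [^] a e \<otimes> act e y [^] a e)"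
      using that unfolding fpM_simps
      by (intro finprod_cong') (auto simp: int_pow_distrib)
    also have "\<dots> = a \<odot>\<^bsub>fpM\<^esub> x \<oplus>\<^bsub>fpM\<^esub> a \<odot>\<^bsub>fpM\<^esub> y"
      using that unfolding fpM_simps by (intro finprod_multf) auto
    finally show ?thesis .
  qed
  show "(a \<otimes>\<^bsub>R\<^esub> b) \<odot>\<^bsub>fpM\<^esub> x = a \<odot>\<^bsub>fpM\<^esub> (b \<odot>\<^bsub>fpM\<^esub> x)"
    if "x \<in> carrier fpM" for a b x
  proof -
    have x: "x \<in> carrier G" using that by (simp add: fpM_simps)
    have "(a \<otimes>\<^bsub>R\<^esub> b) \<odot>\<^bsub>fpM\<^esub> x
      = (\<Otimes>g\<in>carrier H. \<Otimes>y\<in>carrier H. act g x [^] (a y * b (inv\<^bsub>H\<^esub> y \<otimes>\<^bsub>H\<^esub> g)))"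
      using x fin_H unfolding fpM_simps
      by (intro finprod_cong') (auto simp: R_mult pow_mod_p finprod_pow)
    also have "\<dots> = (\<Otimes>y\<in>carrier H. \<Otimes>g\<in>carrier H. act g x [^] (a y * b (inv\<^bsub>H\<^esub> y \<otimes>\<^bsub>H\<^esub> g)))"
      using x fin_H by (intro finprod_swap) auto
    also have "\<dots> = (\<Otimes>y\<in>carrier H. act y (\<Otimes>z\<in>carrier H. act z x [^] b z) [^] a y)"
    proof (rule finprod_cong')
      \<comment> \<open>Translate the inner index, g = y z; the action of y then comes out of the
        product.\<close>
      fix y assume y: "y \<in> carrier H"
      have bij: "(\<lambda>z. y \<otimes>\<^bsub>H\<^esub> z) ` carrier H = carrier H" "inj_on (\<lambda>z. y \<otimes>\<^bsub>H\<^esub> z) (carrier H)"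
        using H.surj_const_mult[OF y] H.inj_on_cmult[OF y] by auto
      have "(\<Otimes>g\<in>carrier H. act g x [^] (a y * b (inv\<^bsub>H\<^esub> y \<otimes>\<^bsub>H\<^esub> g)))
        = (\<Otimes>g\<in>(\<lambda>z. y \<otimes>\<^bsub>H\<^esub> z) ` carrier H. act g x [^] (a y * b (inv\<^bsub>H\<^esub> y \<otimes>\<^bsub>H\<^esub> g)))"
        by (simp only: bij)
      also have "\<dots> = (\<Otimes>z\<in>carrier H. act (y \<otimes>\<^bsub>H\<^esub> z) x [^] (a y * b (inv\<^bsub>H\<^esub> y \<otimes>\<^bsub>H\<^esub> (y \<otimes>\<^bsub>H\<^esub> z))))"
        using x y bij by (intro finprod_reindex) auto
      also have "\<dots> = (\<Otimes>z\<in>carrier H. act y (act z x [^] b z) [^] a y)"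
        using x y by (intro finprod_cong')
          (auto simp: act_act act_pow int_pow_pow mult.commute H.m_assoc[symmetric])
      also have "\<dots> = (act y (\<Otimes>z\<in>carrier H. act z x [^] b z)) [^] a y"
        using x y fin_H by (intro finprod_hom[symmetric, where \<phi> = "\<lambda>u. act y u [^] a y"])
          (auto simp: int_pow_distrib)
      finally show "(\<Otimes>g\<in>carrier H. act g x [^] (a y * b (inv\<^bsub>H\<^esub> y \<otimes>\<^bsub>H\<^esub> g)))
        = act y (\<Otimes>z\<in>carrier H. act z x [^] b z) [^] a y" .
    qed (use x in auto)
    finally show ?thesis by (simp add: fpM_simps)
  qed
  show "\<one>\<^bsub>R\<^esub> \<odot>\<^bsub>fpM\<^esub> x = x" if "x \<in> carrier fpM" for x
  proof -
    have x: "x \<in> carrier G" using that by (simp add: fpM_simps)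
    have "\<one>\<^bsub>R\<^esub> \<odot>\<^bsub>fpM\<^esub> x = (\<Otimes>e\<in>carrier H. if \<one>\<^bsub>H\<^esub> = e then act e x else \<one>)"
      using x unfolding fpM_simps by (intro finprod_cong') (auto simp: R_one)
    also have "\<dots> = act \<one>\<^bsub>H\<^esub> x"
      using x fin_H by (intro finprod_singleton) auto
    finally show ?thesis using x by simp
  qed
qed

end

text \<open>The ring axioms are a separate assumption because their proof embeds the group ring into
  an algebra over a field of characteristic p, and \<open>fp_action\<close> carries no such
  field.\<close>

locale fp_module = fp_action + assumes cring_R: "cring (group_ring (residue_ring (int p)) H)"
begin

sublocale Mod: module R fpM
  by (rule fpM_module[OF cring_R])

definition unit_coeff where "unit_coeff e = (\<lambda>g\<in>carrier H. if g = e then 1 else (0::int))"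

lemma unit_coeff_R: "e \<in> carrier H \<Longrightarrow> unit_coeff e \<in> carrier R"
  using p_gt_1 by (auto simp: R_carrier unit_coeff_def)

lemma unit_coeff_smult:
  assumes "e \<in> carrier H" "x \<in> carrier G"
  shows "unit_coeff e \<odot>\<^bsub>fpM\<^esub> x = act e x"
proof -
  have "unit_coeff e \<odot>\<^bsub>fpM\<^esub> x = (\<Otimes>g\<in>carrier H. if e = g then act g x else \<one>)"
    using assms unfolding fpM_simps by (intro finprod_cong') (auto simp: unit_coeff_def)
  also have "\<dots> = act e x"
    using assms fin_H by (intro finprod_singleton) auto
  finally show ?thesis .
qed

lemma fpM_neg: "x \<in> carrier G \<Longrightarrow> \<ominus>\<^bsub>fpM\<^esub> x = inv x"
  using Mod.M.minus_equality[of "inv x" x] by (simp add: fpM_simps)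

lemma submodule_fpM_iff:
  "submodule N R fpM \<longleftrightarrow> subgroup N G \<and> (\<forall>e\<in>carrier H. \<forall>x\<in>N. act e x \<in> N)"
proof
  assume N: "submodule N R fpM"
  have submod: "N \<subseteq> carrier G" using Mod.submoduleE(1)[OF N] by (simp add: fpM_simps)
  have "subgroup N G"
  proof (rule subgroupI)
    show "N \<noteq> {}" by (rule Mod.submoduleE(2)[OF N])
    show "inv a \<in> N" if "a \<in> N" for a
      using Mod.submoduleE(3)[OF N that] that submod fpM_neg[of a] by auto
    show "a \<otimes> b \<in> N" if "a \<in> N" "b \<in> N" for a b
      using Mod.submoduleE(5)[OF N that] by (simp add: fpM_simps)
  qed (rule submod)
  moreover have "act e x \<in> N" if "e \<in> carrier H" "x \<in> N" for e x
    using Mod.submoduleE(4)[OF N unit_coeff_R[OF that(1)] that(2)] unit_coeff_smult[OF that(1)] that(2) submod by auto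
  ultimately show "subgroup N G \<and> (\<forall>e\<in>carrier H. \<forall>x\<in>N. act e x \<in> N)" by blast
next
  assume N: "subgroup N G \<and> (\<forall>e\<in>carrier H. \<forall>x\<in>N. act e x \<in> N)"
  then interpret N: subgroup N G by blast
  have pow: "x [^] (i :: int) \<in> N" if "x \<in> N" for x i
    using subgroup_int_pow_closed[OF N.subgroup_axioms that] .
  have fp: "(\<Otimes>i\<in>I. f i) \<in> N" if "finite I" "\<And>i. i \<in> I \<Longrightarrow> f i \<in> N" for f :: "'c \<Rightarrow> 'a" and I
    using that
  proof (induction I rule: finite_induct)
    case (insert i I)
    then have "f \<in> I \<rightarrow> carrier G" "f i \<in> carrier G" by auto
    then show ?case using insert by simp
  qed simp
  show "submodule N R fpM"
  proof (rule Mod.submoduleI)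
    show "\<ominus>\<^bsub>fpM\<^esub> a \<in> N" if "a \<in> N" for a
      using that fpM_neg[of a] by simp
    show "r \<odot>\<^bsub>fpM\<^esub> x \<in> N" if "x \<in> N" for r x
      unfolding fpM_simps using fp[OF fin_H] pow N that by auto
  qed (auto simp: fpM_simps)
qed

text \<open>Vector space complements in multiplicative notation: K is taken maximal among the
  subgroups that meet N trivially.\<close>

lemma subgroup_complement:
  assumes N: "subgroup N G"
  obtains K where "subgroup K G" "K \<inter> N = {\<one>}" "\<And>u. u \<in> carrier G \<Longrightarrow> \<exists>n\<in>N. \<exists>k\<in>K. u = n \<otimes> k"
proof -
  interpret N: subgroup N G by (rule N)
  define F where "F = {K. subgroup K G \<and> K \<inter> N = {\<one>}}"
  have "finite F" by (rule finite_subset[of _ "Pow (carrier G)"]) (use fin_G subgroup.subset in \<open>auto simp: F_def\<close>)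
  moreover have "{\<one>} \<in> F" using triv_subgroup by (auto simp: F_def)
  ultimately obtain K where K: "K \<in> F" "\<And>K'. K' \<in> F \<Longrightarrow> K \<subseteq> K' \<Longrightarrow> K = K'"
    using finite_has_maximal[of F] by (metis empty_iff)
  then have Ks: "subgroup K G" "K \<inter> N = {\<one>}" by (auto simp: F_def)
  interpret K: subgroup K G by (rule Ks)
  have "\<exists>n\<in>N. \<exists>k\<in>K. u = n \<otimes> k" if u: "u \<in> carrier G" for u
  proof (cases "u \<in> K")
    case True
    then show ?thesis using u by (intro bexI[of _ \<one>] bexI[of _ u]) auto
  next
    case False
    \<comment> \<open>K and u generate a larger subgroup, so it contains some n = k u^i in N other
      than 1. Then p does not divide i, and inverting i modulo p expresses u by n and k.\<close>
    define K' where "K' = {k \<otimes> u [^] (i :: int) | k i. k \<in> K}"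
    have K'I: "k \<otimes> u [^] (i :: int) \<in> K'" if "k \<in> K" for k i using that by (auto simp: K'_def)
    have "subgroup K' G"
    proof (rule subgroupI)
      show "K' \<subseteq> carrier G" using u by (auto simp: K'_def)
      show "K' \<noteq> {}" using K'I[of \<one> 0] by auto
      show "inv a \<in> K'" if a: "a \<in> K'" for a
      proof -
        obtain k i where "a = k \<otimes> u [^] (i :: int)" "k \<in> K" using a unfolding K'_def by blast
        then have "inv a = inv k \<otimes> u [^] (- i)" using u by (simp add: inv_mult int_pow_neg)
        then show ?thesis using K'I[of "inv k" "- i"] \<open>k \<in> K\<close> by simp
      qed
      show "a \<otimes> b \<in> K'" if "a \<in> K'" "b \<in> K'" for a b
      proof -
        obtain k i l j where "a = k \<otimes> u [^] (i :: int)" "k \<in> K" "b = l \<otimes> u [^] (j :: int)" "l \<in> K"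
          using \<open>a \<in> K'\<close> \<open>b \<in> K'\<close> unfolding K'_def by blast
        then have "a \<otimes> b = (k \<otimes> l) \<otimes> u [^] (i + j)"
          using u by (simp add: int_pow_mult m_ac)
        then show ?thesis using K'I[of "k \<otimes> l" "i + j"] \<open>k \<in> K\<close> \<open>l \<in> K\<close> by simp
      qed
    qed
    moreover have "K \<subseteq> K'"
    proof
      fix k assume "k \<in> K"
      then show "k \<in> K'" using K'I[of k 0] by simp
    qed
    moreover have "u \<in> K'" using K'I[of \<one> 1] u by simp
    ultimately have "K' \<notin> F" using K(2) False by blast
    then have "K' \<inter> N \<noteq> {\<one>}" using \<open>subgroup K' G\<close> by (simp add: F_def)
    moreover have "\<one> \<in> K' \<inter> N" using subgroup.one_closed[OF \<open>subgroup K' G\<close>] by simp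
    ultimately obtain n where n: "n \<in> K'" "n \<in> N" "n \<noteq> \<one>" by blast
    then obtain k i where ki: "n = k \<otimes> u [^] (i :: int)" "k \<in> K" by (auto simp: K'_def)
    have "\<not> int p dvd i"
    proof
      assume "int p dvd i"
      then have "u [^] i = \<one>" using pow_mod_p[OF u, of i] by simp
      then have "n \<in> K" using ki by simp
      then show False using n Ks by blast
    qed
    then have "coprime (int p) i" using prime_p by (intro prime_imp_coprime) auto
    then obtain j where j: "[i * j = 1] (mod int p)"
      using cong_solve_coprime_int[of i "int p"] by (auto simp: coprime_commute)
    have "u [^] (i * j) = u"
      using pow_mod_p[OF u, of "i * j"] pow_mod_p[OF u, of 1] j u by (simp add: cong_def)
    moreover have "u [^] i = inv k \<otimes> n"
      using ki u by (simp add: m_assoc[symmetric])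
    ultimately have "u = (inv k \<otimes> n) [^] j" using u by (simp add: int_pow_pow[symmetric])
    also have "\<dots> = n [^] j \<otimes> inv k [^] j"
      using ki n by (simp add: int_pow_distrib m_comm)
    finally show ?thesis
      using subgroup_int_pow_closed[OF N n(2)] subgroup_int_pow_closed[OF Ks(1), of "inv k"] ki(2) by blast
  qed
  then show thesis using that Ks by blast
qed

lemma order_inverse:
  obtains c where "\<And>x. x \<in> carrier G \<Longrightarrow> (x [^] card (carrier H)) [^] (c :: int) = x"
proof -
  have "coprime (int (card (carrier H))) (int p)" using coprime_H by simp
  then obtain c where c: "[int (card (carrier H)) * c = 1] (mod int p)"
    using cong_solve_coprime_int by blast
  have "(x [^] card (carrier H)) [^] c = x" if x: "x \<in> carrier G" for x
    using pow_mod_p[OF x, of "int (card (carrier H)) * c"] pow_mod_p[OF x, of 1] c x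
    by (simp add: cong_def int_pow_pow int_pow_int[symmetric])
  then show thesis by (rule that)
qed

text \<open>Maschke's theorem: average a projection over \<open>H\<close>.\<close>
lemma submodule_complement:
  assumes N: "submodule N R fpM"
  shows "\<exists>C. submodule C R fpM \<and> N \<inter> C = {\<zero>\<^bsub>fpM\<^esub>} \<and>
    (\<forall>x\<in>carrier fpM. \<exists>a\<in>N. \<exists>b\<in>C. x = a \<oplus>\<^bsub>fpM\<^esub> b)"
proof -
  have Ns: "subgroup N G" and Nact: "\<And>e x. e \<in> carrier H \<Longrightarrow> x \<in> N \<Longrightarrow> act e x \<in> N"
    using N submodule_fpM_iff by auto
  interpret N: subgroup N G by (rule Ns)
  obtain K where K: "subgroup K G" "K \<inter> N = {\<one>}" "\<And>u. u \<in> carrier G \<Longrightarrow> \<exists>n\<in>N. \<exists>k\<in>K. u = n \<otimes> k"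
    using subgroup_complement[OF Ns] by blast
  interpret K: subgroup K G by (rule K(1))
  \<comment> \<open>The projection onto N along K, which need not commute with H.\<close>
  define \<pi>0 where "\<pi>0 u = (SOME n. n \<in> N \<and> (\<exists>k\<in>K. u = n \<otimes> k))" for u
  have \<pi>0: "\<pi>0 u \<in> N" "\<exists>k\<in>K. u = \<pi>0 u \<otimes> k" if "u \<in> carrier G" for u
    using someI_ex[of "\<lambda>n. n \<in> N \<and> (\<exists>k\<in>K. u = n \<otimes> k)"] K(3)[OF that] unfolding \<pi>0_def by blast+
  have \<pi>0_eq: "\<pi>0 (n \<otimes> k) = n" if "n \<in> N" "k \<in> K" for n k
  proof -
    have nk: "n \<otimes> k \<in> carrier G" using that by simp
    obtain l where l: "l \<in> K" "n \<otimes> k = \<pi>0 (n \<otimes> k) \<otimes> l" using \<pi>0(2)[OF nk] by blast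
    let ?m = "\<pi>0 (n \<otimes> k)"
    have m: "?m \<in> N" by (rule \<pi>0(1)[OF nk])
    have "inv ?m \<otimes> n = l \<otimes> inv k"
    proof -
      have "inv ?m \<otimes> n = inv ?m \<otimes> (n \<otimes> k) \<otimes> inv k" using m that by (simp add: m_assoc)
      also have "inv ?m \<otimes> (n \<otimes> k) = inv ?m \<otimes> (?m \<otimes> l)" by (rule arg_cong[OF l(2)])
      also have "\<dots> = l" using l(1) m by (simp add: m_assoc[symmetric])
      finally show ?thesis .
    qed
    moreover have "l \<otimes> inv k \<in> K" using l(1) that(2) by simp
    moreover have "inv ?m \<otimes> n \<in> N" using m that(1) by simp
    ultimately have "inv ?m \<otimes> n \<in> K \<inter> N" by simp
    then have "inv ?m \<otimes> n = \<one>" using K(2) by blast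
    then show ?thesis using m that by (metis N.mem_carrier inv_closed inv_inv inv_solve_left r_one one_closed)
  qed
  have \<pi>0_mult: "\<pi>0 (u \<otimes> v) = \<pi>0 u \<otimes> \<pi>0 v" if uv: "u \<in> carrier G" "v \<in> carrier G" for u v
  proof -
    obtain k l where kl: "k \<in> K" "u = \<pi>0 u \<otimes> k" "l \<in> K" "v = \<pi>0 v \<otimes> l"
      using \<pi>0(2)[OF uv(1)] \<pi>0(2)[OF uv(2)] by blast
    have n: "\<pi>0 u \<in> N" "\<pi>0 v \<in> N" using \<pi>0(1) that by auto
    have "u \<otimes> v = (\<pi>0 u \<otimes> k) \<otimes> (\<pi>0 v \<otimes> l)" using kl(2,4) by simp
    also have "\<dots> = (\<pi>0 u \<otimes> \<pi>0 v) \<otimes> (k \<otimes> l)" using kl(1,3) n by (simp add: m_ac)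
    finally show ?thesis using \<pi>0_eq[of "\<pi>0 u \<otimes> \<pi>0 v" "k \<otimes> l"] n kl(1,3) by simp
  qed
  have \<pi>0_N: "\<pi>0 n = n" if "n \<in> N" for n using \<pi>0_eq[OF that, of \<one>] that by simp
  \<comment> \<open>The average before division by |H|: on N it is the power with exponent
    |H|.\<close>
  define \<pi> where "\<pi> u = (\<Otimes>e\<in>carrier H. act e (\<pi>0 (act (inv\<^bsub>H\<^esub> e) u)))" for u
  have tm: "act e (\<pi>0 (act (inv\<^bsub>H\<^esub> e) u)) \<in> N" if "e \<in> carrier H" "u \<in> carrier G" for e u
    using that Nact \<pi>0(1) by simp
  have tmG: "act e (\<pi>0 (act (inv\<^bsub>H\<^esub> e) u)) \<in> carrier G" if "e \<in> carrier H" "u \<in> carrier G" for e u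
    using tm[OF that] by simp
  have \<pi>_in: "\<pi> u \<in> N" if "u \<in> carrier G" for u
  proof -
    have "(\<Otimes>e\<in>I. act e (\<pi>0 (act (inv\<^bsub>H\<^esub> e) u))) \<in> N" if "finite I" "I \<subseteq> carrier H" for I
      using that
    proof (induction I)
      case (insert i I)
      have "(\<lambda>e. act e (\<pi>0 (act (inv\<^bsub>H\<^esub> e) u))) \<in> I \<rightarrow> carrier G"
        using insert tmG[OF _ \<open>u \<in> carrier G\<close>] by auto
      moreover have "act i (\<pi>0 (act (inv\<^bsub>H\<^esub> i) u)) \<in> N" using insert tm[OF _ \<open>u \<in> carrier G\<close>] by auto
      ultimately show ?case using insert by simp
    qed simp
    then show ?thesis unfolding \<pi>_def using fin_H by simp
  qed
  have \<pi>_mult: "\<pi> (u \<otimes> v) = \<pi> u \<otimes> \<pi> v" if uv: "u \<in> carrier G" "v \<in> carrier G" for u v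
  proof -
    have "\<pi> (u \<otimes> v) = (\<Otimes>e\<in>carrier H. act e (\<pi>0 (act (inv\<^bsub>H\<^esub> e) u)) \<otimes> act e (\<pi>0 (act (inv\<^bsub>H\<^esub> e) v)))"
      unfolding \<pi>_def
    proof (rule finprod_cong'[OF refl])
      fix e assume e: "e \<in> carrier H"
      have "\<pi>0 (act (inv\<^bsub>H\<^esub> e) u) \<in> carrier G" "\<pi>0 (act (inv\<^bsub>H\<^esub> e) v) \<in> carrier G"
        using \<pi>0(1) e uv by auto
      then show "act e (\<pi>0 (act (inv\<^bsub>H\<^esub> e) (u \<otimes> v)))
        = act e (\<pi>0 (act (inv\<^bsub>H\<^esub> e) u)) \<otimes> act e (\<pi>0 (act (inv\<^bsub>H\<^esub> e) v))"
        using e uv by (simp add: \<pi>0_mult)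
    qed (use tmG uv in auto)
    also have "\<dots> = \<pi> u \<otimes> \<pi> v"
      unfolding \<pi>_def using tmG uv by (intro finprod_multf) auto
    finally show ?thesis .
  qed
  have \<pi>_act: "\<pi> (act f u) = act f (\<pi> u)" if f: "f \<in> carrier H" and u: "u \<in> carrier G" for f u
  proof -
    have bij: "(\<lambda>z. f \<otimes>\<^bsub>H\<^esub> z) ` carrier H = carrier H" "inj_on (\<lambda>z. f \<otimes>\<^bsub>H\<^esub> z) (carrier H)"
      using H.surj_const_mult[OF f] H.inj_on_cmult[OF f] by auto
    have "\<pi> (act f u) = (\<Otimes>e\<in>(\<lambda>z. f \<otimes>\<^bsub>H\<^esub> z) ` carrier H. act e (\<pi>0 (act (inv\<^bsub>H\<^esub> e) (act f u))))"
      unfolding \<pi>_def by (simp only: bij)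
    also have "\<dots> = (\<Otimes>e\<in>carrier H. act (f \<otimes>\<^bsub>H\<^esub> e) (\<pi>0 (act (inv\<^bsub>H\<^esub> (f \<otimes>\<^bsub>H\<^esub> e)) (act f u))))"
      using f u bij tmG by (intro finprod_reindex) auto
    also have "\<dots> = (\<Otimes>e\<in>carrier H. act f (act e (\<pi>0 (act (inv\<^bsub>H\<^esub> e) u))))"
    proof (rule finprod_cong'[OF refl])
      fix e assume e: "e \<in> carrier H"
      have "act (inv\<^bsub>H\<^esub> (f \<otimes>\<^bsub>H\<^esub> e)) (act f u) = act (inv\<^bsub>H\<^esub> (f \<otimes>\<^bsub>H\<^esub> e) \<otimes>\<^bsub>H\<^esub> f) u"
        using e f u by (simp add: act_act)
      also have "inv\<^bsub>H\<^esub> (f \<otimes>\<^bsub>H\<^esub> e) \<otimes>\<^bsub>H\<^esub> f = inv\<^bsub>H\<^esub> e"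
        using e f by (simp add: H.inv_mult_group H.m_assoc)
      finally have eq: "act (inv\<^bsub>H\<^esub> (f \<otimes>\<^bsub>H\<^esub> e)) (act f u) = act (inv\<^bsub>H\<^esub> e) u" .
      have "\<pi>0 (act (inv\<^bsub>H\<^esub> e) u) \<in> carrier G" using \<pi>0(1) e u by auto
      then show "act (f \<otimes>\<^bsub>H\<^esub> e) (\<pi>0 (act (inv\<^bsub>H\<^esub> (f \<otimes>\<^bsub>H\<^esub> e)) (act f u)))
        = act f (act e (\<pi>0 (act (inv\<^bsub>H\<^esub> e) u)))"
        unfolding eq using e f by (simp add: act_act)
    qed (use tmG f u in auto)
    also have "\<dots> = act f (\<pi> u)"
      unfolding \<pi>_def using f u fin_H tmG by (intro finprod_hom[symmetric]) auto
    finally show ?thesis .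
  qed
  have \<pi>_N: "\<pi> n = n [^] card (carrier H)" if n: "n \<in> N" for n
  proof -
    have "\<pi> n = (\<Otimes>e\<in>carrier H. n)"
      unfolding \<pi>_def
    proof (rule finprod_cong'[OF refl])
      fix e assume e: "e \<in> carrier H"
      have "act e (\<pi>0 (act (inv\<^bsub>H\<^esub> e) n)) = act e (act (inv\<^bsub>H\<^esub> e) n)"
        using \<pi>0_N Nact e n by simp
      also have "\<dots> = n" using e n by (simp add: act_act[symmetric])
      finally show "act e (\<pi>0 (act (inv\<^bsub>H\<^esub> e) n)) = n" .
    qed (use n in auto)
    then show ?thesis using n by (simp add: finprod_const)
  qed
  obtain c where c: "\<And>x. x \<in> carrier G \<Longrightarrow> (x [^] card (carrier H)) [^] (c :: int) = x"
    using order_inverse by blast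
  define C where "C = {u \<in> carrier G. \<pi> u = \<one>}"
  have \<pi>_one: "\<pi> \<one> = \<one>" using \<pi>_N[of \<one>] by simp
  have \<pi>_G: "\<pi> u \<in> carrier G" if "u \<in> carrier G" for u using \<pi>_in[OF that] by simp
  have \<pi>_inv: "\<pi> (inv u) = inv (\<pi> u)" if "u \<in> carrier G" for u
    using \<pi>_mult[of "inv u" u] \<pi>_one that \<pi>_G inv_equality[of "\<pi> (inv u)" "\<pi> u"] by simp
  have "subgroup C G"
    by (rule subgroupI) (auto simp: C_def \<pi>_one \<pi>_mult \<pi>_inv)
  then have C: "submodule C R fpM"
    unfolding submodule_fpM_iff by (auto simp: C_def \<pi>_act)
  have NC: "n = \<one>" if "n \<in> N" "n \<in> C" for n
    using c[of n] \<pi>_N[OF that(1)] that by (simp add: C_def)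
  have "\<exists>a\<in>N. \<exists>b\<in>C. u = a \<otimes> b" if u: "u \<in> carrier G" for u
  proof -
    \<comment> \<open>c inverts |H| modulo p, so this is the missing division. Since \<pi> agrees on
      a and u, the rest of u lies in the kernel C.\<close>
    define a where "a = \<pi> u [^] c"
    have aN: "a \<in> N" unfolding a_def by (rule subgroup_int_pow_closed[OF Ns \<pi>_in[OF u]])
    have "\<pi> a = (\<pi> u [^] c) [^] card (carrier H)" using \<pi>_N[OF aN] by (simp add: a_def)
    also have "\<dots> = (\<pi> u [^] card (carrier H)) [^] c"
      using \<pi>_G[OF u] by (simp add: int_pow_pow int_pow_int[symmetric] mult.commute)
    also have "\<dots> = \<pi> u" using c \<pi>_G[OF u] by simp
    finally have "inv a \<otimes> u \<in> C"
      using aN u \<pi>_G[OF u] by (simp add: C_def \<pi>_mult \<pi>_inv)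
    moreover have "u = a \<otimes> (inv a \<otimes> u)" using aN u by (simp add: m_assoc[symmetric])
    ultimately show ?thesis using aN by blast
  qed
  moreover have "N \<inter> C = {\<one>}" using NC \<pi>_one by (auto simp: C_def)
  ultimately show ?thesis using C by (intro exI[of _ C]) (simp add: fpM_simps)
qed

definition fp_endo where
  "fp_endo \<phi> \<longleftrightarrow> (\<forall>x\<in>carrier G. \<phi> x \<in> carrier G) \<and>
    (\<forall>x\<in>carrier G. \<forall>y\<in>carrier G. \<phi> (x \<otimes> y) = \<phi> x \<otimes> \<phi> y) \<and>
    (\<forall>e\<in>carrier H. \<forall>x\<in>carrier G. \<phi> (act e x) = act e (\<phi> x))"

lemma fp_endoI:
  assumes "Mod.module_endo \<phi>" shows "fp_endo \<phi>"
proof -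
  have \<phi>: "\<And>x. x \<in> carrier G \<Longrightarrow> \<phi> x \<in> carrier G"
    "\<And>x y. x \<in> carrier G \<Longrightarrow> y \<in> carrier G \<Longrightarrow> \<phi> (x \<otimes> y) = \<phi> x \<otimes> \<phi> y"
    "\<And>r x. r \<in> carrier R \<Longrightarrow> x \<in> carrier G \<Longrightarrow> \<phi> (r \<odot>\<^bsub>fpM\<^esub> x) = r \<odot>\<^bsub>fpM\<^esub> \<phi> x"
    using assms unfolding Mod.module_endo_def by (simp_all add: fpM_simps(1,3))
  have "\<phi> (act e x) = act e (\<phi> x)" if "e \<in> carrier H" "x \<in> carrier G" for e x
    using \<phi>(3)[OF unit_coeff_R[OF that(1)] that(2)] unit_coeff_smult[OF that(1)] \<phi>(1) that(2) by simp
  then show ?thesis using \<phi>(1,2) by (simp add: fp_endo_def)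
qed

lemma sl2_of_not_multiplicity_free:
  assumes "\<not> multiplicity_free R fpM"
  obtains e f h where "fp_endo e" "fp_endo f" "fp_endo h"
    "\<And>x. x \<in> carrier G \<Longrightarrow> e (f x) = h x \<otimes> f (e x)"
    "\<And>x. x \<in> carrier G \<Longrightarrow> h (e x) = (e x \<otimes> e x) \<otimes> e (h x)"
    "\<And>x. x \<in> carrier G \<Longrightarrow> f (h x) = (f x \<otimes> f x) \<otimes> h (f x)"
    "\<exists>x\<in>carrier G. e x \<noteq> \<one>"
proof -
  have "finite (carrier fpM)" using fin_G by (simp add: fpM_simps)
  then obtain SS where SS: "direct_sum R fpM SS" "\<And>N. N \<in> SS \<Longrightarrow> simple_module R (Mod.submod N)"
    using Mod.semisimple_decomposition submodule_complement by metis
  \<comment> \<open>Maschke's theorem provides a decomposition into simple modules in any case, so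
    only the pairwise non-isomorphism can fail.\<close>
  then obtain N N' where N: "N \<in> SS" "N' \<in> SS" "N \<noteq> N'"
    and iso: "module_isomorphic R (Mod.submod N) (Mod.submod N')"
    using assms unfolding multiplicity_free_def by metis
  have "N \<noteq> {\<zero>\<^bsub>fpM\<^esub>}" using SS(2)[OF N(1)] by (simp add: simple_module_def)
  then show thesis
  proof (rule Mod.sl2_endos[OF SS(1) N _ iso])
    fix e f h
    assume efh: "Mod.module_endo e" "Mod.module_endo f" "Mod.module_endo h"
      "\<And>x. x \<in> carrier fpM \<Longrightarrow> e (f x) = h x \<oplus>\<^bsub>fpM\<^esub> f (e x)"
      "\<And>x. x \<in> carrier fpM \<Longrightarrow> h (e x) = (e x \<oplus>\<^bsub>fpM\<^esub> e x) \<oplus>\<^bsub>fpM\<^esub> e (h x)"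
      "\<And>x. x \<in> carrier fpM \<Longrightarrow> f (h x) = (f x \<oplus>\<^bsub>fpM\<^esub> f x) \<oplus>\<^bsub>fpM\<^esub> h (f x)"
      "\<exists>x\<in>carrier fpM. e x \<noteq> \<zero>\<^bsub>fpM\<^esub>"
    show thesis
      by (rule that[of e f h, OF fp_endoI[OF efh(1)] fp_endoI[OF efh(2)] fp_endoI[OF efh(3)]
            efh(4-7)[unfolded fpM_simps(1-3)]])
  qed
qed

lemma cyclic_of_multiplicity_free:
  assumes "multiplicity_free R fpM"
  obtains m where "m \<in> carrier G" "\<And>x. x \<in> carrier G \<Longrightarrow> x \<in> generate G ((\<lambda>e. act e m) ` carrier H)"
proof -
  obtain m where m: "m \<in> carrier fpM" "\<And>x. x \<in> carrier fpM \<Longrightarrow> \<exists>r\<in>carrier R. x = r \<odot>\<^bsub>fpM\<^esub> m"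
    using Mod.multiplicity_free_cyclic[OF assms] by metis
  have mG: "m \<in> carrier G" using m(1) by (simp add: fpM_simps)
  let ?S = "generate G ((\<lambda>e. act e m) ` carrier H)"
  have S: "subgroup ?S G" by (rule generate_is_subgroup) (use mG in auto)
  interpret S: subgroup ?S G by (rule S)
  have "x \<in> ?S" if "x \<in> carrier G" for x
  proof -
    have "x \<in> carrier fpM" using that by (simp add: fpM_simps(1))
    then obtain r where r: "x = r \<odot>\<^bsub>fpM\<^esub> m" using m(2) by blast
    have tm: "act e m [^] r e \<in> ?S" if "e \<in> carrier H" for e
      using that by (intro subgroup_int_pow_closed[OF S] generate.incl) auto
    have "(\<Otimes>e\<in>I. act e m [^] r e) \<in> ?S" if "finite I" "I \<subseteq> carrier H" for I
      using that
    proof (induction I)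
      case (insert i I)
      then have "(\<lambda>e. act e m [^] r e) \<in> I \<rightarrow> carrier G" using mG by auto
      then show ?case using insert tm[of i] by simp
    qed simp
    then show ?thesis using r fin_H by (simp add: fpM_simps(4))
  qed
  then show thesis using that mG by blast
qed

end

section \<open>The Frattini quotient\<close>

declare mult_FactGroup [simp del] one_FactGroup [simp del]

lemma (in comm_group) quotient_swap:
  assumes "d \<in> carrier G" "k' \<in> carrier G" "c \<in> carrier G" "k \<in> carrier G" "d \<otimes> k' = c \<otimes> k"
  shows "d \<otimes> inv c = k \<otimes> inv k'"
proof -
  have "d \<otimes> inv c = d \<otimes> k' \<otimes> (inv k' \<otimes> inv c)"
    using assms(1-4) by (simp add: m_assoc[symmetric]) (simp add: m_assoc)
  also have "\<dots> = k \<otimes> inv k' \<otimes> (c \<otimes> inv c)"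
    unfolding assms(5) using assms(1-4) by (simp only: m_ac inv_closed m_closed)
  finally show ?thesis using assms(1-4) by simp
qed

context p_setting
begin

text \<open>This is \<Phi>(P), by \<open>frattini_eq\<close>, with explicit elements.\<close>

definition pth_powers where "pth_powers = (\<lambda>u. u [^] p) ` carrier P"
abbreviation "Fq \<equiv> P Mod pth_powers"
definition pmod where "pmod u = pth_powers #> u"

lemma pth_powers_subgroup: "subgroup pth_powers P"
proof (rule subgroupI)
  show "inv a \<in> pth_powers" if a: "a \<in> pth_powers" for a
  proof -
    obtain u where "u \<in> carrier P" "a = u [^] p" using a unfolding pth_powers_def by blast
    then have "inv a = (inv u) [^] p" "inv u \<in> carrier P" by (simp_all add: nat_pow_inv)
    then show ?thesis unfolding pth_powers_def by blast
  qed
  show "a \<otimes> b \<in> pth_powers" if a: "a \<in> pth_powers" and b: "b \<in> pth_powers" for a b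
  proof -
    obtain u v where "u \<in> carrier P" "a = u [^] p" "v \<in> carrier P" "b = v [^] p"
      using a b unfolding pth_powers_def by blast
    then have "a \<otimes> b = (u \<otimes> v) [^] p" "u \<otimes> v \<in> carrier P" by (simp_all add: nat_pow_distrib)
    then show ?thesis unfolding pth_powers_def by blast
  qed
qed (auto simp: pth_powers_def)

lemma pth_powers_normal: "pth_powers \<lhd> P"
  by (rule subgroup_imp_normal[OF pth_powers_subgroup])

sublocale Fq: comm_group Fq
  by (rule abelian_FactGroup[OF pth_powers_subgroup])

lemma Fq_carrier: "carrier Fq = pmod ` carrier P"
  by (simp add: carrier_FactGroup pmod_def)

lemma pmod_closed [simp]: "u \<in> carrier P \<Longrightarrow> pmod u \<in> carrier Fq"
  by (simp add: Fq_carrier)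

lemma pmod_mult: "u \<in> carrier P \<Longrightarrow> v \<in> carrier P \<Longrightarrow> pmod u \<otimes>\<^bsub>Fq\<^esub> pmod v = pmod (u \<otimes> v)"
  using normal.rcos_sum[OF pth_powers_normal, of u v] by (simp add: pmod_def mult_FactGroup)

lemma pmod_one: "pmod \<one> = \<one>\<^bsub>Fq\<^esub>"
  using subgroup.subset[OF pth_powers_subgroup] by (simp add: pmod_def one_FactGroup)

lemma pmod_pow: "u \<in> carrier P \<Longrightarrow> pmod (u [^] (n::nat)) = pmod u [^]\<^bsub>Fq\<^esub> n"
  by (induction n) (simp_all add: pmod_one pmod_mult[symmetric])

lemma pmod_inv: "u \<in> carrier P \<Longrightarrow> pmod (inv u) = inv\<^bsub>Fq\<^esub> (pmod u)"
  using Fq.inv_equality[of "pmod (inv u)" "pmod u"] by (simp add: pmod_mult pmod_one)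

lemma pmod_eq_one_iff: "u \<in> carrier P \<Longrightarrow> pmod u = \<one>\<^bsub>Fq\<^esub> \<longleftrightarrow> u \<in> pth_powers"
  using coset_join1[of pth_powers u] coset_join2[of u pth_powers] pth_powers_subgroup subgroup.subset[OF pth_powers_subgroup]
  by (auto simp: pmod_def one_FactGroup)

lemma pmod_eq_iff: "u \<in> carrier P \<Longrightarrow> v \<in> carrier P \<Longrightarrow> pmod u = pmod v \<longleftrightarrow> u \<otimes> inv v \<in> pth_powers"
proof -
  assume uv: "u \<in> carrier P" "v \<in> carrier P"
  have "pmod (u \<otimes> inv v) = pmod u \<otimes>\<^bsub>Fq\<^esub> inv\<^bsub>Fq\<^esub> pmod v" using uv by (simp add: pmod_mult[symmetric] pmod_inv)
  then have "pmod (u \<otimes> inv v) = \<one>\<^bsub>Fq\<^esub> \<longleftrightarrow> pmod u = pmod v"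
    using uv by (metis Fq.inv_closed Fq.inv_equality Fq.inv_inv Fq.r_inv pmod_closed)
  then show ?thesis using uv pmod_eq_one_iff[of "u \<otimes> inv v"] by simp
qed

lemma pmod_exp_p: "C \<in> carrier Fq \<Longrightarrow> C [^]\<^bsub>Fq\<^esub> p = \<one>\<^bsub>Fq\<^esub>"
proof -
  assume "C \<in> carrier Fq"
  then obtain u where "u \<in> carrier P" "C = pmod u" by (auto simp: Fq_carrier)
  then show ?thesis using pmod_pow[of u p] pmod_eq_one_iff[of "u [^] p"] by (auto simp: pth_powers_def)
qed

lemma act_pmod:
  assumes e: "e \<in> E" and u: "u \<in> carrier P"
  shows "e ` pmod u = pmod (e u)"
proof
  have pow: "e (v [^] p) = e v [^] p" if "v \<in> carrier P" for v
    using hom_nat_pow[of e P P v p] act_hom[OF e] that P.is_group by simp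
  show "e ` pmod u \<subseteq> pmod (e u)"
  proof (safe)
    fix w assume "w \<in> pmod u"
    then obtain v where v: "v \<in> carrier P" "w = v [^] p \<otimes> u" by (auto simp: pmod_def r_coset_def pth_powers_def)
    then have "e w = (e v) [^] p \<otimes> e u" using e u pow by simp
    moreover have "(e v) [^] p \<in> pth_powers" using e v by (auto simp: pth_powers_def)
    ultimately show "e w \<in> pmod (e u)" by (auto simp: pmod_def r_coset_def)
  qed
  show "pmod (e u) \<subseteq> e ` pmod u"
  proof
    fix w assume "w \<in> pmod (e u)"
    then obtain v where v: "v \<in> carrier P" "w = v [^] p \<otimes> e u" by (auto simp: pmod_def r_coset_def pth_powers_def)
    then have "w = e ((einv e v) [^] p \<otimes> u)" using e u pow by simp
    moreover have "(einv e v) [^] p \<otimes> u \<in> pmod u"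
      using e v by (auto simp: pmod_def r_coset_def pth_powers_def)
    ultimately show "w \<in> e ` pmod u" by blast
  qed
qed

sublocale FM: fp_module Fq H "\<lambda>e C. e ` C" p
proof (intro fp_module.intro fp_action.intro fp_action_axioms.intro fp_module_axioms.intro)
  show "comm_group Fq" "comm_group H" by unfold_locales
  show "Factorial_Ring.prime p" by (rule prime_p)
  show "finite (carrier Fq)" using fin_P by (simp add: Fq_carrier)
  show "finite (carrier H)" using fin_E by simp
  show "coprime (card (carrier H)) p" using E_coprime by simp
  show "cring (group_ring (residue_ring (int p)) H)"
    by (rule group_ring_cring[OF prime_p char_p E_comm]) (use fin_E in simp)
next
  fix C assume C: "C \<in> carrier Fq"
  then obtain u where u: "u \<in> carrier P" "C = pmod u" by (auto simp: Fq_carrier)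
  show "C [^]\<^bsub>Fq\<^esub> p = \<one>\<^bsub>Fq\<^esub>" by (rule pmod_exp_p[OF C])
  show "\<one>\<^bsub>H\<^esub> ` C = C" using u by (simp add: act_pmod)
  fix e assume e: "e \<in> carrier H"
  show "e ` C \<in> carrier Fq" using u e by (simp add: act_pmod)
  show "(e \<otimes>\<^bsub>H\<^esub> f) ` C = e ` f ` C" if "f \<in> carrier H" for f
    using u e that by (simp add: act_pmod)
  show "e ` (C \<otimes>\<^bsub>Fq\<^esub> D) = e ` C \<otimes>\<^bsub>Fq\<^esub> e ` D" if D: "D \<in> carrier Fq" for D
  proof -
    obtain v where v: "v \<in> carrier P" "D = pmod v" using D by (auto simp: Fq_carrier)
    then show ?thesis using u e act_pmod[of e "u \<otimes> v"] act_pmod[of e u] act_pmod[of e v]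
      by (simp add: pmod_mult)
  qed
qed

text \<open>P modulo its p-th powers is elementary abelian, and any N with elementary abelian
  quotient contains every u^p.\<close>

lemma frattini_eq: "frattini p P = pth_powers"
proof
  have "elementary_abelian p Fq"
    unfolding elementary_abelian_def using Fq.comm_group_axioms pmod_exp_p by blast
  then show "frattini p P \<subseteq> pth_powers" unfolding frattini_def using pth_powers_normal by blast
  show "pth_powers \<subseteq> frattini p P"
    unfolding frattini_def
  proof (rule Inter_greatest, safe)
    fix N w assume N: "N \<lhd> P" "elementary_abelian p (P Mod N)" and "w \<in> pth_powers"
    then obtain u where u: "u \<in> carrier P" "w = u [^] p" by (auto simp: pth_powers_def)
    interpret N: normal N P by (rule N)
    have hom: "(\<lambda>a. N #> a) \<in> hom P (P Mod N)" by (rule N.r_coset_hom_Mod)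
    have "N #> w = (N #> u) [^]\<^bsub>P Mod N\<^esub> p"
      using hom_nat_pow[OF hom u(1) P.is_group N.factorgroup_is_group, of p] u by simp
    also have "\<dots> = N" using N(2) u by (simp add: elementary_abelian_def carrier_FactGroup one_FactGroup)
    finally show "w \<in> N" using coset_join1[of N w] N.subset N.subgroup_axioms u by simp
  qed
qed

lemma FpE_eq: "FpE p P E = FM.R"
  by (simp add: FpE_def)

lemma frattini_quotient_eq: "frattini_quotient p P E = FM.fpM"
  by (simp add: frattini_quotient_def FM.fpM_def frattini_eq Let_def)

lemma orbit_gen_of_cyclic:
  assumes "multiplicity_free (FpE p P E) (frattini_quotient p P E)"
  obtains m where "m \<in> carrier P" "carrier P = orbit_gen m"
proof -
  obtain C0 where C0: "C0 \<in> carrier Fq"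
    "\<And>x. x \<in> carrier Fq \<Longrightarrow> x \<in> generate Fq ((\<lambda>e. e ` C0) ` carrier H)"
    using FM.cyclic_of_multiplicity_free assms unfolding FpE_eq frattini_quotient_eq by metis
  obtain m where m: "m \<in> carrier P" "C0 = pmod m" using C0(1) by (auto simp: Fq_carrier)
  have submod: "subgroup (orbit_gen m) P"
    unfolding orbit_gen_def by (rule generate_is_subgroup) (use m in auto)
  interpret UG: subgroup "orbit_gen m" P by (rule submod)
  have *: "\<exists>w\<in>orbit_gen m. D = pmod w" if "D \<in> generate Fq ((\<lambda>e. e ` C0) ` carrier H)" for D
    using that
  proof (induction rule: generate.induct)
    case one
    then show ?case using pmod_one UG.one_closed by metis
  next
    case (incl h)
    then obtain e where e: "e \<in> E" "h = pmod (e m)" using m by (auto simp: act_pmod)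
    moreover have "e m \<in> orbit_gen m" unfolding orbit_gen_def using e by (intro generate.incl) auto
    ultimately show ?case by blast
  next
    case (inv h)
    then obtain e where e: "e \<in> E" "h = pmod (e m)" using m by (auto simp: act_pmod)
    then have "inv\<^bsub>Fq\<^esub> h = pmod (inv (e m))" using m by (simp add: pmod_inv)
    moreover have "e m \<in> orbit_gen m" unfolding orbit_gen_def using e by (intro generate.incl) auto
    ultimately show ?case using UG.m_inv_closed by blast
  next
    case (eng h1 h2)
    then obtain w1 w2 where "w1 \<in> orbit_gen m" "h1 = pmod w1" "w2 \<in> orbit_gen m" "h2 = pmod w2" by blast
    then show ?case using pmod_mult[of w1 w2] by (intro bexI[of _ "w1 \<otimes> w2"]) auto
  qed
  have "u \<in> orbit_gen m" if u: "u \<in> carrier P" for u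
  proof -
    \<comment> \<open>u agrees with some w in \<open>orbit_gen m\<close> up to a p-th power, and
      p-th powers are among the generators.\<close>
    obtain w where w: "w \<in> orbit_gen m" "pmod u = pmod w" using *[OF C0(2)[OF pmod_closed[OF u]]] by blast
    have "u \<otimes> inv w \<in> pth_powers" using w u pmod_eq_iff[of u w] by simp
    then have "u \<otimes> inv w \<in> orbit_gen m"
      unfolding pth_powers_def orbit_gen_def by (intro generate.incl) blast
    then have "u \<otimes> inv w \<otimes> w \<in> orbit_gen m" using w(1) by (rule UG.m_closed)
    then show ?thesis using u w by simp
  qed
  then have "carrier P = orbit_gen m" using UG.subset by blast
  then show thesis using that m by blast
qed

lemma solvable_of_multiplicity_free:
  "multiplicity_free (FpE p P E) (frattini_quotient p P E) \<Longrightarrow> lie_solvable HH"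
  using orbit_gen_of_cyclic solvable_of_cyclic by metis

text \<open>\<open>J/J\<^sup>2\<close> is \<open>k \<otimes> P/\<Phi>(P)\<close>; only injectivity on \<open>P/\<Phi>(P)\<close> is needed, and a homomorphism
  \<open>P \<rightarrow> k\<close> with value \<open>1\<close> at \<open>w\<close> yields a functional separating \<open>w - 1\<close> from \<open>J\<^sup>2\<close>.\<close>
lemma hom_to_field:
  assumes w: "w \<in> carrier P" "w \<notin> pth_powers"
  obtains l :: "'a \<Rightarrow> 'k" where "\<And>u v. u \<in> carrier P \<Longrightarrow> v \<in> carrier P \<Longrightarrow> l (u \<otimes> v) = l u + l v" "l w = 1"
proof -
  define C where "C = pmod w"
  have C: "C \<in> carrier Fq" "C \<noteq> \<one>\<^bsub>Fq\<^esub>" using w pmod_eq_one_iff by (auto simp: C_def)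
  \<comment> \<open>With a complement K of the subgroup generated by C, every coset is C^i times an
    element of K; the homomorphism sends it to i in the field.\<close>
  define N where "N = range (\<lambda>i :: int. C [^]\<^bsub>Fq\<^esub> i)"
  have "subgroup N Fq"
  proof (rule Fq.subgroupI)
    show "inv\<^bsub>Fq\<^esub> a \<in> N" if a: "a \<in> N" for a
    proof -
      obtain i where "a = C [^]\<^bsub>Fq\<^esub> (i :: int)" using a unfolding N_def by blast
      then have "inv\<^bsub>Fq\<^esub> a = C [^]\<^bsub>Fq\<^esub> (- i)" using C(1) by (simp add: Fq.int_pow_neg)
      then show ?thesis unfolding N_def by blast
    qed
    show "a \<otimes>\<^bsub>Fq\<^esub> b \<in> N" if a: "a \<in> N" and b: "b \<in> N" for a b
    proof -
      obtain i j where "a = C [^]\<^bsub>Fq\<^esub> (i :: int)" "b = C [^]\<^bsub>Fq\<^esub> (j :: int)"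
        using a b unfolding N_def by blast
      then have "a \<otimes>\<^bsub>Fq\<^esub> b = C [^]\<^bsub>Fq\<^esub> (i + j)" using C(1) by (simp add: Fq.int_pow_mult)
      then show ?thesis unfolding N_def by blast
    qed
    show "N \<subseteq> carrier Fq" using C(1) by (auto simp: N_def)
    show "N \<noteq> {}" by (auto simp: N_def)
  qed
  from FM.subgroup_complement[OF this]
  obtain K where K: "subgroup K Fq" "K \<inter> N = {\<one>\<^bsub>Fq\<^esub>}"
    "\<And>u. u \<in> carrier Fq \<Longrightarrow> \<exists>n\<in>N. \<exists>k\<in>K. u = n \<otimes>\<^bsub>Fq\<^esub> k" by metis
  interpret K: subgroup K Fq by (rule K(1))
  \<comment> \<open>Well-definedness: two exponents of the same coset differ by some i with C^i
    \<in> K, and C has order p.\<close>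
  have zero: "(of_int i :: 'k) = 0" if "C [^]\<^bsub>Fq\<^esub> i \<in> K" for i :: int
  proof -
    have one: "C [^]\<^bsub>Fq\<^esub> i = \<one>\<^bsub>Fq\<^esub>" using K(2) that by (auto simp: N_def)
    have "int p dvd i"
    proof (rule ccontr)
      assume "\<not> int p dvd i"
      then have "coprime (int p) i" using prime_p by (intro prime_imp_coprime) auto
      then obtain j where j: "[i * j = 1] (mod int p)"
        using cong_solve_coprime_int[of i "int p"] by (auto simp: coprime_commute)
      have "C = C [^]\<^bsub>Fq\<^esub> (i * j)"
        using FM.pow_mod_p[OF C(1), of "i * j"] FM.pow_mod_p[OF C(1), of 1] j C(1) by (simp add: cong_def)
      also have "\<dots> = \<one>\<^bsub>Fq\<^esub>" using C(1) one by (simp add: Fq.int_pow_pow[symmetric])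
      finally show False using C(2) by simp
    qed
    then have "i mod int p = 0" by simp
    then show ?thesis using of_int_mod_char[OF char_p, of i] by simp
  qed
  have ex: "\<exists>i :: int. \<exists>k\<in>K. pmod u = C [^]\<^bsub>Fq\<^esub> i \<otimes>\<^bsub>Fq\<^esub> k" if "u \<in> carrier P" for u
    using K(3)[OF pmod_closed[OF that]] unfolding N_def by blast
  define l where "l u = (of_int (SOME i. \<exists>k\<in>K. pmod u = C [^]\<^bsub>Fq\<^esub> i \<otimes>\<^bsub>Fq\<^esub> k) :: 'k)" for u
  have l: "l u = of_int i" if u: "u \<in> carrier P" and k: "k \<in> K" "pmod u = C [^]\<^bsub>Fq\<^esub> i \<otimes>\<^bsub>Fq\<^esub> k" for u i k
  proof -
    define j :: int where "j = (SOME i. \<exists>k\<in>K. pmod u = C [^]\<^bsub>Fq\<^esub> i \<otimes>\<^bsub>Fq\<^esub> k)"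
    obtain k' where k': "k' \<in> K" "pmod u = C [^]\<^bsub>Fq\<^esub> j \<otimes>\<^bsub>Fq\<^esub> k'"
      using someI_ex[of "\<lambda>i :: int. \<exists>k\<in>K. pmod u = C [^]\<^bsub>Fq\<^esub> i \<otimes>\<^bsub>Fq\<^esub> k", OF ex[OF u]]
      unfolding j_def[symmetric] by blast
    define c where "c = C [^]\<^bsub>Fq\<^esub> i"
    define d where "d = C [^]\<^bsub>Fq\<^esub> j"
    have mem: "c \<in> carrier Fq" "d \<in> carrier Fq" "k \<in> carrier Fq" "k' \<in> carrier Fq"
      using C k k' by (auto simp: c_def d_def)
    have eq: "d \<otimes>\<^bsub>Fq\<^esub> k' = c \<otimes>\<^bsub>Fq\<^esub> k" using k(2) k'(2) by (simp add: c_def d_def)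
    have "d \<otimes>\<^bsub>Fq\<^esub> inv\<^bsub>Fq\<^esub> c = k \<otimes>\<^bsub>Fq\<^esub> inv\<^bsub>Fq\<^esub> k'"
      by (rule Fq.quotient_swap[OF mem(2,4,1,3) eq])
    also have "d \<otimes>\<^bsub>Fq\<^esub> inv\<^bsub>Fq\<^esub> c = C [^]\<^bsub>Fq\<^esub> (j - i)"
      unfolding c_def d_def using C(1) by (rule Fq.int_pow_diff[symmetric])
    finally have "C [^]\<^bsub>Fq\<^esub> (j - i) \<in> K" using k(1) k'(1) K.m_closed K.m_inv_closed by metis
    then have "(of_int (j - i) :: 'k) = 0" by (rule zero)
    then show ?thesis by (simp add: l_def j_def)
  qed
  show thesis
  proof (rule that[of l])
    fix u v assume uv: "u \<in> carrier P" "v \<in> carrier P"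
    obtain i k where i: "k \<in> K" "pmod u = C [^]\<^bsub>Fq\<^esub> (i :: int) \<otimes>\<^bsub>Fq\<^esub> k" using ex[OF uv(1)] by blast
    obtain j k' where j: "k' \<in> K" "pmod v = C [^]\<^bsub>Fq\<^esub> (j :: int) \<otimes>\<^bsub>Fq\<^esub> k'" using ex[OF uv(2)] by blast
    have mem: "k \<in> carrier Fq" "k' \<in> carrier Fq" "C [^]\<^bsub>Fq\<^esub> i \<in> carrier Fq" "C [^]\<^bsub>Fq\<^esub> j \<in> carrier Fq"
      using C(1) i(1) j(1) by simp_all
    have "pmod (u \<otimes> v) = (C [^]\<^bsub>Fq\<^esub> i \<otimes>\<^bsub>Fq\<^esub> k) \<otimes>\<^bsub>Fq\<^esub> (C [^]\<^bsub>Fq\<^esub> j \<otimes>\<^bsub>Fq\<^esub> k')"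
      unfolding i(2)[symmetric] j(2)[symmetric] by (rule pmod_mult[OF uv, symmetric])
    also have "\<dots> = (C [^]\<^bsub>Fq\<^esub> i \<otimes>\<^bsub>Fq\<^esub> C [^]\<^bsub>Fq\<^esub> j) \<otimes>\<^bsub>Fq\<^esub> (k \<otimes>\<^bsub>Fq\<^esub> k')"
      using mem by (simp add: Fq.m_ac)
    also have "C [^]\<^bsub>Fq\<^esub> i \<otimes>\<^bsub>Fq\<^esub> C [^]\<^bsub>Fq\<^esub> j = C [^]\<^bsub>Fq\<^esub> (i + j)"
      using C(1) by (rule Fq.int_pow_mult[symmetric])
    finally have "l (u \<otimes> v) = of_int (i + j)"
      using uv i(1) j(1) K.m_closed by (intro l[of _ "k \<otimes>\<^bsub>Fq\<^esub> k'"]) auto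
    then show "l (u \<otimes> v) = l u + l v" using l[OF uv(1) i] l[OF uv(2) j] by simp
  next
    show "l w = 1"
      using l[of w "\<one>\<^bsub>Fq\<^esub>" 1] w C(1) K.one_closed by (simp add: C_def)
  qed
qed

lemma U_minus_one_J2:
  assumes w: "w \<in> carrier P" "U w - \<one>\<^bsub>A\<^esub> \<in> J 2"
  shows "w \<in> pth_powers"
proof (rule ccontr)
  assume "w \<notin> pth_powers"
  then obtain l :: "'a \<Rightarrow> 'k" where l: "\<And>u v. u \<in> carrier P \<Longrightarrow> v \<in> carrier P \<Longrightarrow> l (u \<otimes> v) = l u + l v" "l w = 1"
    using hom_to_field[OF w(1)] by metis
  \<comment> \<open>On (u - 1) b it takes the value l(u) times the degree 1 augmentation of b, which
    is 0 for b in J.\<close>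
  define \<Lambda> where "\<Lambda> a = (\<Sum>v\<in>carrier P. a (v, \<one>\<^sub>E) * l v)" for a :: "'a \<times> ('a \<Rightarrow> 'a) \<Rightarrow> 'k"
  have "\<Lambda> a = 0" if "a \<in> J (Suc 1)" for a
    using that
  proof (induction rule: J_Suc_induct)
    case (gen u b)
    have "\<Lambda> (U u \<star> b) = (\<Sum>v\<in>carrier P. b (v, \<one>\<^sub>E) * (l u + l v))"
      unfolding \<Lambda>_def
      by (rule sum.reindex_bij_witness[of _ "\<lambda>v. u \<otimes> v" "\<lambda>v. inv u \<otimes> v"])
        (use gen l in \<open>auto simp: U_star l(1)[symmetric]\<close>)
    also have "\<dots> = l u * (\<Sum>v\<in>carrier P. b (v, \<one>\<^sub>E)) + \<Lambda> b"
      by (simp add: \<Lambda>_def algebra_simps sum.distrib sum_distrib_left)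
    also have "(\<Sum>v\<in>carrier P. b (v, \<one>\<^sub>E)) = 0" using sum_J1[OF gen(2)] by simp
    finally have "\<Lambda> (U u \<star> b) = \<Lambda> b" by simp
    then show "\<Lambda> (U u \<star> b - b) = 0" by (simp add: \<Lambda>_def minus_apply left_diff_distrib sum_subtractf)
  qed (auto simp: fsp.subspace_def \<Lambda>_def fun_apply algebra_simps sum.distrib sum_distrib_left[symmetric] mult.assoc)
  then have "\<Lambda> (U w - \<one>\<^bsub>A\<^esub>) = 0" using w(2) by (simp add: numeral_2_eq_2)
  moreover have \<Lambda>U: "\<Lambda> (U u) = inverse (\<alpha> \<one>\<^sub>E \<one>\<^sub>E) * l u" if "u \<in> carrier P" for u
    using that fin_P by (simp add: \<Lambda>_def U_def fscale_apply delta_def if_distrib[of "\<lambda>x. _ * x"]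
      if_distrib[of "\<lambda>x. x * _"] sum.delta cong: if_cong)
  moreover have "l \<one> = 0"
  proof -
    have "l \<one> + l \<one> = l \<one> + 0" using l(1)[of \<one> \<one>, symmetric] by simp
    then show ?thesis by (rule add_left_imp_eq)
  qed
  moreover have "\<Lambda> (U w - U \<one>) = \<Lambda> (U w) - \<Lambda> (U \<one>)"
    by (simp add: \<Lambda>_def minus_apply left_diff_distrib sum_subtractf)
  ultimately show False using w l(2) cocycle_nonzeroE[of "\<one>\<^sub>E" "\<one>\<^sub>E"] by (simp add: U_one[symmetric])
qed

section \<open>Lifting endomorphisms of the Frattini quotient\<close>

definition conjW where "conjW x a = W x \<star> a \<star> Wi x"

lemma conjW_closed [simp]: "conjW x a \<in> carrier A"
  by (simp add: conjW_def)

lemma conjW_linear: "conjW x (a + b) = conjW x a + conjW x b" "conjW x (a - b) = conjW x a - conjW x b"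
  "conjW x (fscale c a) = fscale c (conjW x a)"
  by (simp_all add: conjW_def T.star_add_left T.star_add_right T.star_diff_left T.star_diff_right)

lemma conjW_sum: "conjW x (sum f I) = (\<Sum>i\<in>I. conjW x (f i))"
  by (simp add: conjW_def T.star_sum_left T.star_sum_right)

lemma conjW_J: "x \<in> E \<Longrightarrow> a \<in> J m \<Longrightarrow> conjW x a \<in> J m"
  by (simp add: conjW_def star_J_left star_J_right)

lemma conjW_conjW:
  assumes x: "x \<in> E" and y: "y \<in> E"
  shows "conjW x (conjW y a) = conjW (x \<cdot> y) a"
proof -
  have "conjW x (conjW y a) = (W x \<star> W y) \<star> a \<star> (Wi y \<star> Wi x)" by (simp add: conjW_def T.star_assoc)
  also have "\<dots> = conjW (x \<cdot> y) a"
    unfolding conjW_def Wi_mult[OF x y] using x y by (simp add: W_mult)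
  finally show ?thesis .
qed

lemma pr_conjW:
  assumes x: "x \<in> E" shows "pr \<one>\<^sub>E (conjW x a) = conjW x (pr \<one>\<^sub>E a)"
proof -
  have "pr (x \<cdot> einv x) (W x \<star> a \<star> W (einv x)) = W x \<star> pr \<one>\<^sub>E a \<star> W (einv x)"
    using x pr_star_W[of "einv x" x "W x \<star> a"] pr_W_star[of x "\<one>\<^sub>E" a] by simp
  then show ?thesis using x by (simp add: conjW_def Wi_def pr_linear)
qed

definition rep where "rep C = (SOME u. u \<in> carrier P \<and> C = pmod u)"

lemma rep: "C \<in> carrier Fq \<Longrightarrow> rep C \<in> carrier P \<and> C = pmod (rep C)"
  unfolding rep_def by (rule someI_ex) (auto simp: Fq_carrier)

text \<open>The map from P/\<Phi>(P) to J/J^2 induced by u \<mapsto> u - 1, carried by chosen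
  representatives; it is additive, equivariant and independent of the choice only modulo
  J^2.\<close>

definition pmod_diff where "pmod_diff C = U (rep C) - \<one>\<^bsub>A\<^esub>"

lemma pmod_diff_J1: "C \<in> carrier Fq \<Longrightarrow> pmod_diff C \<in> J 1"
  unfolding pmod_diff_def using rep by (intro U_minus_one) blast

lemma pmod_diff_closed: "C \<in> carrier Fq \<Longrightarrow> pmod_diff C \<in> carrier A"
  using pmod_diff_J1 J_A by blast

lemma J2_trans: "a - b \<in> J 2 \<Longrightarrow> b - c \<in> J 2 \<Longrightarrow> a - c \<in> J 2"
  using J_closed(2)[of "a - b" 2 "b - c"] by simp

lemma J2_sym: "a - b \<in> J 2 \<Longrightarrow> b - a \<in> J 2"
  using J_closed(5)[of "a - b" 2] by simp

lemma U_pmod_J2: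
  assumes u: "u \<in> carrier P" and v: "v \<in> carrier P" and eq: "pmod u = pmod v"
  shows "U u - U v \<in> J 2"
proof -
  obtain w where w: "w \<in> carrier P" "u \<otimes> inv v = w [^] p"
    using pmod_eq_iff[OF u v] eq by (auto simp: pth_powers_def)
  then have uw: "u = w [^] p \<otimes> v" using u v by (simp add: w(2)[symmetric])
  have "(of_nat p :: 'k) = 0" using char_p by (simp add: of_nat_eq_0_iff_char_dvd)
  then have "U (w [^] p) - \<one>\<^bsub>A\<^esub> \<in> J 2"
    using additive_mod_J2_pow[where f = "\<lambda>v. U v - \<one>\<^bsub>A\<^esub>", OF U_additive_mod_J2 w(1), of p]
    by (simp add: fsp.scale_zero_left)
  from J_closed(2)[OF U_additive_mod_J2[of "w [^] p" v] this] show ?thesis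
    using w v uw by simp
qed

lemma pmod_diff_pmod:
  assumes u: "u \<in> carrier P" shows "pmod_diff (pmod u) - (U u - \<one>\<^bsub>A\<^esub>) \<in> J 2"
  using U_pmod_J2[of "rep (pmod u)" u] rep[of "pmod u"] u by (simp add: pmod_diff_def)

lemma pmod_diff_mult:
  assumes C: "C \<in> carrier Fq" and D: "D \<in> carrier Fq"
  shows "pmod_diff (C \<otimes>\<^bsub>Fq\<^esub> D) - pmod_diff C - pmod_diff D \<in> J 2"
proof -
  let ?u = "rep C" and ?v = "rep D"
  have telescope: "(x - y) + (y - a - b) = x - a - b" for x y a b :: "'a \<times> ('a \<Rightarrow> 'a) \<Rightarrow> 'k"
    by (simp add: algebra_simps)
  have uv: "?u \<in> carrier P" "?v \<in> carrier P" "C = pmod ?u" "D = pmod ?v" using rep C D by auto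
  then have "C \<otimes>\<^bsub>Fq\<^esub> D = pmod (?u \<otimes> ?v)" by (metis pmod_mult)
  then have "pmod_diff (C \<otimes>\<^bsub>Fq\<^esub> D) - (U (?u \<otimes> ?v) - \<one>\<^bsub>A\<^esub>) \<in> J 2" using pmod_diff_pmod[of "?u \<otimes> ?v"] uv by simp
  from J_closed(2)[OF this U_additive_mod_J2[OF uv(1,2)]]
  have "pmod_diff (C \<otimes>\<^bsub>Fq\<^esub> D) - (U ?u - \<one>\<^bsub>A\<^esub>) - (U ?v - \<one>\<^bsub>A\<^esub>) \<in> J 2" by (simp only: telescope)
  then show ?thesis by (simp only: pmod_diff_def)
qed

lemma pr_U [simp]: "pr \<one>\<^sub>E (U u) = U u"
  by (auto simp: pr_def U_def delta_def fscale_apply fun_eq_iff)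

lemma pr_one [simp]: "pr \<one>\<^sub>E \<one>\<^bsub>A\<^esub> = \<one>\<^bsub>A\<^esub>"
  using pr_U[of \<one>] by (simp add: U_one)

lemma pr_pmod_diff [simp]: "pr \<one>\<^sub>E (pmod_diff C) = pmod_diff C"
  by (simp add: pmod_diff_def pr_linear)

lemma conjW_pmod_diff:
  assumes x: "x \<in> E" and C: "C \<in> carrier Fq"
  shows "conjW x (pmod_diff C) - pmod_diff (x ` C) \<in> J 2"
proof -
  have r: "rep C \<in> carrier P" "C = pmod (rep C)" using rep[OF C] by auto
  have "conjW x (pmod_diff C) = U (x (rep C)) - \<one>\<^bsub>A\<^esub>"
    unfolding conjW_def pmod_diff_def by (rule U_act[OF x r(1)])
  moreover have "x ` C = pmod (x (rep C))" using act_pmod[OF x r(1)] r(2) by simp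
  ultimately show ?thesis using J2_sym[OF pmod_diff_pmod[of "x (rep C)"]] x r(1) by simp
qed

text \<open>Take the identity minus a linear projection onto J^2. Composition with it makes maps
  that are additive modulo J^2 additive, without changing them modulo J^2.\<close>

lemma linear_section:
  obtains \<sigma> where "\<And>a b. \<sigma> (a + b) = \<sigma> a + \<sigma> b" "\<And>a. a \<in> J 2 \<Longrightarrow> \<sigma> a = 0" "\<And>a. \<sigma> a - a \<in> J 2"
proof -
  interpret vp: vector_space_pair "fscale :: 'k \<Rightarrow> ('a \<times> ('a \<Rightarrow> 'a) \<Rightarrow> 'k) \<Rightarrow> _"
    "fscale :: 'k \<Rightarrow> ('a \<times> ('a \<Rightarrow> 'a) \<Rightarrow> 'k) \<Rightarrow> _" ..
  have "Vector_Spaces.linear fscale fscale (id :: ('a \<times> ('a \<Rightarrow> 'a) \<Rightarrow> 'k) \<Rightarrow> _)"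
    by (rule fsp.linear_id)
  from vp.linear_exists_left_inverse_on[OF this J_subspace[of 2]]
  obtain g where g: "range g \<subseteq> J 2" "Vector_Spaces.linear fscale fscale g" "\<And>v. v \<in> J 2 \<Longrightarrow> g v = v"
    by auto
  show thesis
  proof (rule that[of "\<lambda>a. a - g a"])
    show "a + b - g (a + b) = (a - g a) + (b - g b)" for a b
      using vp.linear_add[OF g(2), of a b] by simp
    show "a - g a = 0" if "a \<in> J 2" for a using g(3)[OF that] by simp
    show "a - g a - a \<in> J 2" for a using g(1) J_closed(5)[of "g a" 2] by auto
  qed
qed

text \<open>An additive d is a logarithmic derivative: u \<mapsto> u d(u) obeys the product rule on
  the commutative algebra kP, and equivariance lets it extend by zero on the
  \<open>W x\<close>.\<close>

lemma derivation_of_hom: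
  assumes d: "\<And>u. u \<in> carrier P \<Longrightarrow> d u \<in> carrier A" "\<And>u. u \<in> carrier P \<Longrightarrow> pr \<one>\<^sub>E (d u) = d u"
    and d_mult: "\<And>u v. u \<in> carrier P \<Longrightarrow> v \<in> carrier P \<Longrightarrow> d (u \<otimes> v) = d u + d v"
    and d_act: "\<And>x u. x \<in> E \<Longrightarrow> u \<in> carrier P \<Longrightarrow> conjW x (d u) = d (x u)"
  obtains D where "D \<in> derivations A" "\<And>x. x \<in> E \<Longrightarrow> D (W x) = 0"
    "\<And>u. u \<in> carrier P \<Longrightarrow> D (U u) = U u \<star> d u"
proof -
  define D where "D = (\<lambda>a\<in>carrier A. \<Sum>(u, x)\<in>carrier P \<times> E. fscale (a (u, x)) (U u \<star> d u \<star> W x))"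
  have D_apply: "D a = (\<Sum>(u, x)\<in>carrier P \<times> E. fscale (a (u, x)) (U u \<star> d u \<star> W x))" if "a \<in> carrier A" for a
    using that by (simp add: D_def)
  have D_closed: "D a \<in> carrier A" if "a \<in> carrier A" for a
    unfolding D_apply[OF that] by (rule T.A_closed(6)) auto
  have D_add: "D (a + b) = D a + D b" if "a \<in> carrier A" "b \<in> carrier A" for a b
    using that by (simp add: D_apply plus_fun_apply fsp.scale_left_distrib sum.distrib case_prod_unfold)
  have D_fscale: "D (fscale c a) = fscale c (D a)" if "a \<in> carrier A" for a c
    using that by (simp add: D_apply fscale_apply fsp.scale_sum_right case_prod_unfold)
  have D_delta: "D (U u \<star> W x) = U u \<star> d u \<star> W x" if u: "u \<in> carrier P" and x: "x \<in> E" for u x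
  proof -
    have "D (U u \<star> W x) = (\<Sum>g\<in>carrier P \<times> E. if g = (u, x) then U u \<star> d u \<star> W x else 0)"
      unfolding D_apply[OF T.star_closed]
      by (intro sum.cong refl) (use u x in \<open>auto simp: U_W delta_def fsp.scale_zero_left\<close>)
    also have "\<dots> = U u \<star> d u \<star> W x" using u x fin_P fin_E by simp
    finally show ?thesis .
  qed
  have W_d: "W x \<star> d u = d (x u) \<star> W x" if "x \<in> E" "u \<in> carrier P" for x u
    unfolding d_act[OF that, symmetric] using that d(1)[OF that(2)] by (simp add: conjW_def T.star_assoc)
  have d_U: "d u \<star> U v = U v \<star> d u" if "u \<in> carrier P" "v \<in> carrier P" for u v
    using pr_supp[of "\<one>\<^sub>E" v "d u"] d(2)[OF that(1)] that by simp
  have delta_case: "D ((U u \<star> W x) \<star> (U v \<star> W y)) = D (U u \<star> W x) \<star> (U v \<star> W y) + (U u \<star> W x) \<star> D (U v \<star> W y)"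
    if u: "u \<in> carrier P" and x: "x \<in> E" and v: "v \<in> carrier P" and y: "y \<in> E" for u x v y
  proof -
    let ?w = "u \<otimes> x v"
    have w: "?w \<in> carrier P" using u v x by simp
    have WU: "W x \<star> (U v \<star> b) = U (x v) \<star> (W x \<star> b)" for b
      using W_U[OF v x] by (simp add: T.star_assoc[symmetric])
    have "(U u \<star> W x) \<star> (U v \<star> W y) = U ?w \<star> (W x \<star> W y)"
      using u v x by (simp add: T.star_assoc WU) (simp add: T.star_assoc[symmetric] U_mult)
    also have "\<dots> = fscale (\<alpha> x y) (U ?w \<star> W (x \<cdot> y))" using x y by (simp add: W_mult)
    finally have "D ((U u \<star> W x) \<star> (U v \<star> W y)) = fscale (\<alpha> x y) (U ?w \<star> d ?w \<star> W (x \<cdot> y))"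
      using w x y by (simp add: D_fscale D_delta)
    also have "\<dots> = U ?w \<star> d ?w \<star> (W x \<star> W y)" using x y by (simp add: W_mult)
    also have "\<dots> = U ?w \<star> d u \<star> (W x \<star> W y) + U ?w \<star> d (x v) \<star> (W x \<star> W y)"
      using u v x by (simp add: d_mult T.star_add_left T.star_add_right)
    also have "U ?w \<star> d u \<star> (W x \<star> W y) = D (U u \<star> W x) \<star> (U v \<star> W y)"
    proof -
      have "D (U u \<star> W x) \<star> (U v \<star> W y) = U u \<star> (d u \<star> U (x v)) \<star> (W x \<star> W y)"
        using u x v by (simp add: D_delta T.star_assoc WU)
      also have "\<dots> = U u \<star> U (x v) \<star> d u \<star> (W x \<star> W y)"
        using u x v by (simp add: d_U T.star_assoc)
      finally show ?thesis using u x v by (simp add: U_mult)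
    qed
    also have "U ?w \<star> d (x v) \<star> (W x \<star> W y) = (U u \<star> W x) \<star> D (U v \<star> W y)"
    proof -
      have "(U u \<star> W x) \<star> D (U v \<star> W y) = U u \<star> U (x v) \<star> (W x \<star> d v) \<star> W y"
        using v y by (simp add: D_delta T.star_assoc WU)
      also have "\<dots> = U u \<star> U (x v) \<star> d (x v) \<star> (W x \<star> W y)"
        using v x by (simp add: W_d T.star_assoc)
      finally show ?thesis using u x v by (simp add: U_mult)
    qed
    finally show ?thesis .
  qed
  have D_star: "D (a \<star> b) = D a \<star> b + a \<star> D b" if a: "a \<in> carrier A" and b: "b \<in> carrier A" for a b
  proof -
    \<comment> \<open>Both sides of the product rule are linear in each factor, so basis elements
      suffice: the second factor is varied first, then the first one.\<close>
    have submod: "fsp.subspace {c. c \<in> carrier A \<and> D (f c) = g c}"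
      if "\<And>c. f c \<in> carrier A" "\<And>c c'. c \<in> carrier A \<Longrightarrow> c' \<in> carrier A \<Longrightarrow> f (c + c') = f c + f c' \<and> g (c + c') = g c + g c'"
        "\<And>r c. c \<in> carrier A \<Longrightarrow> f (fscale r c) = fscale r (f c) \<and> g (fscale r c) = fscale r (g c)" for f g
    proof -
      have "f 0 = 0" "g 0 = 0" using that(3)[of 0 0] by (simp_all add: fsp.scale_zero_left)
      moreover have "D 0 = 0" using D_fscale[of 0 0] by (simp add: fsp.scale_zero_left)
      ultimately show ?thesis using that by (auto simp: fsp.subspace_def D_add D_fscale)
    qed
    have bas1: "c \<in> carrier A \<and> D ((U u \<star> W x) \<star> c) = D (U u \<star> W x) \<star> c + (U u \<star> W x) \<star> D c"
      if c: "c \<in> carrier A" and u: "u \<in> carrier P" and x: "x \<in> E" for u x c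
      using c
    proof (induction rule: A_induct)
      case (delta v y)
      then show "U v \<star> W y \<in> carrier A \<and> D ((U u \<star> W x) \<star> (U v \<star> W y))
        = D (U u \<star> W x) \<star> (U v \<star> W y) + (U u \<star> W x) \<star> D (U v \<star> W y)"
        using delta_case[OF u x] by simp
    next
      case subspace
      show "fsp.subspace {c. c \<in> carrier A \<and> D ((U u \<star> W x) \<star> c) = D (U u \<star> W x) \<star> c + (U u \<star> W x) \<star> D c}"
        by (rule submod) (auto simp: T.star_add_right D_add D_fscale fsp.scale_right_distrib algebra_simps)
    qed
    have "a \<in> carrier A \<and> D (a \<star> b) = D a \<star> b + a \<star> D b"
      using a
    proof (induction rule: A_induct)
      case (delta u x)
      then show "U u \<star> W x \<in> carrier A \<and> D (U u \<star> W x \<star> b) = D (U u \<star> W x) \<star> b + U u \<star> W x \<star> D b"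
        using bas1[OF b] by simp
    next
      case subspace
      show "fsp.subspace {a. a \<in> carrier A \<and> D (a \<star> b) = D a \<star> b + a \<star> D b}"
        by (rule submod) (auto simp: T.star_add_left D_add D_fscale fsp.scale_right_distrib algebra_simps)
    qed
    then show ?thesis by simp
  qed
  have D: "D \<in> derivations A"
    unfolding derivation_iff using D_closed D_add D_fscale D_star by (auto simp: D_def)
  have d_one: "d \<one> = 0" using d_mult[of \<one> \<one>] by simp
  show thesis
  proof (rule that[OF D])
    fix x assume x: "x \<in> E"
    have "D (W x) = D (U \<one> \<star> W x)" using x by (simp add: U_one)
    then show "D (W x) = 0" using D_delta[of \<one> x] x d_one by simp
  next
    fix u assume u: "u \<in> carrier P"
    have "U u \<star> d u \<star> W \<one>\<^sub>E = D (fscale (\<alpha> \<one>\<^sub>E \<one>\<^sub>E) (U u))"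
      using D_delta[OF u E_closed(1)] u by (simp add: W_one)
    also have "\<dots> = fscale (\<alpha> \<one>\<^sub>E \<one>\<^sub>E) (D (U u))" using u by (simp add: D_fscale)
    finally have "fscale (\<alpha> \<one>\<^sub>E \<one>\<^sub>E) (U u \<star> d u) = fscale (\<alpha> \<one>\<^sub>E \<one>\<^sub>E) (D (U u))"
      by (simp add: W_one)
    then show "D (U u) = U u \<star> d u"
      using cocycle_nonzeroE[of "\<one>\<^sub>E" "\<one>\<^sub>E"] fsp.scale_cancel_left by auto
  qed
qed

text \<open>D preserves kP and induces \<phi> on the image of P/\<Phi>(P) in J/J^2. Staying in
  degree 1 is what later makes an inner lift vanish on P.\<close>

definition lifts where
  "lifts D \<phi> \<longleftrightarrow> D \<in> derivations A \<and> (\<forall>x\<in>E. D (W x) = 0) \<and>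
    (\<forall>u\<in>carrier P. pr \<one>\<^sub>E (D (U u)) = D (U u) \<and> D (U u) - pmod_diff (\<phi> (pmod u)) \<in> J 2)"

lemma lift_endo:
  assumes \<phi>: "FM.fp_endo \<phi>"
  obtains D where "lifts D \<phi>"
proof -
  have \<phi>c: "\<And>C. C \<in> carrier Fq \<Longrightarrow> \<phi> C \<in> carrier Fq"
    and \<phi>m: "\<And>C D. C \<in> carrier Fq \<Longrightarrow> D \<in> carrier Fq \<Longrightarrow> \<phi> (C \<otimes>\<^bsub>Fq\<^esub> D) = \<phi> C \<otimes>\<^bsub>Fq\<^esub> \<phi> D"
    and \<phi>a: "\<And>e C. e \<in> E \<Longrightarrow> C \<in> carrier Fq \<Longrightarrow> \<phi> (e ` C) = e ` \<phi> C"
    using \<phi> unfolding FM.fp_endo_def by auto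
  obtain \<sigma> where \<sigma>: "\<And>a b. \<sigma> (a + b) = \<sigma> a + \<sigma> b" "\<And>a. a \<in> J 2 \<Longrightarrow> \<sigma> a = 0" "\<And>a. \<sigma> a - a \<in> J 2"
    using linear_section by metis
  \<comment> \<open>The section turns \<phi> into an honest homomorphism to \<open>A\<close>, and
    the projection puts its values in degree 1. Equivariance so far holds only modulo J^2.\<close>
  define g where "g u = pr \<one>\<^sub>E (\<sigma> (pmod_diff (\<phi> (pmod u))))" for u
  have \<sigma>_closed: "\<sigma> a \<in> carrier A" if "a \<in> carrier A" for a
    using T.A_closed(2)[OF J_A[OF \<sigma>(3)[of a]] that] by simp
  have g_closed: "g u \<in> carrier A" if "u \<in> carrier P" for u
    unfolding g_def using that by (intro pr_closed \<sigma>_closed pmod_diff_closed \<phi>c pmod_closed)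
  have g_mult: "g (u \<otimes> v) = g u + g v" if uv: "u \<in> carrier P" "v \<in> carrier P" for u v
  proof -
    let ?C = "\<phi> (pmod u)" and ?D = "\<phi> (pmod v)"
    have "\<phi> (pmod (u \<otimes> v)) = ?C \<otimes>\<^bsub>Fq\<^esub> ?D" using uv \<phi>m by (simp add: pmod_mult[symmetric])
    moreover have "\<sigma> (pmod_diff (?C \<otimes>\<^bsub>Fq\<^esub> ?D)) = \<sigma> (pmod_diff ?C) + \<sigma> (pmod_diff ?D)"
    proof -
      let ?j = "pmod_diff (?C \<otimes>\<^bsub>Fq\<^esub> ?D) - pmod_diff ?C - pmod_diff ?D"
      have "\<sigma> ?j = 0" using uv \<phi>c by (intro \<sigma>(2) pmod_diff_mult) auto
      moreover have "\<sigma> (?j + (pmod_diff ?C + pmod_diff ?D)) = \<sigma> ?j + (\<sigma> (pmod_diff ?C) + \<sigma> (pmod_diff ?D))"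
        by (simp only: \<sigma>(1))
      ultimately show ?thesis by (simp add: algebra_simps)
    qed
    ultimately show ?thesis by (simp add: g_def pr_linear)
  qed
  have g_J2: "g u - pmod_diff (\<phi> (pmod u)) \<in> J 2" if "u \<in> carrier P" for u
    using pr_J[OF E_closed(1) \<sigma>(3)[of "pmod_diff (\<phi> (pmod u))"]] by (simp add: g_def pr_linear)
  define nE where "nE = inverse (of_nat (card E) :: 'k)"
  \<comment> \<open>Averaging over E makes it equivariant and changes nothing modulo J^2.\<close>
  define d where "d u = fscale nE (\<Sum>x\<in>E. conjW x (g (einv x u)))" for u
  have d_closed: "d u \<in> carrier A" for u
    unfolding d_def by (intro T.A_closed(3,6) conjW_closed)
  have d_mult: "d (u \<otimes> v) = d u + d v" if "u \<in> carrier P" "v \<in> carrier P" for u v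
    unfolding d_def using that
    by (simp add: g_mult conjW_linear sum.distrib fsp.scale_right_distrib)
  have d_act: "conjW y (d u) = d (y u)" if y: "y \<in> E" and u: "u \<in> carrier P" for y u
  proof -
    have "(\<Sum>x\<in>E. conjW (y \<cdot> x) (g (einv x u))) = (\<Sum>z\<in>E. conjW z (g (einv z (y u))))"
    proof (rule sum.reindex_bij_witness[of _ "\<lambda>z. einv y \<cdot> z" "\<lambda>x. y \<cdot> x"])
      fix x assume x: "x \<in> E"
      have "einv (y \<cdot> x) (y u) = einv x u"
        using x y u by (simp add: H.inv_mult act_commute[of "einv x" y])
      then show "conjW (y \<cdot> x) (g (einv (y \<cdot> x) (y u))) = conjW (y \<cdot> x) (g (einv x u))" by simp
    qed (use y in auto)
    then show ?thesis using y by (simp add: d_def conjW_linear conjW_sum conjW_conjW)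
  qed
  have d_pr: "pr \<one>\<^sub>E (d u) = d u" if "u \<in> carrier P" for u
    unfolding d_def pr_linear pr_sum
    by (intro arg_cong[where f = "fscale nE"] sum.cong) (simp_all add: pr_conjW g_def pr_pr)
  have d_J2: "d u - pmod_diff (\<phi> (pmod u)) \<in> J 2" if u: "u \<in> carrier P" for u
  proof -
    have tm: "conjW x (g (einv x u)) - pmod_diff (\<phi> (pmod u)) \<in> J 2" if x: "x \<in> E" for x
    proof -
      let ?v = "einv x u"
      have v: "?v \<in> carrier P" using x u by simp
      have "conjW x (g ?v) - conjW x (pmod_diff (\<phi> (pmod ?v))) \<in> J 2"
        using conjW_J[OF x g_J2[OF v]] by (simp add: conjW_linear)
      moreover have "conjW x (pmod_diff (\<phi> (pmod ?v))) - pmod_diff (x ` \<phi> (pmod ?v)) \<in> J 2"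
        using v \<phi>c by (intro conjW_pmod_diff x) auto
      moreover have "x ` \<phi> (pmod ?v) = \<phi> (pmod u)"
        using \<phi>a[OF x pmod_closed[OF v]] act_pmod[OF x v] x u by simp
      ultimately show ?thesis using J2_trans by metis
    qed
    have "fscale nE (\<Sum>x\<in>E. conjW x (g (einv x u)) - pmod_diff (\<phi> (pmod u))) \<in> J 2"
      using tm by (intro J_closed(3,6)) auto
    also have "fscale nE (\<Sum>x\<in>E. conjW x (g (einv x u)) - pmod_diff (\<phi> (pmod u)))
      = d u - fscale nE (fscale (of_nat (card E)) (pmod_diff (\<phi> (pmod u))))"
      by (simp add: d_def sum_subtractf fsp.scale_right_diff_distrib fsp.sum_constant_scale del: sum_constant fsp.scale_scale)
    also have "fscale nE (fscale (of_nat (card E)) (pmod_diff (\<phi> (pmod u)))) = pmod_diff (\<phi> (pmod u))"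
      using card_E_nz by (simp add: nE_def)
    finally show ?thesis .
  qed
  obtain D where D: "D \<in> derivations A" "\<And>x. x \<in> E \<Longrightarrow> D (W x) = 0"
    "\<And>u. u \<in> carrier P \<Longrightarrow> D (U u) = U u \<star> d u"
    using derivation_of_hom[OF d_closed d_pr d_mult d_act] by blast
  have "D (U u) - pmod_diff (\<phi> (pmod u)) \<in> J 2" if u: "u \<in> carrier P" for u
  proof -
    have "d u - pmod_diff (\<phi> (pmod u)) \<in> J 1" using d_J2[OF u] J_mono[of 1 2] by auto
    moreover have "pmod_diff (\<phi> (pmod u)) \<in> J 1" using u \<phi>c by (intro pmod_diff_J1) auto
    ultimately have "d u \<in> J 1" using J_closed(2) by fastforce
    then have "U u \<star> d u - d u \<in> J 2" using J_gen[OF u, of "d u" 1] by (simp add: numeral_2_eq_2)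
    from J2_trans[OF this d_J2[OF u]] show ?thesis using D(3)[OF u] by simp
  qed
  moreover have "pr \<one>\<^sub>E (D (U u)) = D (U u)" if "u \<in> carrier P" for u
    using that D(3) d_pr by (simp add: pr_U_star)
  ultimately have "lifts D \<phi>" using D by (simp add: lifts_def)
  then show thesis by (rule that)
qed

lemma lifts_J1:
  assumes D: "lifts D \<phi>" and \<phi>: "\<And>C. C \<in> carrier Fq \<Longrightarrow> \<phi> C \<in> carrier Fq" and a: "a \<in> carrier A"
  shows "D a \<in> J 1"
proof (rule der_vanish[OF _ _ a])
  fix u assume u: "u \<in> carrier P"
  have "D (U u) - pmod_diff (\<phi> (pmod u)) \<in> J 1" using D u J_mono[of 1 2] by (auto simp: lifts_def)
  moreover have "pmod_diff (\<phi> (pmod u)) \<in> J 1" using u \<phi> by (intro pmod_diff_J1) auto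
  ultimately show "D (U u) \<in> J 1" using J_closed(2) by fastforce
qed (use D in \<open>auto simp: lifts_def\<close>)

text \<open>Needed for brackets of lifts to stay in kP. The detour through \<open>pr\<close> allows
  induction over the basis of the whole algebra, where degrees other than 1 contribute zero.\<close>

lemma lifts_pr:
  assumes D: "lifts D \<phi>" and a: "a \<in> carrier A"
  shows "pr \<one>\<^sub>E (D (pr \<one>\<^sub>E a)) = D (pr \<one>\<^sub>E a)"
proof -
  have d: "D \<in> derivations A" using D by (simp add: lifts_def)
  have "a \<in> carrier A \<and> pr \<one>\<^sub>E (D (pr \<one>\<^sub>E a)) = D (pr \<one>\<^sub>E a)" using a
  proof (induction rule: A_induct)
    case (delta u x)
    have "pr \<one>\<^sub>E (D (pr \<one>\<^sub>E (U u \<star> W x))) = D (pr \<one>\<^sub>E (U u \<star> W x))"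
    proof (cases "x = \<one>\<^sub>E")
      case True
      then show ?thesis using delta D d by (simp add: W_one pr_linear der_fscale lifts_def)
    next
      case False
      then have "pr \<one>\<^sub>E (U u \<star> W x) = 0"
      proof (intro ext)
        fix g show "pr \<one>\<^sub>E (U u \<star> W x) g = 0 g"
          using delta False by (cases g) (auto simp: U_W delta_def zero_fun_apply)
      qed
      then show ?thesis by (simp add: der_zero[OF d] pr_linear)
    qed
    then show "U u \<star> W x \<in> carrier A \<and> pr \<one>\<^sub>E (D (pr \<one>\<^sub>E (U u \<star> W x))) = D (pr \<one>\<^sub>E (U u \<star> W x))" by simp
  next
    case subspace
    show "fsp.subspace {a. a \<in> carrier A \<and> pr \<one>\<^sub>E (D (pr \<one>\<^sub>E a)) = D (pr \<one>\<^sub>E a)}"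
      by (auto simp: fsp.subspace_def pr_linear der_zero[OF d] der_add[OF d] der_fscale[OF d])
  qed
  then show ?thesis by simp
qed

text \<open>P/\<Phi>(P) is written multiplicatively, so the commutator of \<phi> and \<psi> is
  formed in J/J^2, as a difference of \<open>pmod_diff\<close> values.\<close>

lemma lifts_bracket:
  assumes D: "lifts D \<phi>" and D': "lifts D' \<psi>"
    and \<phi>: "\<And>C. C \<in> carrier Fq \<Longrightarrow> \<phi> C \<in> carrier Fq" and \<psi>: "\<And>C. C \<in> carrier Fq \<Longrightarrow> \<psi> C \<in> carrier Fq"
    and u: "u \<in> carrier P"
  shows "bracket D D' (U u) - (pmod_diff (\<phi> (\<psi> (pmod u))) - pmod_diff (\<psi> (\<phi> (pmod u)))) \<in> J 2"
proof -
  have main: "D (D' (U u)) - pmod_diff (\<phi> (\<psi> (pmod u))) \<in> J 2"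
    if D: "lifts D \<phi>" and D': "lifts D' \<psi>"
    and \<phi>: "\<And>C. C \<in> carrier Fq \<Longrightarrow> \<phi> C \<in> carrier Fq" and \<psi>: "\<And>C. C \<in> carrier Fq \<Longrightarrow> \<psi> C \<in> carrier Fq"
    for D D' \<phi> \<psi>
  proof -
    have d: "D \<in> derivations A" "D' \<in> derivations A" using D D' by (simp_all add: lifts_def)
    let ?C = "\<psi> (pmod u)"
    have C: "?C \<in> carrier Fq" using \<psi> u by simp
    then have r: "rep ?C \<in> carrier P" "pmod (rep ?C) = ?C" using rep by auto
    have "D (D' (U u) - pmod_diff ?C) \<in> J (2 + 0)"
    proof (rule der_J[OF d(1)])
      show "D a \<in> J (Suc 0)" if "a \<in> carrier A" for a using lifts_J1[OF D \<phi> that] by simp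
    qed (use D' u in \<open>simp add: lifts_def\<close>)
    then have "D (D' (U u)) - D (pmod_diff ?C) \<in> J 2"
      using d u pmod_diff_closed[OF C] by (simp add: der_diff)
    moreover have "D (pmod_diff ?C) = D (U (rep ?C))"
      using r d by (simp add: pmod_diff_def der_diff der_one)
    moreover have "D (U (rep ?C)) - pmod_diff (\<phi> ?C) \<in> J 2" using D r by (auto simp: lifts_def)
    ultimately show ?thesis using J2_trans by metis
  qed
  have "bracket D D' (U u) - (pmod_diff (\<phi> (\<psi> (pmod u))) - pmod_diff (\<psi> (\<phi> (pmod u))))
    = (D (D' (U u)) - pmod_diff (\<phi> (\<psi> (pmod u)))) - (D' (D (U u)) - pmod_diff (\<psi> (\<phi> (pmod u))))"
    using u by (simp add: bracket_apply)
  then show ?thesis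
    using J_closed(4)[OF main[OF D D' \<phi> \<psi>] main[OF D' D \<psi> \<phi>]] by (simp only:)
qed

text \<open>The scalar allows division by 2, so that e and f themselves, and not 2e and 2f, are
  recovered from brackets.\<close>

lemma bracket_lifts:
  assumes D: "lifts D \<phi>" and D': "lifts D' \<psi>"
    and \<phi>: "\<And>C. C \<in> carrier Fq \<Longrightarrow> \<phi> C \<in> carrier Fq" and \<psi>: "\<And>C. C \<in> carrier Fq \<Longrightarrow> \<psi> C \<in> carrier Fq"
    and \<chi>: "\<And>u. u \<in> carrier P \<Longrightarrow>
      fscale c (pmod_diff (\<phi> (\<psi> (pmod u))) - pmod_diff (\<psi> (\<phi> (pmod u)))) - pmod_diff (\<chi> (pmod u)) \<in> J 2"
  shows "lifts (der_scale c (bracket D D')) \<chi>"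
proof -
  have d: "D \<in> derivations A" "D' \<in> derivations A" using D D' by (simp_all add: lifts_def)
  have ap: "der_scale c (bracket D D') a = fscale c (D (D' a) - D' (D a))" if "a \<in> carrier A" for a
    using that by (simp add: der_scale_def bracket_apply)
  show ?thesis
    unfolding lifts_def
  proof (intro conjI ballI)
    show "der_scale c (bracket D D') \<in> derivations A" by (intro der_scale_der bracket_der d)
    show "der_scale c (bracket D D') (W x) = 0" if "x \<in> E" for x
      using that D D' by (simp add: ap lifts_def der_zero)
    fix u assume u: "u \<in> carrier P"
    have "pr \<one>\<^sub>E (D (D' (U u))) = D (D' (U u))"
      using lifts_pr[OF D, of "D' (U u)"] D' u d by (simp add: lifts_def)
    moreover have "pr \<one>\<^sub>E (D' (D (U u))) = D' (D (U u))"
      using lifts_pr[OF D', of "D (U u)"] D u d by (simp add: lifts_def)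
    ultimately show "pr \<one>\<^sub>E (der_scale c (bracket D D') (U u)) = der_scale c (bracket D D') (U u)"
      using u by (simp add: ap pr_linear)
    have "fscale c (bracket D D' (U u)) - fscale c (pmod_diff (\<phi> (\<psi> (pmod u))) - pmod_diff (\<psi> (\<phi> (pmod u)))) \<in> J 2"
      using J_closed(3)[OF lifts_bracket[OF D D' \<phi> \<psi> u], of c] by (simp add: fsp.scale_right_diff_distrib)
    from J2_trans[OF this \<chi>[OF u]]
    show "der_scale c (bracket D D') (U u) - pmod_diff (\<chi> (pmod u)) \<in> J 2" using u by (simp add: der_scale_def)
  qed
qed

lemma lie_span_scale: "x \<in> Z \<Longrightarrow> lie_scale L c x \<in> lie_span L Z"
  unfolding lie_span_def lie_subspace_def by blast

lemma derived_bracket: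
  assumes "D \<in> derivations A" "D' \<in> derivations A" "cls D \<in> Z" "cls D' \<in> Z"
  shows "cls (der_scale c (bracket D D')) \<in> lie_derived HH Z"
proof -
  have "lie_scale HH c (lie_bracket HH (cls D) (cls D')) \<in> lie_derived HH Z"
    unfolding lie_derived_def using assms(3,4) by (intro lie_span_scale) blast
  then show ?thesis using assms(1,2) bracket_der by (simp add: HH_bracket HH_scale)
qed

lemma multiplicity_free_of_solvable:
  assumes odd: "odd p" and solv: "lie_solvable HH"
  shows "multiplicity_free (FpE p P E) (frattini_quotient p P E)"
proof (rule ccontr)
  assume "\<not> multiplicity_free (FpE p P E) (frattini_quotient p P E)"
  then have not_mf: "\<not> multiplicity_free FM.R FM.fpM" by (simp add: FpE_eq frattini_quotient_eq)
  obtain e f h where efh: "FM.fp_endo e" "FM.fp_endo f" "FM.fp_endo h"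
    and rel: "\<And>x. x \<in> carrier Fq \<Longrightarrow> e (f x) = h x \<otimes>\<^bsub>Fq\<^esub> f (e x)"
    "\<And>x. x \<in> carrier Fq \<Longrightarrow> h (e x) = (e x \<otimes>\<^bsub>Fq\<^esub> e x) \<otimes>\<^bsub>Fq\<^esub> e (h x)"
    "\<And>x. x \<in> carrier Fq \<Longrightarrow> f (h x) = (f x \<otimes>\<^bsub>Fq\<^esub> f x) \<otimes>\<^bsub>Fq\<^esub> h (f x)"
    and e_nz: "\<exists>x\<in>carrier Fq. e x \<noteq> \<one>\<^bsub>Fq\<^esub>"
  proof (rule FM.sl2_of_not_multiplicity_free[OF not_mf])
    fix e f h
    assume "FM.fp_endo e" "FM.fp_endo f" "FM.fp_endo h"
      "\<And>x. x \<in> carrier Fq \<Longrightarrow> e (f x) = h x \<otimes>\<^bsub>Fq\<^esub> f (e x)"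
      "\<And>x. x \<in> carrier Fq \<Longrightarrow> h (e x) = (e x \<otimes>\<^bsub>Fq\<^esub> e x) \<otimes>\<^bsub>Fq\<^esub> e (h x)"
      "\<And>x. x \<in> carrier Fq \<Longrightarrow> f (h x) = (f x \<otimes>\<^bsub>Fq\<^esub> f x) \<otimes>\<^bsub>Fq\<^esub> h (f x)"
      "\<exists>x\<in>carrier Fq. e x \<noteq> \<one>\<^bsub>Fq\<^esub>"
    then show thesis by (rule that)
  qed
  have ec: "\<And>C. C \<in> carrier Fq \<Longrightarrow> e C \<in> carrier Fq" and fc: "\<And>C. C \<in> carrier Fq \<Longrightarrow> f C \<in> carrier Fq"
    and hc: "\<And>C. C \<in> carrier Fq \<Longrightarrow> h C \<in> carrier Fq"
    using efh by (auto simp: FM.fp_endo_def)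
  have "p \<noteq> 2" "p \<noteq> 1" using odd prime_p by auto
  then have "\<not> p dvd 2" by (metis primes_dvd_imp_eq prime_p two_is_prime_nat)
  then have two: "(2 :: 'k) \<noteq> 0" using of_nat_eq_0_iff_char_dvd[of 2, where 'a = 'k] char_p by simp
  define c where "c = inverse (2 :: 'k)"
  \<comment> \<open>The multiplicative relation says that A' - B' is 2C modulo J^2; dividing by 2 is
    where odd p enters.\<close>
  have half: "fscale c (pmod_diff A' - pmod_diff B') - pmod_diff C \<in> J 2"
    if "A' = (C \<otimes>\<^bsub>Fq\<^esub> C) \<otimes>\<^bsub>Fq\<^esub> B'" "C \<in> carrier Fq" "B' \<in> carrier Fq" for A' B' C
  proof -
    have "(pmod_diff A' - pmod_diff (C \<otimes>\<^bsub>Fq\<^esub> C) - pmod_diff B') + (pmod_diff (C \<otimes>\<^bsub>Fq\<^esub> C) - pmod_diff C - pmod_diff C) \<in> J 2"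
      unfolding that(1) using that(2,3) by (intro J_closed(2) pmod_diff_mult) auto
    also have "(pmod_diff A' - pmod_diff (C \<otimes>\<^bsub>Fq\<^esub> C) - pmod_diff B') + (pmod_diff (C \<otimes>\<^bsub>Fq\<^esub> C) - pmod_diff C - pmod_diff C)
      = (pmod_diff A' - pmod_diff B') - fscale 2 (pmod_diff C)"
      by (auto simp: fun_eq_iff fun_apply)
    finally have "fscale c ((pmod_diff A' - pmod_diff B') - fscale 2 (pmod_diff C)) \<in> J 2" by (rule J_closed(3))
    then have "fscale c (pmod_diff A' - pmod_diff B') - fscale c (fscale 2 (pmod_diff C)) \<in> J 2"
      by (subst (asm) fsp.scale_right_diff_distrib)
    also have "fscale c (fscale 2 (pmod_diff C)) = pmod_diff C" using two by (simp add: c_def)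
    finally show ?thesis .
  qed
  \<comment> \<open>All three endomorphisms persist in every derived term: e = [h,e]/2, f = [f,h]/2
    and h = [e,f].\<close>
  have step: "(\<exists>D. lifts D e \<and> cls D \<in> (lie_derived HH ^^ n) (carrier HH)) \<and>
    (\<exists>D. lifts D f \<and> cls D \<in> (lie_derived HH ^^ n) (carrier HH)) \<and>
    (\<exists>D. lifts D h \<and> cls D \<in> (lie_derived HH ^^ n) (carrier HH))" for n
  proof (induction n)
    case 0
    have "\<exists>D. lifts D \<phi> \<and> cls D \<in> carrier HH" if "FM.fp_endo \<phi>" for \<phi>
      using lift_endo[OF that] HH_carrier by (metis lifts_def imageI)
    then show ?case using efh by simp
  next
    case (Suc n)
    let ?Z = "(lie_derived HH ^^ n) (carrier HH)"
    obtain De Df Dh where D: "lifts De e" "cls De \<in> ?Z" "lifts Df f" "cls Df \<in> ?Z" "lifts Dh h" "cls Dh \<in> ?Z"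
      using Suc.IH by blast
    then have d: "De \<in> derivations A" "Df \<in> derivations A" "Dh \<in> derivations A" by (simp_all add: lifts_def)
    have "lifts (der_scale c (bracket Dh De)) e"
      by (rule bracket_lifts[OF D(5,1) hc ec]) (use half rel(2) ec hc in auto)
    moreover have "lifts (der_scale c (bracket Df Dh)) f"
      by (rule bracket_lifts[OF D(3,5) fc hc]) (use half rel(3) fc hc in auto)
    moreover have "lifts (der_scale 1 (bracket De Df)) h"
    proof (rule bracket_lifts[OF D(1,3) ec fc])
      fix u assume u: "u \<in> carrier P"
      have "pmod_diff (h (pmod u) \<otimes>\<^bsub>Fq\<^esub> f (e (pmod u))) - pmod_diff (h (pmod u)) - pmod_diff (f (e (pmod u))) \<in> J 2"
        using u ec fc hc by (intro pmod_diff_mult) auto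
      then show "fscale 1 (pmod_diff (e (f (pmod u))) - pmod_diff (f (e (pmod u)))) - pmod_diff (h (pmod u)) \<in> J 2"
        using rel(1)[of "pmod u"] u by (simp add: algebra_simps)
    qed
    moreover have "cls (der_scale c (bracket Dh De)) \<in> lie_derived HH ?Z" "cls (der_scale c (bracket Df Dh)) \<in> lie_derived HH ?Z"
      "cls (der_scale 1 (bracket De Df)) \<in> lie_derived HH ?Z"
      using D d by (auto intro!: derived_bracket)
    ultimately show ?case by (simp del: funpow.simps add: funpow.simps(2)) blast
  qed
  obtain n where n: "(lie_derived HH ^^ n) (carrier HH) = {lie_zero HH}"
    using solv unfolding lie_solvable_def by blast
  obtain D where D: "lifts D e" "cls D = cls (\<lambda>a\<in>carrier A. 0)"
    using step[of n] unfolding n HH_zero by blast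
  have d: "D \<in> derivations A" using D(1) by (simp add: lifts_def)
  have "inner_eq (\<lambda>a\<in>carrier A. 0) D" using cls_eq_iff[OF zero_der d] D(2) by simp
  then obtain k where k: "k \<in> carrier A" "\<And>a. a \<in> carrier A \<Longrightarrow> D a = ad k a"
    unfolding inner_eq_def by auto
  \<comment> \<open>The lift of e is now inner, given by k. Its values on P have degree 1, so only
    the degree 1 part of k contributes, and that part commutes with kP.\<close>
  have DU: "D (U u) = 0" if u: "u \<in> carrier P" for u
  proof -
    have "pr \<one>\<^sub>E (D (U u)) = pr \<one>\<^sub>E k \<star> U u - U u \<star> pr \<one>\<^sub>E k"
      using u k by (simp add: ad_def pr_linear pr_star_U pr_U_star)
    also have "\<dots> = 0" using pr_supp[of "\<one>\<^sub>E" u k] u by simp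
    finally show ?thesis using D(1) u by (simp add: lifts_def)
  qed
  obtain C where C: "C \<in> carrier Fq" "e C \<noteq> \<one>\<^bsub>Fq\<^esub>" using e_nz by blast
  obtain u where u: "u \<in> carrier P" "C = pmod u" using C(1) by (auto simp: Fq_carrier)
  \<comment> \<open>Hence e(C) has zero image in J/J^2, against the injectivity of P/\<Phi>(P) into
    J/J^2.\<close>
  have "D (U u) - pmod_diff (e C) \<in> J 2" using D(1) u by (simp add: lifts_def)
  then have "pmod_diff (e C) \<in> J 2" using DU[OF u(1)] J_closed(5)[of "- pmod_diff (e C)" 2] by simp
  moreover have r: "rep (e C) \<in> carrier P" "e C = pmod (rep (e C))" using rep[OF ec[OF C(1)]] by auto
  ultimately have "rep (e C) \<in> pth_powers" by (intro U_minus_one_J2) (simp_all add: pmod_diff_def)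
  then show False using r C(2) pmod_eq_one_iff by metis
qed

end

theorem theorem1p3:
  fixes P :: "('a, 'm) monoid_scheme"
    and E :: "('a \<Rightarrow> 'a) set"
    and \<alpha> :: "('a \<Rightarrow> 'a) \<Rightarrow> ('a \<Rightarrow> 'a) \<Rightarrow> 'k::field"
    and p :: nat
  assumes "Factorial_Ring.prime p"
    and "CHAR('k) = p"
    and "comm_group P" and "finite (carrier P)" and "\<exists>n. order P = p ^ n"
    and "carrier P \<noteq> {\<one>\<^bsub>P\<^esub>}"
    and "subgroup E (AutoGroup P)" and "comm_group (aut_group P E)" and "coprime (card E) p"
    and "two_cocycle (aut_group P E) \<alpha>"
    and "comm_aut P E = carrier P"
  shows "(\<forall>C\<in>carrier (HH1 (twisted_semidirect P E \<alpha>)).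
            \<exists>D\<in>C. D ` carrier (twisted_semidirect P E \<alpha>)
                   \<subseteq> jacobson_radical (twisted_semidirect P E \<alpha>))
       \<and> (multiplicity_free (FpE p P E) (frattini_quotient p P E) \<longrightarrow>
            lie_solvable (HH1 (twisted_semidirect P E \<alpha>)))
       \<and> (odd p \<and> lie_solvable (HH1 (twisted_semidirect P E \<alpha>)) \<longrightarrow>
            multiplicity_free (FpE p P E) (frattini_quotient p P E))"
proof -
  interpret p_setting P E \<alpha> p
    by (intro p_setting.intro p_setting_axioms.intro assms)
  show ?thesis
    using HH1_represented_in_radical solvable_of_multiplicity_free multiplicity_free_of_solvable by blast
qed

end
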